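(* Let $\Gamma$ be a tropical curve and $D$ a divisor on $\Gamma$ with $r(D)\ge 0$. Then $D$ is very ample if and only if the map $\mathrm{Red}:\Gamma\to|D|$, $P\mapsto D_P$, is injective.
   Context: A tropical curve $\Gamma$ is a compact connected metric graph (a finite connected graph, loops and multiple edges allowed, whose edges are identified with closed intervals of positive lengths). A divisor is a finite formal integer combination $D=\sum_v D(v)(v)$ of points; $D\ge 0$ means all coefficients are non-negative. A rational function is a continuous piecewise linear $f:\Gamma\to\mathbb R$ with integer slopes and finitely many pieces on each edge; $\mathrm{div}(f)=\sum_v \mathrm{ord}_v(f)(v)$, where $\mathrm{ord}_v(f)$ is the sum of the outgoing slopes of $f$ at $v$. $D\sim D'$ if $D-D'=\mathrm{div}(f)$. $|D|=\{E\ge0:E\sim D\}$, $R(D)=\{f \text{ rational}: D+\mathrm{div}(f)\ge 0\}$, and $r(D)=\min\{\deg(E):E\ge0,\ |D-E|=\emptyset\}-1$. For a closed connected $X\subseteq\Gamma$ and $v\in\partial X$, $\deg^{\mathrm{out}}_X(v)$ is the maximum number of internally disjoint segments in $\Gamma\setminus(X\setminus\{v\})$ with an endpoint at $v$. A divisor $D'$ is $P$-reduced if $D'(v)\ge 0$ for $v\neq P$ and every closed connected $X$ not containing $P$ has a boundary point $v$ with $D'(v)<\deg^{\mathrm{out}}_X(v)$; every divisor $D$ is linearly equivalent to a unique $P$-reduced divisor $D_P$. A divisor $D$ is very ample if for all points $P\ne Q$ of $\Gamma$ there exist $f,g\in R(D)$ with $f(P)-g(P)\ne f(Q)-g(Q)$.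 *)

theory Defs
  imports "HOL-Analysis.Analysis" "Graph_Theory.Digraph_Component"
begin

text \<open>
  A tropical curve is given by a finite connected multigraph \<open>G\<close> (loops and parallel arcs allowed)
  and a positive length for every arc. The orientation of the arcs only fixes a coordinate on each
  edge: \<open>Inner e t\<close> is the point at distance \<open>t\<close> from the tail of \<open>e\<close>, with \<open>0 < t < len e\<close>.
\<close>

datatype ('v, 'e) curve_point = Vertex 'v | Inner 'e real

locale tropical_curve = fin_digraph G for G :: "('v, 'e) pre_digraph" +
  fixes len :: "'e \<Rightarrow> real"
  assumes connected_curve: "Digraph_Component.connected G"
    and len_pos: "e \<in> arcs G \<Longrightarrow> 0 < len e"
begin

subsection \<open>Points and topology\<close>

definition points :: "('v, 'e) curve_point set" where
  "points = Vertex ` verts G \<union> {Inner e t | e t. e \<in> arcs G \<and> 0 < t \<and> t < len e}"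

text \<open>The map from the closed interval \<open>{0..len e}\<close> to the closed edge \<open>e\<close>.\<close>

definition edge_pt :: "'e \<Rightarrow> real \<Rightarrow> ('v, 'e) curve_point" where
  "edge_pt e t =
     (if t \<le> 0 then Vertex (tail G e) else if len e \<le> t then Vertex (head G e) else Inner e t)"

text \<open>The quotient topology obtained by gluing the closed intervals at the vertices; as the graph is
  finite, this is also the topology of the path metric.\<close>

definition curve_topology :: "('v, 'e) curve_point topology" where
  "curve_topology = topology (\<lambda>U. U \<subseteq> points \<and>
     (\<forall>e\<in>arcs G. openin (top_of_set {0..len e}) {t \<in> {0..len e}. edge_pt e t \<in> U}))"

lemma edge_pt_in_points:
  "e \<in> arcs G \<Longrightarrow> edge_pt e t \<in> points"
  by (auto simp: edge_pt_def points_def)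

lemma openin_curve_topology:
  "openin curve_topology U \<longleftrightarrow> U \<subseteq> points \<and>
     (\<forall>e\<in>arcs G. openin (top_of_set {0..len e}) {t \<in> {0..len e}. edge_pt e t \<in> U})"
proof -
  let ?pre = "\<lambda>e U. {t \<in> {0..len e}. edge_pt e t \<in> U}"
  have inter: "openin (top_of_set {0..len e}) (?pre e (S \<inter> T))"
    if "openin (top_of_set {0..len e}) (?pre e S)" "openin (top_of_set {0..len e}) (?pre e T)"
    for e S T
  proof -
    have "?pre e (S \<inter> T) = ?pre e S \<inter> ?pre e T" by blast
    then show ?thesis using openin_Int[OF that] by simp
  qed
  have union: "openin (top_of_set {0..len e}) (?pre e (\<Union>K))"
    if "\<And>U. U \<in> K \<Longrightarrow> openin (top_of_set {0..len e}) (?pre e U)" for e K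
  proof -
    have "openin (top_of_set {0..len e}) (\<Union>U\<in>K. ?pre e U)" using that by blast
    moreover have "?pre e (\<Union>K) = (\<Union>U\<in>K. ?pre e U)" by blast
    ultimately show ?thesis by argo
  qed
  have "istopology (\<lambda>U. U \<subseteq> points \<and> (\<forall>e\<in>arcs G. openin (top_of_set {0..len e}) (?pre e U)))"
    unfolding istopology_def
    by (intro conjI allI impI ballI inter union) (blast | simp)+
  then show ?thesis
    unfolding curve_topology_def by (simp add: topology_inverse')
qed

lemma topspace_curve_topology: "topspace curve_topology = points"
proof
  show "topspace curve_topology \<subseteq> points"
    using openin_topspace[of curve_topology] openin_curve_topology by blast
  have "{t \<in> {0..len e}. edge_pt e t \<in> points} = {0..len e}" if "e \<in> arcs G" for e
    using that edge_pt_in_points by blast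
  then have "openin curve_topology points"
    by (auto simp: openin_curve_topology)
  then show "points \<subseteq> topspace curve_topology"
    by (rule openin_subset)
qed

subsection \<open>Divisors and rational functions\<close>

text \<open>A divisor is represented by its coefficient function, which vanishes off the curve.\<close>

definition is_divisor :: "(('v, 'e) curve_point \<Rightarrow> int) \<Rightarrow> bool" where
  "is_divisor D \<longleftrightarrow> finite {x. D x \<noteq> 0} \<and> {x. D x \<noteq> 0} \<subseteq> points"

definition effective :: "(('v, 'e) curve_point \<Rightarrow> int) \<Rightarrow> bool" where
  "effective D \<longleftrightarrow> (\<forall>x. 0 \<le> D x)"

definition deg :: "(('v, 'e) curve_point \<Rightarrow> int) \<Rightarrow> int" where
  "deg D = (\<Sum>x | D x \<noteq> 0. D x)"

text \<open>Continuity on every closed edge is continuity for the quotient topology. Only the values on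
  \<^term>\<open>points\<close> matter.\<close>

definition rational_function :: "(('v, 'e) curve_point \<Rightarrow> real) \<Rightarrow> bool" where
  "rational_function f \<longleftrightarrow>
     (\<forall>e\<in>arcs G. continuous_on {0..len e} (\<lambda>t. f (edge_pt e t)) \<and>
       (\<exists>B. finite B \<and>
         (\<forall>a b. 0 \<le> a \<and> a < b \<and> b \<le> len e \<and> {a<..<b} \<inter> B = {} \<longrightarrow>
           (\<exists>(m::int) c. \<forall>t\<in>{a<..<b}. f (edge_pt e t) = of_int m * t + c))))"

text \<open>The outgoing slope of \<open>f\<close> at the point with coordinate \<open>t\<close> on the edge \<open>e\<close>, towards the head
  of \<open>e\<close> if \<open>d = 1\<close> and towards its tail if \<open>d = -1\<close>.\<close>

definition slope :: "(('v, 'e) curve_point \<Rightarrow> real) \<Rightarrow> 'e \<Rightarrow> real \<Rightarrow> real \<Rightarrow> int" where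
  "slope f e t d = (THE m. \<forall>\<^sub>F s in at_right 0. f (edge_pt e (t + d * s)) = f (edge_pt e t) + of_int m * s)"

text \<open>A loop contributes two outgoing directions at its vertex.\<close>

definition ord_at :: "(('v, 'e) curve_point \<Rightarrow> real) \<Rightarrow> ('v, 'e) curve_point \<Rightarrow> int" where
  "ord_at f x = (case x of
       Vertex v \<Rightarrow> (\<Sum>e\<in>out_arcs G v. slope f e 0 1) + (\<Sum>e\<in>in_arcs G v. slope f e (len e) (-1))
     | Inner e t \<Rightarrow> slope f e t 1 + slope f e t (-1))"

definition div_of :: "(('v, 'e) curve_point \<Rightarrow> real) \<Rightarrow> ('v, 'e) curve_point \<Rightarrow> int" where
  "div_of f x = (if x \<in> points then ord_at f x else 0)"

definition lin_equiv ::
  "(('v, 'e) curve_point \<Rightarrow> int) \<Rightarrow> (('v, 'e) curve_point \<Rightarrow> int) \<Rightarrow> bool" where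
  "lin_equiv D D' \<longleftrightarrow> (\<exists>f. rational_function f \<and> (\<forall>x. D x - D' x = div_of f x))"

definition linear_system ::
  "(('v, 'e) curve_point \<Rightarrow> int) \<Rightarrow> (('v, 'e) curve_point \<Rightarrow> int) set" where
  "linear_system D = {E. is_divisor E \<and> effective E \<and> lin_equiv E D}"

definition R_space ::
  "(('v, 'e) curve_point \<Rightarrow> int) \<Rightarrow> (('v, 'e) curve_point \<Rightarrow> real) set" where
  "R_space D = {f. rational_function f \<and> effective (\<lambda>x. D x + div_of f x)}"

definition divisor_rank :: "(('v, 'e) curve_point \<Rightarrow> int) \<Rightarrow> int" where
  "divisor_rank D =
     int (LEAST n. \<exists>E. is_divisor E \<and> effective E \<and> deg E = int n \<and>
            linear_system (\<lambda>x. D x - E x) = {}) - 1"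

definition very_ample :: "(('v, 'e) curve_point \<Rightarrow> int) \<Rightarrow> bool" where
  "very_ample D \<longleftrightarrow>
     (\<forall>P\<in>points. \<forall>Q\<in>points. P \<noteq> Q \<longrightarrow>
        (\<exists>f\<in>R_space D. \<exists>g\<in>R_space D. f P - g P \<noteq> f Q - g Q))"

subsection \<open>Reduced divisors\<close>

text \<open>A segment is (parametrised by) a homeomorphic embedding of the unit interval.\<close>

definition segment_path :: "(real \<Rightarrow> ('v, 'e) curve_point) \<Rightarrow> bool" where
  "segment_path \<gamma> \<longleftrightarrow> embedding_map (top_of_set {0..1}) curve_topology \<gamma>"

definition outdeg :: "('v, 'e) curve_point set \<Rightarrow> ('v, 'e) curve_point \<Rightarrow> nat" where
  "outdeg X v = Max {n. \<exists>\<gamma> :: nat \<Rightarrow> real \<Rightarrow> ('v, 'e) curve_point.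
     (\<forall>i<n. segment_path (\<gamma> i) \<and> \<gamma> i 0 = v \<and> \<gamma> i ` {0..1} \<subseteq> points - (X - {v})) \<and>
     (\<forall>i<n. \<forall>j<n. i \<noteq> j \<longrightarrow> \<gamma> i ` {0<..<1} \<inter> \<gamma> j ` {0<..<1} = {})}"

text \<open>Closed connected sets are required to be nonempty: the empty set is closed, connected and has
  no boundary points, so without this no divisor would be reduced.\<close>

definition reduced :: "('v, 'e) curve_point \<Rightarrow> (('v, 'e) curve_point \<Rightarrow> int) \<Rightarrow> bool" where
  "reduced P D \<longleftrightarrow>
     (\<forall>v\<in>points. v \<noteq> P \<longrightarrow> 0 \<le> D v) \<and>
     (\<forall>X. X \<noteq> {} \<and> closedin curve_topology X \<and> connectedin curve_topology X \<and> P \<notin> X \<longrightarrow>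
        (\<exists>v\<in>curve_topology frontier_of X. D v < int (outdeg X v)))"

text \<open>The map \<open>P \<mapsto> D\<^sub>P\<close>.\<close>

definition Red ::
  "(('v, 'e) curve_point \<Rightarrow> int) \<Rightarrow> ('v, 'e) curve_point \<Rightarrow> ('v, 'e) curve_point \<Rightarrow> int" where
  "Red D P = (THE D'. is_divisor D' \<and> lin_equiv D' D \<and> reduced P D')"

end

end

theory Submission
  imports Defs
begin

text \<open>
  The \<open>P\<close>-reduced divisor in the class of \<open>D\<close> is \<open>D + div F\<close>, where \<open>F\<close> is the pointwise largest
  function of \<open>R_space D\<close> vanishing at \<open>P\<close>. One half of this is Dhar's argument: if \<open>D + div f\<close> is
  \<open>P\<close>-reduced and \<open>g \<in> R_space D\<close>, then \<open>g - f\<close> takes its maximum at \<open>P\<close>. For the other half the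
  supremum \<open>F\<close> is shown to lie in \<open>R_space D\<close>; it exists because a Harnack inequality bounds the
  oscillation of the functions in \<open>R_space D\<close>, and it is piecewise linear because away from the
  support of \<open>D\<close> these functions are convex with bounded integer slopes. Firing a set \<open>X\<close> that
  violates reducedness would increase \<open>F\<close>.

  Consequently, if \<open>P\<close> and \<open>Q\<close> have the same reduced divisor \<open>D + div F\<close>, then for every
  \<open>g \<in> R_space D\<close> both \<open>g P - g Q \<le> F P - F Q\<close> and its reverse hold, so \<open>D\<close> is not very ample.
  Conversely, if \<open>g P - g Q\<close> does not depend on \<open>g\<close>, then the extremal functions for \<open>P\<close> and \<open>Q\<close>
  differ by a constant.
\<close>

subsection \<open>One-sided slopes of real functions\<close>

text \<open>Germs replace breakpoints. A function is rational exactly when it has an integer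
  one-sided slope in every direction at every point, so the rationality of a supremum, or of the
  function that fires a set, becomes a local check. Two obstacles shape the rest.
  \<open>outdeg\<close> is a maximum over arbitrary embedded segments and has to become a count of
  directions before it can be compared with a sum of slopes. And divisors do not simply pass to a
  supremum of infinitely many functions; integrality is the remedy, since an error of less than one
  unit in an integer slope is no error. The bound on the oscillation cannot be obtained locally: on
  an edge where \<open>D\<close> vanishes a function may be linear with any slope, and only its
  distance from the global maximum controls it. The estimate is therefore carried from star to star
  along the curve.\<close>

definition germ :: "(real \<Rightarrow> real) \<Rightarrow> real \<Rightarrow> real \<Rightarrow> real \<Rightarrow> bool" where
  "germ \<phi> t d m \<longleftrightarrow> (\<forall>\<^sub>F s in at_right 0. \<phi> (t + d * s) = \<phi> t + m * s)"

lemma eventually_at_right_0_obtain: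
  assumes "\<forall>\<^sub>F s in at_right (0::real). P s"
  obtains r where "r > 0" "\<And>s. 0 < s \<Longrightarrow> s < r \<Longrightarrow> P s"
  using assms unfolding eventually_at_right_field by blast

lemma eventually_at_right_0I:
  assumes "r > 0" "\<And>s. 0 < s \<Longrightarrow> s < r \<Longrightarrow> P s"
  shows "\<forall>\<^sub>F s in at_right (0::real). P s"
  using assms unfolding eventually_at_right_field by blast

lemma eventually_at_right_0_witness:
  assumes "\<forall>\<^sub>F s in at_right (0::real). P s"
  obtains s where "s > 0" "P s"
  by (rule eventually_at_right_0_obtain[OF assms]) (metis dense)

lemma germ_unique:
  assumes "germ \<phi> t d m" "germ \<phi> t d m'"
  shows "m = m'"
proof -
  have "\<forall>\<^sub>F s in at_right 0. m * s = m' * s"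
    using assms unfolding germ_def by eventually_elim linarith
  then obtain s :: real where "s > 0" "m * s = m' * s"
    by (rule eventually_at_right_0_witness)
  then show ?thesis by simp
qed

lemma germ_cong:
  assumes "\<forall>\<^sub>F s in at_right 0. \<phi> (t + d * s) = \<psi> (t + d * s)" "\<phi> t = \<psi> t"
  shows "germ \<phi> t d m \<longleftrightarrow> germ \<psi> t d m"
proof -
  have "(\<forall>\<^sub>F s in at_right 0. \<phi> (t + d * s) = \<phi> t + m * s) \<longleftrightarrow>
        (\<forall>\<^sub>F s in at_right 0. \<psi> (t + d * s) = \<psi> t + m * s)"
    by (rule eventually_cong[OF assms(1)]) (use assms(2) in auto)
  then show ?thesis unfolding germ_def .
qed

lemma germ_add:
  assumes "germ \<phi> t d m" "germ \<psi> t d m'"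
  shows "germ (\<lambda>u. \<phi> u + \<psi> u) t d (m + m')"
  using assms unfolding germ_def by eventually_elim (simp add: algebra_simps)

lemma germ_diff:
  assumes "germ \<phi> t d m" "germ \<psi> t d m'"
  shows "germ (\<lambda>u. \<phi> u - \<psi> u) t d (m - m')"
  using assms unfolding germ_def by eventually_elim (simp add: algebra_simps)

lemma germ_line: "germ (\<lambda>u. \<phi> (t + d * u)) s d' m \<longleftrightarrow> germ \<phi> (t + d * s) (d * d') m"
  unfolding germ_def by (simp add: algebra_simps)

lemma germ_ge:
  assumes "germ \<phi> t d m" "\<forall>\<^sub>F s in at_right 0. \<phi> t + k * s \<le> \<phi> (t + d * s)"
  shows "k \<le> m"
proof -
  have "\<forall>\<^sub>F s in at_right 0. k * s \<le> m * s"
    using assms unfolding germ_def by eventually_elim simp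
  then obtain s :: real where "s > 0" "k * s \<le> m * s"
    by (rule eventually_at_right_0_witness)
  then show ?thesis by simp
qed

lemma germ_le:
  assumes "germ \<phi> t d m" "\<forall>\<^sub>F s in at_right 0. \<phi> (t + d * s) \<le> \<phi> t + k * s"
  shows "m \<le> k"
proof -
  have "\<forall>\<^sub>F s in at_right 0. m * s \<le> k * s"
    using assms unfolding germ_def by eventually_elim simp
  then obtain s :: real where "s > 0" "m * s \<le> k * s"
    by (rule eventually_at_right_0_witness)
  then show ?thesis by simp
qed

lemma germ_tendsto:
  assumes "germ \<phi> t d m"
  shows "((\<lambda>s. \<phi> (t + d * s)) \<longlongrightarrow> \<phi> t) (at_right 0)"
proof -
  have "((\<lambda>s. \<phi> t + m * s) \<longlongrightarrow> \<phi> t) (at_right 0)"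
    by (auto intro!: tendsto_eq_intros)
  moreover have "\<forall>\<^sub>F s in at_right 0. \<phi> t + m * s = \<phi> (t + d * s)"
    using assms unfolding germ_def by eventually_elim simp
  ultimately show ?thesis by (rule Lim_transform_eventually)
qed

lemma germ_radius:
  assumes "germ \<phi> t 1 m"
  shows "\<exists>r>0. \<forall>u. t \<le> u \<longrightarrow> u < t + r \<longrightarrow> \<phi> u = \<phi> t + m * (u - t)"
proof -
  obtain r where r: "r > 0" "\<And>s. 0 < s \<Longrightarrow> s < r \<Longrightarrow> \<phi> (t + 1 * s) = \<phi> t + m * s"
    by (rule eventually_at_right_0_obtain[OF assms[unfolded germ_def]]) blast
  have "\<phi> u = \<phi> t + m * (u - t)" if "t \<le> u" "u < t + r" for u
    using r(2)[of "u - t"] that by (cases "t = u") auto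
  then show ?thesis using r(1) by blast
qed

lemma germ_radius_left:
  assumes "germ \<phi> t (- 1) m"
  shows "\<exists>r>0. \<forall>u. t - r < u \<longrightarrow> u \<le> t \<longrightarrow> \<phi> u = \<phi> t + m * (t - u)"
proof -
  obtain r where r: "r > 0" "\<And>s. 0 < s \<Longrightarrow> s < r \<Longrightarrow> \<phi> (t + (- 1) * s) = \<phi> t + m * s"
    by (rule eventually_at_right_0_obtain[OF assms[unfolded germ_def]]) blast
  have "\<phi> u = \<phi> t + m * (t - u)" if "t - r < u" "u \<le> t" for u
    using r(2)[of "t - u"] that by (cases "t = u") auto
  then show ?thesis using r(1) by blast
qed

section \<open>Germs of piecewise affine functions\<close>

lemma affine_germs:
  assumes "\<And>u. a < u \<Longrightarrow> u < b \<Longrightarrow> \<phi> u = m * u + c" "a < u" "u < b"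
  shows "germ \<phi> u 1 m" "germ \<phi> u (- 1) (- m)"
proof -
  show "germ \<phi> u 1 m" unfolding germ_def
    by (rule eventually_at_right_0I[of "b - u"]) (use assms in \<open>auto simp: algebra_simps\<close>)
  show "germ \<phi> u (- 1) (- m)" unfolding germ_def
    by (rule eventually_at_right_0I[of "u - a"]) (use assms in \<open>auto simp: algebra_simps\<close>)
qed

text \<open>The pieces of a rational function are open intervals. Continuity extends the affine
  formula to the closure, which yields the germs at the end points as well.\<close>

lemma continuous_germs:
  assumes "continuous_on {a..b} \<phi>" "a \<le> u" "u < v" "v \<le> b"
    and lin: "\<And>t. u < t \<Longrightarrow> t < v \<Longrightarrow> \<phi> t = m * t + c"
  shows "\<And>t. u \<le> t \<Longrightarrow> t < v \<Longrightarrow> germ \<phi> t 1 m"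
    and "\<And>t. u < t \<Longrightarrow> t \<le> v \<Longrightarrow> germ \<phi> t (- 1) (- m)"
proof -
  have lin': "\<phi> t = m * t + c" if "t \<in> {u..v}" for t
  proof -
    have "closure {u<..<v} = {u..v}" using assms by simp
    moreover have "continuous_on {u..v} \<phi>"
      by (rule continuous_on_subset[OF assms(1)]) (use assms in auto)
    ultimately show ?thesis
      using continuous_constant_on_closure[of "{u<..<v}" "\<lambda>t. \<phi> t - m * t" c t] lin that
      by (fastforce intro!: continuous_intros)
  qed
  show "germ \<phi> t 1 m" if "u \<le> t" "t < v" for t unfolding germ_def
    by (rule eventually_at_right_0I[of "v - t"]) (use that lin' in \<open>auto simp: algebra_simps\<close>)
  show "germ \<phi> t (- 1) (- m)" if "u < t" "t \<le> v" for t unfolding germ_def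
    by (rule eventually_at_right_0I[of "t - u"]) (use that lin' in \<open>auto simp: algebra_simps\<close>)
qed

text \<open>A finite set of breakpoints leaves a punctured interval around each point free. The
  third claim, with opposite slopes off \<open>B\<close>, is what makes the support of a principal
  divisor finite.\<close>

lemma piecewise_affine_germs:
  fixes \<phi> :: "real \<Rightarrow> real"
  assumes cont: "continuous_on {0..l} \<phi>" and "finite B"
    and B: "\<And>a b. 0 \<le> a \<Longrightarrow> a < b \<Longrightarrow> b \<le> l \<Longrightarrow> {a<..<b} \<inter> B = {} \<Longrightarrow>
      \<exists>(m::int) c. \<forall>t\<in>{a<..<b}. \<phi> t = of_int m * t + c"
  shows "\<And>t. 0 \<le> t \<Longrightarrow> t < l \<Longrightarrow> \<exists>m::int. germ \<phi> t 1 m"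
    and "\<And>t. 0 < t \<Longrightarrow> t \<le> l \<Longrightarrow> \<exists>m::int. germ \<phi> t (- 1) m"
    and "\<And>t. 0 < t \<Longrightarrow> t < l \<Longrightarrow> t \<notin> B \<Longrightarrow> \<exists>m::int. germ \<phi> t 1 m \<and> germ \<phi> t (- 1) (- m)"
proof -
  have gap: "\<exists>r>0. \<forall>u\<in>B. u \<noteq> t \<longrightarrow> r \<le> \<bar>u - t\<bar>" for t
    using finite_set_avoid[OF \<open>finite B\<close>, of t] by (auto simp: dist_real_def abs_minus_commute)
  show "\<exists>m::int. germ \<phi> t 1 m" if t: "0 \<le> t" "t < l" for t
  proof -
    obtain r where r: "r > 0" "\<And>u. u \<in> B \<Longrightarrow> u \<noteq> t \<Longrightarrow> r \<le> \<bar>u - t\<bar>" using gap by blast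
    have "{t<..<min (t + r) l} \<inter> B = {}" using r by fastforce
    then obtain m c where "\<And>u. t < u \<Longrightarrow> u < min (t + r) l \<Longrightarrow> \<phi> u = of_int m * u + c"
      using B[of t "min (t + r) l"] t r(1) by auto
    then have "germ \<phi> t 1 m"
      using continuous_germs(1)[OF cont, of t "min (t + r) l" m c t] t r(1) by auto
    then show ?thesis by blast
  qed
  show "\<exists>m::int. germ \<phi> t (- 1) m" if t: "0 < t" "t \<le> l" for t
  proof -
    obtain r where r: "r > 0" "\<And>u. u \<in> B \<Longrightarrow> u \<noteq> t \<Longrightarrow> r \<le> \<bar>u - t\<bar>" using gap by blast
    have "{max (t - r) 0<..<t} \<inter> B = {}" using r by fastforce
    then obtain m c where "\<And>u. max (t - r) 0 < u \<Longrightarrow> u < t \<Longrightarrow> \<phi> u = of_int m * u + c"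
      using B[of "max (t - r) 0" t] t r(1) by auto
    then have "germ \<phi> t (- 1) (- m)"
      using continuous_germs(2)[OF cont, of "max (t - r) 0" t m c t] t r(1) by auto
    then have "germ \<phi> t (- 1) (of_int (- m))" by simp
    then show ?thesis by blast
  qed
  show "\<exists>m::int. germ \<phi> t 1 m \<and> germ \<phi> t (- 1) (- m)" if t: "0 < t" "t < l" "t \<notin> B" for t
  proof -
    obtain r where r: "r > 0" "\<And>u. u \<in> B \<Longrightarrow> u \<noteq> t \<Longrightarrow> r \<le> \<bar>u - t\<bar>" using gap by blast
    have "{max (t - r) 0<..<min (t + r) l} \<inter> B = {}" using r t(3) by fastforce
    then obtain m :: int and c where
      "\<And>u. max (t - r) 0 < u \<Longrightarrow> u < min (t + r) l \<Longrightarrow> \<phi> u = of_int m * u + c"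
      using B[of "max (t - r) 0" "min (t + r) l"] t r(1) by auto
    then have "germ \<phi> t 1 m \<and> germ \<phi> t (- 1) (- of_int m)"
      using affine_germs[of "max (t - r) 0" "min (t + r) l" \<phi> m c t] t r(1) by auto
    then show ?thesis by blast
  qed
qed

lemma germs_continuous_on:
  assumes r: "\<And>t. 0 \<le> t \<Longrightarrow> t < l \<Longrightarrow> \<exists>m::int. germ \<phi> t 1 m"
    and l: "\<And>t. 0 < t \<Longrightarrow> t \<le> l \<Longrightarrow> \<exists>m::int. germ \<phi> t (- 1) m"
  shows "continuous_on {0..l} \<phi>"
proof -
  have right: "(\<phi> \<longlongrightarrow> \<phi> t) (at t within {t..l})" if t: "0 \<le> t" "t \<le> l" for t
  proof (cases "t < l")
    case True
    then obtain m :: int where "germ \<phi> t 1 m" using r t by blast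
    then have "((\<lambda>s. \<phi> (t + s)) \<longlongrightarrow> \<phi> t) (at_right 0)" using germ_tendsto by fastforce
    then have "(\<phi> \<longlongrightarrow> \<phi> t) (at_right t)"
      by (simp add: filterlim_at_right_to_0[of \<phi> _ t] add.commute)
    then show ?thesis using True by (simp add: at_within_Icc_at_right)
  next
    case False
    then have "l = t" using t by simp
    then show ?thesis by (simp add: at_within_def)
  qed
  have left: "(\<phi> \<longlongrightarrow> \<phi> t) (at t within {0..t})" if t: "0 \<le> t" "t \<le> l" for t
  proof (cases "0 < t")
    case True
    then obtain m :: int where m: "germ \<phi> t (- 1) m" using l t by blast
    have "((\<lambda>s. \<phi> (t + (- 1) * s)) \<longlongrightarrow> \<phi> t) (at_right 0)" by (rule germ_tendsto[OF m])
    then have "((\<lambda>s. \<phi> (- s)) \<longlongrightarrow> \<phi> t) (at_right (- t))"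
      by (simp add: filterlim_at_right_to_0[of _ _ "- t"])
    then have "(\<phi> \<longlongrightarrow> \<phi> t) (at_left t)"
      by (simp add: at_left_minus[of t] filterlim_filtermap)
    then show ?thesis using True by (simp add: at_within_Icc_at_left)
  next
    case False
    then have "t = 0" using t by simp
    then show ?thesis by (simp add: at_within_def)
  qed
  have "(\<phi> \<longlongrightarrow> \<phi> t) (at t within {0..l})" if t: "0 \<le> t" "t \<le> l" for t
  proof -
    have "{0..l} = {0..t} \<union> {t..l}" using t by auto
    then show ?thesis using left[OF t] right[OF t] by (simp add: Lim_within_Un)
  qed
  then show ?thesis unfolding continuous_on_def by auto
qed

text \<open>Compactness of the interval in the form of \<open>Bolzano\<close>: germs make the
  function affine on either side of a point, with that point as the only breakpoint, and breakpoint
  sets of adjacent intervals can be united.\<close>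

lemma germs_piecewise_affine:
  assumes "0 \<le> l"
    and r: "\<And>t. 0 \<le> t \<Longrightarrow> t < l \<Longrightarrow> \<exists>m::int. germ \<phi> t 1 m"
    and l: "\<And>t. 0 < t \<Longrightarrow> t \<le> l \<Longrightarrow> \<exists>m::int. germ \<phi> t (- 1) m"
  shows "\<exists>B. finite B \<and> (\<forall>a b. 0 \<le> a \<and> a < b \<and> b \<le> l \<and> {a<..<b} \<inter> B = {} \<longrightarrow>
     (\<exists>(m::int) c. \<forall>t\<in>{a<..<b}. \<phi> t = of_int m * t + c))"
proof -
  define P where "P u v \<longleftrightarrow> (\<exists>B. finite B \<and>
    (\<forall>a b. 0 \<le> a \<and> u \<le> a \<and> a < b \<and> b \<le> l \<and> b \<le> v \<and> {a<..<b} \<inter> B = {} \<longrightarrow>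
     (\<exists>(m::int) c. \<forall>t\<in>{a<..<b}. \<phi> t = of_int m * t + c)))" for u v
  have "P 0 l" using \<open>0 \<le> l\<close>
  proof (induct rule: Bolzano)
    case (trans u v w)
    obtain B where B: "finite B" "\<And>a b. 0 \<le> a \<Longrightarrow> u \<le> a \<Longrightarrow> a < b \<Longrightarrow> b \<le> l \<Longrightarrow> b \<le> v \<Longrightarrow>
      {a<..<b} \<inter> B = {} \<Longrightarrow> \<exists>(m::int) c. \<forall>t\<in>{a<..<b}. \<phi> t = of_int m * t + c"
      using trans(1) unfolding P_def by auto
    obtain C where C: "finite C" "\<And>a b. 0 \<le> a \<Longrightarrow> v \<le> a \<Longrightarrow> a < b \<Longrightarrow> b \<le> l \<Longrightarrow> b \<le> w \<Longrightarrow>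
      {a<..<b} \<inter> C = {} \<Longrightarrow> \<exists>(m::int) c. \<forall>t\<in>{a<..<b}. \<phi> t = of_int m * t + c"
      using trans(2) unfolding P_def by auto
    \<comment> \<open>The joint \<open>v\<close> becomes a breakpoint itself, so that an interval
      avoiding all breakpoints lies on one side of it.\<close>
    have "\<exists>(m::int) c. \<forall>t\<in>{a<..<b}. \<phi> t = of_int m * t + c"
      if "0 \<le> a" "u \<le> a" "a < b" "b \<le> l" "b \<le> w" "{a<..<b} \<inter> insert v (B \<union> C) = {}" for a b
    proof (cases "b \<le> v")
      case True then show ?thesis using B(2)[of a b] that by blast
    next
      case False
      then have "v \<le> a" using that by (metis Int_insert_right_if1 greaterThanLessThan_iff insert_not_empty linorder_le_less_linear)
      then show ?thesis using C(2)[of a b] that by blast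
    qed
    then show ?case unfolding P_def using B(1) C(1)
      by (intro exI[of _ "insert v (B \<union> C)"]) auto
  next
    case (local x)
    have "\<exists>d>0. \<exists>(m::int). x < l \<longrightarrow> (\<forall>u. x \<le> u \<longrightarrow> u < x + d \<longrightarrow> \<phi> u = \<phi> x + m * (u - x))"
    proof (cases "x < l")
      case True
      then obtain m :: int where "germ \<phi> x 1 m" using r local by blast
      then show ?thesis using germ_radius[of \<phi> x m] by blast
    qed (auto intro: exI[of _ 1])
    then obtain d1 and m1 :: int where d1: "d1 > 0"
      "\<And>u. x < l \<Longrightarrow> x \<le> u \<Longrightarrow> u < x + d1 \<Longrightarrow> \<phi> u = \<phi> x + m1 * (u - x)" by blast
    have "\<exists>d>0. \<exists>(m::int). 0 < x \<longrightarrow> (\<forall>u. x - d < u \<longrightarrow> u \<le> x \<longrightarrow> \<phi> u = \<phi> x + m * (x - u))"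
    proof (cases "0 < x")
      case True
      then obtain m :: int where "germ \<phi> x (- 1) m" using l local by blast
      then show ?thesis using germ_radius_left[of \<phi> x m] by blast
    qed (auto intro: exI[of _ 1])
    then obtain d2 and m2 :: int where d2: "d2 > 0"
      "\<And>u. 0 < x \<Longrightarrow> x - d2 < u \<Longrightarrow> u \<le> x \<Longrightarrow> \<phi> u = \<phi> x + m2 * (x - u)" by blast
    have "P u v" if uv: "u \<le> x" "x \<le> v" "v - u < min d1 d2" for u v
    proof -
      have "\<exists>(m::int) c. \<forall>t\<in>{a<..<b}. \<phi> t = of_int m * t + c"
        if ab: "0 \<le> a" "u \<le> a" "a < b" "b \<le> l" "b \<le> v" "{a<..<b} \<inter> {x} = {}" for a b
      proof (cases "x \<le> a")
        case True
        have "\<phi> t = of_int m1 * t + (\<phi> x - m1 * x)" if "t \<in> {a<..<b}" for t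
          using d1(2)[of t] ab uv True that by (simp add: algebra_simps)
        then show ?thesis by blast
      next
        case False
        then have "b \<le> x" using ab by auto
        have "\<phi> t = of_int (- m2) * t + (\<phi> x + m2 * x)" if "t \<in> {a<..<b}" for t
          using d2(2)[of t] ab uv \<open>b \<le> x\<close> that by (simp add: algebra_simps)
        then show ?thesis by blast
      qed
      then show ?thesis unfolding P_def by (intro exI[of _ "{x}"]) auto
    qed
    then show ?case using d1(1) d2(1) by (intro exI[of _ "min d1 d2"]) auto
  qed
  then obtain B where "finite B" "\<forall>a b. 0 \<le> a \<and> 0 \<le> a \<and> a < b \<and> b \<le> l \<and> b \<le> l \<and> {a<..<b} \<inter> B = {} \<longrightarrow>
     (\<exists>(m::int) c. \<forall>t\<in>{a<..<b}. \<phi> t = of_int m * t + c)"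
    unfolding P_def by blast
  then show ?thesis by (intro exI[of _ B]) simp
qed

text \<open>Slopes are outgoing, so the left derivative is \<open>- l\<close>, and
  \<open>bend\<close> says that it never exceeds the right derivative \<open>r\<close>.
  \<open>Bolzano\<close> turns this local convexity into global supporting lines.\<close>

lemma convex_germs_tangent:
  fixes \<phi> r l :: "real \<Rightarrow> real"
  assumes r: "\<And>t. a \<le> t \<Longrightarrow> t < b \<Longrightarrow> germ \<phi> t 1 (r t)"
    and l: "\<And>t. a < t \<Longrightarrow> t \<le> b \<Longrightarrow> germ \<phi> t (- 1) (l t)"
    and bend: "\<And>t. a < t \<Longrightarrow> t < b \<Longrightarrow> 0 \<le> r t + l t"
    and t: "a \<le> t" "t < b" and u: "a \<le> u" "u \<le> b"
  shows "\<phi> t + r t * (u - t) \<le> \<phi> u"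
proof -
  \<comment> \<open>The mean slope is squeezed between the right derivative at the left end and the
    left derivative at the right end; this two-sided form survives gluing at an intermediate
    point.\<close>
  define P where "P u v \<longleftrightarrow> (a \<le> u \<longrightarrow> u < v \<longrightarrow> v \<le> b \<longrightarrow>
    r u * (v - u) \<le> \<phi> v - \<phi> u \<and> \<phi> v - \<phi> u \<le> - l v * (v - u))" for u v
  have "P u v" if "u \<le> v" for u v using that
  proof (induct rule: Bolzano)
    case (trans u v w)
    show ?case unfolding P_def
    proof (intro impI)
      assume *: "a \<le> u" "u < w" "w \<le> b"
      show "r u * (w - u) \<le> \<phi> w - \<phi> u \<and> \<phi> w - \<phi> u \<le> - l w * (w - u)"
      proof (cases "u = v \<or> v = w")
        case True then show ?thesis using trans * unfolding P_def by auto
      next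
        case False
        then have uvw: "u < v" "v < w" using trans by auto
        have 1: "r u * (v - u) \<le> \<phi> v - \<phi> u" "\<phi> v - \<phi> u \<le> - l v * (v - u)"
          "r v * (w - v) \<le> \<phi> w - \<phi> v" "\<phi> w - \<phi> v \<le> - l w * (w - v)"
          using trans uvw * unfolding P_def by auto
        \<comment> \<open>Each half yields an inequality between the derivatives at its ends, and
          \<open>bend\<close> at \<open>v\<close> links the two.\<close>
        have 2: "- l v \<le> r v" using bend[of v] uvw * by auto
        have "r u * (v - u) \<le> - l v * (v - u)" "r v * (w - v) \<le> - l w * (w - v)" using 1 by linarith+
        then have 3: "r u \<le> - l v" "r v \<le> - l w"
          using uvw by (auto simp only: mult_le_cancel_right)
        have "r u \<le> r v" "- l v \<le> - l w" using 2 3 by auto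
        from mult_right_mono[OF this(1), of "w - v"] mult_right_mono[OF this(2), of "v - u"] uvw
        have "r u * (w - v) \<le> r v * (w - v)" "- l v * (v - u) \<le> - l w * (v - u)" by auto
        then show ?thesis using 1 by (auto simp: algebra_simps)
      qed
    qed
  next
    case (local x)
    have "\<exists>d>0. a \<le> x \<longrightarrow> x < b \<longrightarrow> (\<forall>u. x \<le> u \<longrightarrow> u < x + d \<longrightarrow> \<phi> u = \<phi> x + r x * (u - x))"
      using germ_radius[OF r[of x]] by (cases "a \<le> x \<and> x < b") (auto intro: exI[of _ 1])
    then obtain d1 where d1: "d1 > 0"
      "\<And>u. a \<le> x \<Longrightarrow> x < b \<Longrightarrow> x \<le> u \<Longrightarrow> u < x + d1 \<Longrightarrow> \<phi> u = \<phi> x + r x * (u - x)" by blast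
    have "\<exists>d>0. a < x \<longrightarrow> x \<le> b \<longrightarrow> (\<forall>u. x - d < u \<longrightarrow> u \<le> x \<longrightarrow> \<phi> u = \<phi> x + l x * (x - u))"
      using germ_radius_left[OF l[of x]] by (cases "a < x \<and> x \<le> b") (auto intro: exI[of _ 1])
    then obtain d2 where d2: "d2 > 0"
      "\<And>u. a < x \<Longrightarrow> x \<le> b \<Longrightarrow> x - d2 < u \<Longrightarrow> u \<le> x \<Longrightarrow> \<phi> u = \<phi> x + l x * (x - u)" by blast
    have "P u v" if uv: "u \<le> x" "x \<le> v" "v - u < min d1 d2" for u v
      unfolding P_def
    proof (intro impI)
      assume *: "a \<le> u" "u < v" "v \<le> b"
      have xv: "\<phi> v = \<phi> x + r x * (v - x)" if "x < v" using d1(2)[of v] uv * that by auto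
      have ux: "\<phi> u = \<phi> x + l x * (x - u)" if "u < x" using d2(2)[of u] uv * that by auto
      \<comment> \<open>Close to \<open>x\<close> the function is a line on each side, so the germs
        at \<open>u\<close> and \<open>v\<close> that point back to \<open>x\<close> are read off
        from those at \<open>x\<close>.\<close>
      have lv: "l v = - r x" if "x < v"
      proof -
        have "germ \<phi> v (- 1) (l v)" using l[of v] * by auto
        moreover have "germ \<phi> v (- 1) (- r x)" unfolding germ_def
        proof (rule eventually_at_right_0I)
          show "0 < v - x" using that by simp
          show "\<phi> (v + - 1 * s) = \<phi> v + - r x * s" if "0 < s" "s < v - x" for s
            using d1(2)[of "v + - 1 * s"] xv[OF \<open>x < v\<close>] uv * that by (simp add: algebra_simps)
        qed
        ultimately show ?thesis by (rule germ_unique)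
      qed
      have ru: "r u = - l x" if "u < x"
      proof -
        have "germ \<phi> u 1 (r u)" using r[of u] * by auto
        moreover have "germ \<phi> u 1 (- l x)" unfolding germ_def
        proof (rule eventually_at_right_0I)
          show "0 < x - u" using that by simp
          show "\<phi> (u + 1 * s) = \<phi> u + - l x * s" if "0 < s" "s < x - u" for s
            using d2(2)[of "u + 1 * s"] ux[OF \<open>u < x\<close>] uv * that by (simp add: algebra_simps)
        qed
        ultimately show ?thesis by (rule germ_unique)
      qed
      consider "u = x" "x < v" | "u < x" "x = v" | "u < x" "x < v" using uv * by force
      then show "r u * (v - u) \<le> \<phi> v - \<phi> u \<and> \<phi> v - \<phi> u \<le> - l v * (v - u)"
      proof cases
        case 1 then show ?thesis using xv lv by simp
      next
        case 2 then show ?thesis using ux ru by simp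
      next
        case 3
        have "- l x \<le> r x" using bend[of x] 3 * by auto
        from mult_right_mono[OF this, of "v - x"] mult_right_mono[OF this, of "x - u"] 3
        have "- l x * (v - x) \<le> r x * (v - x)" "- l x * (x - u) \<le> r x * (x - u)" by auto
        then show ?thesis using 3 xv ux lv ru by (auto simp: algebra_simps)
      qed
    qed
    then show ?case using d1(1) d2(1) by (intro exI[of _ "min d1 d2"]) auto
  qed
  note P = this
  consider "u = t" | "t < u" | "u < t" by linarith
  then show ?thesis
  proof cases
    case 2 then show ?thesis using P[of t u] t u unfolding P_def by auto
  next
    case 3
    then have "\<phi> t - \<phi> u \<le> - l t * (t - u)" using P[of u t] t u unfolding P_def by auto
    moreover have "- l t * (t - u) \<le> r t * (t - u)"
      using mult_right_mono[of "- l t" "r t" "t - u"] bend[of t] 3 t u by auto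
    ultimately show ?thesis by (simp add: algebra_simps)
  qed simp
qed

text \<open>A pair in \<open>L\<close> is a line given by slope and intercept. Among the lines
  through the value at \<open>t\<close> the steepest wins, and those strictly below stay below for a
  while by continuity. That the germ dominates every active slope later bounds the sum of the two
  slopes at a kink.\<close>

lemma germ_max_lines:
  fixes L :: "(int \<times> real) set" and \<delta> :: real
  assumes "finite L" "L \<noteq> {}" "0 < \<delta>"
    and below: "\<And>m c s. (m, c) \<in> L \<Longrightarrow> 0 \<le> s \<Longrightarrow> s < \<delta> \<Longrightarrow> of_int m * s + c \<le> \<phi> (t + d * s)"
    and attained: "\<And>s. 0 \<le> s \<Longrightarrow> s < \<delta> \<Longrightarrow> \<exists>(m, c)\<in>L. \<phi> (t + d * s) = of_int m * s + c"
  shows "\<exists>m::int. germ \<phi> t d m \<and> (\<forall>k. (k, \<phi> t) \<in> L \<longrightarrow> k \<le> m)"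
proof -
  define A where "A = {m. (m, \<phi> t) \<in> L}"
  have "finite A"
    by (rule finite_subset[of _ "fst ` L"]) (use \<open>finite L\<close> in \<open>force simp: A_def\<close>)+
  have "A \<noteq> {}" using attained[of 0] \<open>0 < \<delta>\<close> by (auto simp: A_def)
  define m where "m = Max A"
  have m: "(m, \<phi> t) \<in> L" "\<And>k. (k, \<phi> t) \<in> L \<Longrightarrow> k \<le> m"
    using Max_in[OF \<open>finite A\<close> \<open>A \<noteq> {}\<close>] Max_ge[OF \<open>finite A\<close>] unfolding m_def A_def by auto
  have "\<forall>\<^sub>F s in at_right 0. of_int k * s + c \<le> of_int m * s + \<phi> t" if "(k, c) \<in> L" for k c
  proof (cases "c = \<phi> t")
    case True
    then have "k \<le> m" using m that by blast
    then show ?thesis using True by (intro eventually_at_right_0I[of 1]) (auto intro: mult_right_mono)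
  next
    case False
    then have "c < \<phi> t" using below[OF that, of 0] \<open>0 < \<delta>\<close> by auto
    have "((\<lambda>s. of_int k * s + c - of_int m * s) \<longlongrightarrow> of_int k * 0 + c - of_int m * 0) (at_right (0::real))"
      by (intro tendsto_intros)
    then have "\<forall>\<^sub>F s in at_right 0. of_int k * s + c - of_int m * s < \<phi> t"
      using \<open>c < \<phi> t\<close> by (intro order_tendstoD(2)) auto
    then show ?thesis by eventually_elim simp
  qed
  then have "\<forall>\<^sub>F s in at_right 0. \<forall>(k, c)\<in>L. of_int k * s + c \<le> of_int m * s + \<phi> t"
    using \<open>finite L\<close> by (intro eventually_ball_finite) auto
  moreover have "\<forall>\<^sub>F s in at_right 0. 0 < s \<and> s < \<delta>"
    by (rule eventually_at_right_0I[OF \<open>0 < \<delta>\<close>]) auto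
  ultimately have "germ \<phi> t d m" unfolding germ_def
  proof eventually_elim
    case (elim s)
    obtain k c where "(k, c) \<in> L" "\<phi> (t + d * s) = of_int k * s + c" using attained[of s] elim by auto
    then show ?case using elim below[OF m(1), of s] by (fastforce intro: antisym)
  qed
  then show ?thesis using m by blast
qed

section \<open>Distance to a closed subset of the line\<close>

lemma infdist_germ_leaving:
  fixes C :: "real set"
  assumes "t \<in> C" "d = 1 \<or> d = - 1" "0 < r" "\<And>s. 0 < s \<Longrightarrow> s < r \<Longrightarrow> t + d * s \<notin> C"
    and "0 < s" "s < r / 2"
  shows "infdist (t + d * s) C = s"
proof (rule antisym)
  show "infdist (t + d * s) C \<le> s"
    using infdist_le[OF \<open>t \<in> C\<close>, of "t + d * s"] assms by (auto simp: dist_real_def)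
  have "s \<le> dist (t + d * s) c" if "c \<in> C" for c
  proof (rule ccontr)
    assume "\<not> ?thesis"
    then have "\<bar>t + d * s - c\<bar> < s" by (simp add: dist_real_def)
    \<comment> \<open>A point \<open>c\<close> closer than \<open>s\<close> lies in the direction
      \<open>d\<close> from \<open>t\<close>, at a distance below \<open>2 * s < r\<close>, where
      \<open>C\<close> has no points.\<close>
    then have "0 < d * (c - t)" "d * (c - t) < r" "t + d * (d * (c - t)) = c"
      using assms(2,5,6) by (auto simp: abs_if split: if_splits)
    then show False using assms(4) that by metis
  qed
  then show "s \<le> infdist (t + d * s) C"
    using \<open>t \<in> C\<close> by (auto simp: infdist_def intro!: cINF_greatest)
qed

lemma gap_around:
  fixes C :: "real set"
  assumes "closed C" "t \<notin> C" "a \<in> C" "a < t" "b \<in> C" "t < b"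
  obtains p q where "p \<in> C" "q \<in> C" "p < t" "t < q" "{p<..<q} \<inter> C = {}"
proof -
  have 1: "compact (C \<inter> {a..t})" "C \<inter> {a..t} \<noteq> {}"
    using assms by (auto intro: closed_Int_compact)
  obtain p where p: "p \<in> C \<inter> {a..t}" "\<And>x. x \<in> C \<inter> {a..t} \<Longrightarrow> x \<le> p"
    using compact_attains_sup[OF 1] by auto
  have 2: "compact (C \<inter> {t..b})" "C \<inter> {t..b} \<noteq> {}"
    using assms by (auto intro: closed_Int_compact)
  obtain q where q: "q \<in> C \<inter> {t..b}" "\<And>x. x \<in> C \<inter> {t..b} \<Longrightarrow> q \<le> x"
    using compact_attains_inf[OF 2] by auto
  show thesis
  proof
    show "p \<in> C" "q \<in> C" using p q by auto
    show "p < t" "t < q" using p q \<open>t \<notin> C\<close> by (auto simp: less_le)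
    show "{p<..<q} \<inter> C = {}"
    proof -
      have False if "p < x" "x < q" "x \<in> C" for x
        using that p(2)[of x] q(2)[of x] p(1) q(1) by (cases "x \<le> t") auto
      then show ?thesis by auto
    qed
  qed
qed

lemma infdist_gap:
  fixes C :: "real set"
  assumes "p \<in> C" "q \<in> C" "{p<..<q} \<inter> C = {}" "p \<le> u" "u \<le> q"
  shows "infdist u C = min (u - p) (q - u)"
proof (rule antisym)
  show "infdist u C \<le> min (u - p) (q - u)"
    using infdist_le[OF assms(1), of u] infdist_le[OF assms(2), of u] assms
    by (auto simp: dist_real_def)
  have "min (u - p) (q - u) \<le> dist u c" if "c \<in> C" for c
  proof -
    have "c \<le> p \<or> q \<le> c" using assms(3) that by force
    then show ?thesis using assms by (auto simp: dist_real_def)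
  qed
  then show "min (u - p) (q - u) \<le> infdist u C"
    using assms(1) by (auto simp: infdist_def intro!: cINF_greatest)
qed

text \<open>In a gap of \<open>C\<close> the truncated negative distance is the maximum of three
  lines, of slopes \<open>-1\<close>, \<open>0\<close> and \<open>1\<close>, hence convex.\<close>

lemma neg_infdist_germs_outside:
  fixes C :: "real set"
  assumes "closed C" "t \<notin> C" "a \<in> C" "a < t" "b \<in> C" "t < b" "0 < \<epsilon>"
  defines "\<psi> \<equiv> \<lambda>u. - min \<epsilon> (infdist u C)"
  shows "\<exists>(m1::int) (m2::int). germ \<psi> t 1 m1 \<and> germ \<psi> t (- 1) m2 \<and> (0::int) \<le> m1 + m2"
proof -
  obtain p q where pq: "p \<in> C" "q \<in> C" "p < t" "t < q" "{p<..<q} \<inter> C = {}"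
    using gap_around[OF assms(1-6)] by blast
  have \<psi>: "\<psi> u = max (- \<epsilon>) (max (p - u) (u - q))" if "p \<le> u" "u \<le> q" for u
    using infdist_gap[OF pq(1,2,5) that] unfolding \<psi>_def by auto
  define \<delta> where "\<delta> = min (t - p) (q - t)"
  have \<delta>: "0 < \<delta>" "\<delta> \<le> t - p" "\<delta> \<le> q - t" using pq by (auto simp: \<delta>_def)
  \<comment> \<open>The same three lines, parametrised by the distance travelled to the right and to
    the left: a line active at \<open>t\<close> occurs in both lists, with opposite slopes
    \<open>k\<close> and \<open>- k\<close>.\<close>
  define L1 where "L1 = {(0::int, - \<epsilon>), (- 1, p - t), (1, t - q)}"
  define L2 where "L2 = {(0::int, - \<epsilon>), (1, p - t), (- 1, t - q)}"
  have "\<exists>m::int. germ \<psi> t 1 m \<and> (\<forall>k. (k, \<psi> t) \<in> L1 \<longrightarrow> k \<le> m)"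
    by (rule germ_max_lines[OF _ _ \<delta>(1)]) (use \<delta> in \<open>auto simp: L1_def \<psi> max_def\<close>)
  moreover have "\<exists>m::int. germ \<psi> t (- 1) m \<and> (\<forall>k. (k, \<psi> t) \<in> L2 \<longrightarrow> k \<le> m)"
    by (rule germ_max_lines[OF _ _ \<delta>(1)]) (use \<delta> in \<open>auto simp: L2_def \<psi> max_def\<close>)
  moreover have "\<exists>k. (k, \<psi> t) \<in> L1 \<and> (- k, \<psi> t) \<in> L2"
    using pq by (auto simp: L1_def L2_def \<psi> max_def)
  ultimately obtain m1 m2 k where "germ \<psi> t 1 (of_int m1)" "germ \<psi> t (- 1) (of_int m2)"
    "k \<le> m1" "- k \<le> m2" by blast
  moreover from this have "0 \<le> m1 + m2" by linarith
  ultimately show ?thesis by blast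
qed

context tropical_curve
begin

subsection \<open>Directions at a point\<close>

text \<open>Unit tangent directions. The coordinate \<open>t\<close> is recorded because a vertex
  can be reached from several edge ends; a loop thus contributes two directions. The strict bounds
  drop directions in which \<open>edge_pt\<close>, which clamps its argument, would stand
  still.\<close>

definition dirs :: "('v, 'e) curve_point \<Rightarrow> ('e \<times> real \<times> real) set" where
  "dirs x = {(e, t, d). e \<in> arcs G \<and> 0 \<le> t \<and> t \<le> len e \<and> edge_pt e t = x \<and>
     (d = 1 \<and> t < len e \<or> d = - 1 \<and> 0 < t)}"

lemma dirsD:
  assumes "(e, t, d) \<in> dirs x"
  shows "e \<in> arcs G" "0 \<le> t" "t \<le> len e" "edge_pt e t = x" "d = 1 \<or> d = - 1"
    "d = 1 \<Longrightarrow> t < len e" "d = - 1 \<Longrightarrow> 0 < t"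
  using assms by (auto simp: dirs_def)

lemma edge_pt_simps [simp]:
  "edge_pt e 0 = Vertex (tail G e)"
  "e \<in> arcs G \<Longrightarrow> edge_pt e (len e) = Vertex (head G e)"
  "0 < t \<Longrightarrow> t < len e \<Longrightarrow> edge_pt e t = Inner e t"
  using len_pos[of e] by (auto simp: edge_pt_def)

lemma edge_pt_cases:
  assumes "e \<in> arcs G" "0 \<le> t" "t \<le> len e"
  obtains "t = 0" "edge_pt e t = Vertex (tail G e)"
  | "t = len e" "edge_pt e t = Vertex (head G e)"
  | "0 < t" "t < len e" "edge_pt e t = Inner e t"
  using assms by (cases "t = 0"; cases "t = len e") auto

lemma points_cases:
  assumes "x \<in> points"
  obtains v where "v \<in> verts G" "x = Vertex v"
  | e t where "e \<in> arcs G" "0 < t" "t < len e" "x = Inner e t"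
  using assms by (auto simp: points_def)

lemma dirs_Vertex:
  "dirs (Vertex v) = (\<lambda>e. (e, 0, 1)) ` out_arcs G v \<union> (\<lambda>e. (e, len e, - 1)) ` in_arcs G v"
proof -
  have "b \<in> dirs (Vertex v)"
    if "b \<in> (\<lambda>e. (e, 0, 1)) ` out_arcs G v \<union> (\<lambda>e. (e, len e, - 1)) ` in_arcs G v" for b
    using that len_pos by (auto simp: dirs_def less_imp_le)
  moreover have "b \<in> (\<lambda>e. (e, 0, 1)) ` out_arcs G v \<union> (\<lambda>e. (e, len e, - 1)) ` in_arcs G v"
    if b: "b \<in> dirs (Vertex v)" for b
  proof -
    obtain e t d where b': "b = (e, t, d)" by (cases b)
    note D = dirsD[OF b[unfolded b']]
    from D(1,2,3) show ?thesis
      by (cases rule: edge_pt_cases) (use D b' in auto)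
  qed
  ultimately show ?thesis by blast
qed

lemma dirs_Inner:
  assumes "e \<in> arcs G" "0 < t" "t < len e"
  shows "dirs (Inner e t) = {(e, t, 1), (e, t, - 1)}"
proof -
  have "b \<in> {(e, t, 1), (e, t, - 1)}" if b: "b \<in> dirs (Inner e t)" for b
  proof -
    obtain e' t' d where b': "b = (e', t', d)" by (cases b)
    note D = dirsD[OF b[unfolded b']]
    from D(1,2,3) show ?thesis
      by (cases rule: edge_pt_cases) (use D b' in auto)
  qed
  then show ?thesis using assms by (auto simp: dirs_def)
qed

lemma finite_dirs: "x \<in> points \<Longrightarrow> finite (dirs x)"
  by (erule points_cases) (auto simp: dirs_Vertex dirs_Inner)

text \<open>This lets an order be estimated slope by slope without telling vertices from inner
  points.\<close>

lemma ord_at_dirs: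
  assumes "x \<in> points"
  shows "ord_at f x = (\<Sum>(e, t, d)\<in>dirs x. slope f e t d)"
  using assms
proof (cases rule: points_cases)
  case (1 v)
  have "(\<Sum>(e, t, d)\<in>dirs x. slope f e t d) =
    (\<Sum>(e, t, d)\<in>(\<lambda>e. (e, 0, 1)) ` out_arcs G v. slope f e t d) +
    (\<Sum>(e, t, d)\<in>(\<lambda>e. (e, len e, - 1)) ` in_arcs G v. slope f e t d)"
    unfolding 1 dirs_Vertex by (rule sum.union_disjoint) auto
  then show ?thesis
    by (simp add: 1 ord_at_def sum.reindex inj_on_def)
next
  case (2 e t)
  then show ?thesis by (simp add: ord_at_def dirs_Inner)
qed

lemma dirs_eventually_inner:
  assumes "(e, t, d) \<in> dirs x"
  shows "\<forall>\<^sub>F s in at_right 0. 0 < t + d * s \<and> t + d * s < len e"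
proof (rule eventually_at_right_0I)
  let ?r = "if d = 1 then len e - t else t"
  show "0 < ?r" using dirsD[OF assms] by auto
  show "0 < t + d * s \<and> t + d * s < len e" if "0 < s" "s < ?r" for s
    using dirsD[OF assms] that by auto
qed

lemma slope_eq:
  assumes "germ (\<lambda>u. f (edge_pt e u)) t d (of_int m)"
  shows "slope f e t d = m"
  unfolding slope_def
proof (rule the_equality)
  show "\<forall>\<^sub>F s in at_right 0. f (edge_pt e (t + d * s)) = f (edge_pt e t) + of_int m * s"
    using assms by (simp add: germ_def)
  show "m' = m"
    if "\<forall>\<^sub>F s in at_right 0. f (edge_pt e (t + d * s)) = f (edge_pt e t) + of_int m' * s" for m'
    using germ_unique[OF assms, of "of_int m'"] that by (simp add: germ_def)
qed

lemma rational_function_edge: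
  assumes "rational_function f" "e \<in> arcs G"
  shows "\<And>t. 0 \<le> t \<Longrightarrow> t < len e \<Longrightarrow> \<exists>m::int. germ (\<lambda>u. f (edge_pt e u)) t 1 m"
    and "\<And>t. 0 < t \<Longrightarrow> t \<le> len e \<Longrightarrow> \<exists>m::int. germ (\<lambda>u. f (edge_pt e u)) t (- 1) m"
    and "\<exists>B. finite B \<and> (\<forall>t. 0 < t \<longrightarrow> t < len e \<longrightarrow> t \<notin> B \<longrightarrow>
      (\<exists>m::int. germ (\<lambda>u. f (edge_pt e u)) t 1 m \<and> germ (\<lambda>u. f (edge_pt e u)) t (- 1) (- of_int m)))"
proof -
  have *: "continuous_on {0..len e} (\<lambda>t. f (edge_pt e t)) \<and> (\<exists>B. finite B \<and>
      (\<forall>a b. 0 \<le> a \<and> a < b \<and> b \<le> len e \<and> {a<..<b} \<inter> B = {} \<longrightarrow>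
        (\<exists>(m::int) c. \<forall>t\<in>{a<..<b}. f (edge_pt e t) = of_int m * t + c)))"
    using assms(1)[unfolded rational_function_def, rule_format, OF assms(2)] .
  note c = *[THEN conjunct1]
  obtain B where B: "finite B \<and>
      (\<forall>a b. 0 \<le> a \<and> a < b \<and> b \<le> len e \<and> {a<..<b} \<inter> B = {} \<longrightarrow>
        (\<exists>(m::int) c. \<forall>t\<in>{a<..<b}. f (edge_pt e t) = of_int m * t + c))"
    using *[THEN conjunct2] by (rule exE)
  have B': "\<exists>(m::int) c. \<forall>t\<in>{a<..<b}. f (edge_pt e t) = of_int m * t + c"
    if "0 \<le> a" "a < b" "b \<le> len e" "{a<..<b} \<inter> B = {}" for a b
    using B[THEN conjunct2, rule_format, of a b] that by simp
  note germs = piecewise_affine_germs[OF c B[THEN conjunct1] B']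
  show "\<exists>m::int. germ (\<lambda>u. f (edge_pt e u)) t 1 m" if "0 \<le> t" "t < len e" for t
    by (rule germs(1)) (use that in auto)
  show "\<exists>m::int. germ (\<lambda>u. f (edge_pt e u)) t (- 1) m" if "0 < t" "t \<le> len e" for t
    by (rule germs(2)) (use that in auto)
  have "\<exists>m::int. germ (\<lambda>u. f (edge_pt e u)) t 1 m \<and> germ (\<lambda>u. f (edge_pt e u)) t (- 1) (- of_int m)"
    if "0 < t" "t < len e" "t \<notin> B" for t
    by (rule germs(3)) (use that in auto)
  then show "\<exists>B. finite B \<and> (\<forall>t. 0 < t \<longrightarrow> t < len e \<longrightarrow> t \<notin> B \<longrightarrow>
      (\<exists>m::int. germ (\<lambda>u. f (edge_pt e u)) t 1 m \<and> germ (\<lambda>u. f (edge_pt e u)) t (- 1) (- of_int m)))"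
    using B[THEN conjunct1] by (intro exI[of _ B]) simp
qed

text \<open>Integer germs already entail continuity and, the edges being compact, finitely many
  pieces.\<close>

lemma rational_function_iff:
  "rational_function f \<longleftrightarrow>
    (\<forall>x. \<forall>(e, t, d)\<in>dirs x. \<exists>m::int. germ (\<lambda>u. f (edge_pt e u)) t d m)"
proof
  assume f: "rational_function f"
  show "\<forall>x. \<forall>(e, t, d)\<in>dirs x. \<exists>m::int. germ (\<lambda>u. f (edge_pt e u)) t d m"
  proof (clarify)
    fix x e t d
    assume "(e, t, d) \<in> dirs x"
    note D = dirsD[OF this]
    show "\<exists>m::int. germ (\<lambda>u. f (edge_pt e u)) t d m"
      using D(5)
    proof
      assume "d = 1"
      then show ?thesis using rational_function_edge(1)[OF f D(1)] D by blast
    next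
      assume "d = - 1"
      then show ?thesis using rational_function_edge(2)[OF f D(1)] D by blast
    qed
  qed
next
  assume *: "\<forall>x. \<forall>(e, t, d)\<in>dirs x. \<exists>m::int. germ (\<lambda>u. f (edge_pt e u)) t d m"
  show "rational_function f"
    unfolding rational_function_def
  proof (intro ballI conjI)
    fix e assume e: "e \<in> arcs G"
    have r: "\<exists>m::int. germ (\<lambda>u. f (edge_pt e u)) t 1 m" if "0 \<le> t" "t < len e" for t
    proof -
      have "(e, t, 1) \<in> dirs (edge_pt e t)" using e that by (simp add: dirs_def)
      then show ?thesis using * by blast
    qed
    have l: "\<exists>m::int. germ (\<lambda>u. f (edge_pt e u)) t (- 1) m" if "0 < t" "t \<le> len e" for t
    proof -
      have "(e, t, - 1) \<in> dirs (edge_pt e t)" using e that by (simp add: dirs_def)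
      then show ?thesis using * by blast
    qed
    show "continuous_on {0..len e} (\<lambda>t. f (edge_pt e t))"
      by (rule germs_continuous_on) (fact r l)+
    show "\<exists>B. finite B \<and> (\<forall>a b. 0 \<le> a \<and> a < b \<and> b \<le> len e \<and> {a<..<b} \<inter> B = {} \<longrightarrow>
           (\<exists>(m::int) c. \<forall>t\<in>{a<..<b}. f (edge_pt e t) = of_int m * t + c))"
      using germs_piecewise_affine[of "len e" "\<lambda>u. f (edge_pt e u)"] r l len_pos[OF e] by simp
  qed
qed

lemma rational_germ:
  assumes "rational_function f" "(e, t, d) \<in> dirs x"
  shows "germ (\<lambda>u. f (edge_pt e u)) t d (of_int (slope f e t d))"
proof -
  obtain m :: int where "germ (\<lambda>u. f (edge_pt e u)) t d m"
    using assms unfolding rational_function_iff by blast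
  then show ?thesis using slope_eq by metis
qed

text \<open>Away from vertices and breakpoints the two outgoing slopes cancel.\<close>

lemma finite_div_support:
  assumes "rational_function f"
  shows "finite {x. div_of f x \<noteq> 0}"
proof -
  have "\<exists>B. finite B \<and> (\<forall>t. 0 < t \<longrightarrow> t < len e \<longrightarrow> t \<notin> B \<longrightarrow> div_of f (Inner e t) = 0)"
    if e: "e \<in> arcs G" for e
  proof -
    obtain B where B: "finite B \<and> (\<forall>t. 0 < t \<longrightarrow> t < len e \<longrightarrow> t \<notin> B \<longrightarrow>
      (\<exists>m::int. germ (\<lambda>u. f (edge_pt e u)) t 1 m \<and> germ (\<lambda>u. f (edge_pt e u)) t (- 1) (- of_int m)))"
      using rational_function_edge(3)[OF assms e] by (rule exE)
    have "div_of f (Inner e t) = 0" if t: "0 < t" "t < len e" "t \<notin> B" for t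
    proof -
      obtain m :: int where m: "germ (\<lambda>u. f (edge_pt e u)) t 1 m \<and> germ (\<lambda>u. f (edge_pt e u)) t (- 1) (- of_int m)"
        using B[THEN conjunct2, rule_format, OF t] by (rule exE)
      have "slope f e t 1 = m" "slope f e t (- 1) = - m"
        using m by (auto intro!: slope_eq)
      then show ?thesis by (simp add: div_of_def ord_at_def)
    qed
    then show ?thesis using B by blast
  qed
  then obtain B where B: "\<And>e. e \<in> arcs G \<Longrightarrow> finite (B e)"
    "\<And>e t. e \<in> arcs G \<Longrightarrow> 0 < t \<Longrightarrow> t < len e \<Longrightarrow> t \<notin> B e \<Longrightarrow> div_of f (Inner e t) = 0"
    by metis
  have "{x. div_of f x \<noteq> 0} \<subseteq> Vertex ` verts G \<union> (\<Union>e\<in>arcs G. Inner e ` B e)"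
  proof
    fix x assume "x \<in> {x. div_of f x \<noteq> 0}"
    then have x: "div_of f x \<noteq> 0" by simp
    then have "x \<in> points" by (auto simp: div_of_def split: if_splits)
    then show "x \<in> Vertex ` verts G \<union> (\<Union>e\<in>arcs G. Inner e ` B e)"
    proof (cases rule: points_cases)
      case (2 e t)
      then have "t \<in> B e" using x B(2) by blast
      then show ?thesis using 2 by blast
    qed simp
  qed
  then show ?thesis by (rule finite_subset) (use B(1) in auto)
qed

lemma is_divisor_add_div:
  assumes "is_divisor D" "rational_function f"
  shows "is_divisor (\<lambda>x. D x + div_of f x)"
  unfolding is_divisor_def
proof
  have "{x. D x + div_of f x \<noteq> 0} \<subseteq> {x. D x \<noteq> 0} \<union> {x. div_of f x \<noteq> 0}" by auto
  then show "finite {x. D x + div_of f x \<noteq> 0}"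
    using assms finite_div_support unfolding is_divisor_def by (auto intro: finite_subset)
  show "{x. D x + div_of f x \<noteq> 0} \<subseteq> points"
    using assms(1) by (auto simp: is_divisor_def div_of_def)
qed

lemma dirs_in_points: "(e, t, d) \<in> dirs x \<Longrightarrow> x \<in> points"
  using edge_pt_in_points dirsD(1,4) by metis

lemma
  assumes "rational_function f" "rational_function g"
  shows rational_function_add: "rational_function (\<lambda>x. f x + g x)"
    and div_of_add: "div_of (\<lambda>x. f x + g x) x = div_of f x + div_of g x"
    and rational_function_diff: "rational_function (\<lambda>x. f x - g x)"
    and div_of_diff: "div_of (\<lambda>x. f x - g x) x = div_of f x - div_of g x"
proof -
  have a: "germ (\<lambda>u. f (edge_pt e u) + g (edge_pt e u)) t d (of_int (slope f e t d + slope g e t d))"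
    if "(e, t, d) \<in> dirs x" for e t d x
    using germ_add[OF rational_germ[OF assms(1) that] rational_germ[OF assms(2) that]] by simp
  have b: "germ (\<lambda>u. f (edge_pt e u) - g (edge_pt e u)) t d (of_int (slope f e t d - slope g e t d))"
    if "(e, t, d) \<in> dirs x" for e t d x
    using germ_diff[OF rational_germ[OF assms(1) that] rational_germ[OF assms(2) that]] by simp
  show "rational_function (\<lambda>x. f x + g x)" "rational_function (\<lambda>x. f x - g x)"
    unfolding rational_function_iff using a b by blast+
  have a': "slope (\<lambda>x. f x + g x) e t d = slope f e t d + slope g e t d"
    if "(e, t, d) \<in> dirs x" for e t d x
    by (rule slope_eq[OF a[OF that]])
  have b': "slope (\<lambda>x. f x - g x) e t d = slope f e t d - slope g e t d"
    if "(e, t, d) \<in> dirs x" for e t d x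
    by (rule slope_eq[OF b[OF that]])
  show "div_of (\<lambda>x. f x + g x) x = div_of f x + div_of g x"
  proof (cases "x \<in> points")
    case True
    have "(\<Sum>(e, t, d)\<in>dirs x. slope (\<lambda>x. f x + g x) e t d) =
      (\<Sum>(e, t, d)\<in>dirs x. slope f e t d + slope g e t d)"
      by (rule sum.cong) (use a' in auto)
    then show ?thesis using True
      by (simp add: div_of_def ord_at_dirs split_beta sum.distrib)
  qed (simp add: div_of_def)
  show "div_of (\<lambda>x. f x - g x) x = div_of f x - div_of g x"
  proof (cases "x \<in> points")
    case True
    have "(\<Sum>(e, t, d)\<in>dirs x. slope (\<lambda>x. f x - g x) e t d) =
      (\<Sum>(e, t, d)\<in>dirs x. slope f e t d - slope g e t d)"
      by (rule sum.cong) (use b' in auto)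
    then show ?thesis using True
      by (simp add: div_of_def ord_at_dirs split_beta sum_subtractf)
  qed (simp add: div_of_def)
qed

lemma div_of_const:
  assumes "\<And>x. x \<in> points \<Longrightarrow> f x = c"
  shows "div_of f x = 0"
proof -
  have g: "germ (\<lambda>u. f (edge_pt e u)) t d (of_int 0)" if "(e, t, d) \<in> dirs x" for e t d x
    using assms edge_pt_in_points dirsD(1)[OF that] by (simp add: germ_def)
  have "(\<Sum>(e, t, d)\<in>dirs x. slope f e t d) = 0"
    by (rule sum.neutral) (use slope_eq[OF g] in auto)
  then show ?thesis by (simp add: div_of_def ord_at_dirs)
qed

subsection \<open>Topology and outgoing degrees\<close>

text \<open>A coordinate on an edge has at most two directions, so testing them amounts to testing a
  neighbourhood of that coordinate in the edge. Openness becomes a statement of the same kind as a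
  germ.\<close>

lemma openin_curve_iff_dirs:
  "openin curve_topology U \<longleftrightarrow> U \<subseteq> points \<and>
    (\<forall>x\<in>U. \<forall>(e, t, d)\<in>dirs x. \<forall>\<^sub>F s in at_right 0. edge_pt e (t + d * s) \<in> U)"
proof
  assume U: "openin curve_topology U"
  show "U \<subseteq> points \<and>
    (\<forall>x\<in>U. \<forall>(e, t, d)\<in>dirs x. \<forall>\<^sub>F s in at_right 0. edge_pt e (t + d * s) \<in> U)"
  proof (intro conjI ballI, use U openin_curve_topology in blast, clarify)
    fix x e t d
    assume x: "x \<in> U" and b: "(e, t, d) \<in> dirs x"
    note D = dirsD[OF b]
    have "openin (top_of_set {0..len e}) {t \<in> {0..len e}. edge_pt e t \<in> U}"
      using U D(1) by (simp add: openin_curve_topology)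
    moreover have "t \<in> {t \<in> {0..len e}. edge_pt e t \<in> U}" using D x by auto
    ultimately have "\<exists>r>0. \<forall>t'\<in>{0..len e}. dist t' t < r \<longrightarrow> t' \<in> {t \<in> {0..len e}. edge_pt e t \<in> U}"
      by (simp only: openin_euclidean_subtopology_iff)
    then obtain r where r: "r > 0" "\<And>t'. t' \<in> {0..len e} \<Longrightarrow> dist t' t < r \<Longrightarrow> edge_pt e t' \<in> U"
      by blast
    have "\<forall>\<^sub>F s in at_right 0. 0 < s \<and> s < r"
      by (rule eventually_at_right_0I[OF r(1)]) auto
    then show "\<forall>\<^sub>F s in at_right 0. edge_pt e (t + d * s) \<in> U"
      using dirs_eventually_inner[OF b]
    proof eventually_elim
      case (elim s)
      then have "t + d * s \<in> {0..len e}" "dist (t + d * s) t < r"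
        using D(5) by (auto simp: dist_real_def)
      then show ?case using r(2) by blast
    qed
  qed
next
  assume *: "U \<subseteq> points \<and>
    (\<forall>x\<in>U. \<forall>(e, t, d)\<in>dirs x. \<forall>\<^sub>F s in at_right 0. edge_pt e (t + d * s) \<in> U)"
  show "openin curve_topology U"
    unfolding openin_curve_topology openin_euclidean_subtopology_iff
  proof (intro conjI ballI)
    fix e t assume e: "e \<in> arcs G" and "t \<in> {t \<in> {0..len e}. edge_pt e t \<in> U}"
    then have t: "0 \<le> t" "t \<le> len e" "edge_pt e t \<in> U" by auto
    have "\<exists>r>0. \<forall>s. 0 < s \<longrightarrow> s < r \<longrightarrow> t < len e \<longrightarrow> edge_pt e (t + s) \<in> U"
    proof (cases "t < len e")
      case True
      then have "(e, t, 1) \<in> dirs (edge_pt e t)" using e t by (simp add: dirs_def)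
      then have "\<forall>\<^sub>F s in at_right 0. edge_pt e (t + 1 * s) \<in> U" using * t(3) by blast
      then show ?thesis unfolding eventually_at_right_field by auto
    qed (auto intro: exI[of _ 1])
    then obtain r where r: "r > 0" "\<And>s. 0 < s \<Longrightarrow> s < r \<Longrightarrow> t < len e \<Longrightarrow> edge_pt e (t + s) \<in> U"
      by blast
    have "\<exists>r>0. \<forall>s. 0 < s \<longrightarrow> s < r \<longrightarrow> 0 < t \<longrightarrow> edge_pt e (t - s) \<in> U"
    proof (cases "0 < t")
      case True
      then have "(e, t, - 1) \<in> dirs (edge_pt e t)" using e t by (simp add: dirs_def)
      then have "\<forall>\<^sub>F s in at_right 0. edge_pt e (t + (- 1) * s) \<in> U" using * t(3) by blast
      then show ?thesis unfolding eventually_at_right_field by auto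
    qed (auto intro: exI[of _ 1])
    then obtain r' where r': "r' > 0" "\<And>s. 0 < s \<Longrightarrow> s < r' \<Longrightarrow> 0 < t \<Longrightarrow> edge_pt e (t - s) \<in> U"
      by blast
    have "edge_pt e u \<in> U" if "u \<in> {0..len e}" "dist u t < min r r'" for u
    proof -
      consider "u = t" | "t < u" | "u < t" by linarith
      then show ?thesis
      proof cases
        case 1 then show ?thesis using t by simp
      next
        case 2 then show ?thesis using r(2)[of "u - t"] that by (auto simp: dist_real_def)
      next
        case 3 then show ?thesis using r'(2)[of "t - u"] that by (auto simp: dist_real_def)
      qed
    qed
    then show "\<exists>r>0. \<forall>u\<in>{0..len e}. dist u t < r \<longrightarrow> u \<in> {t \<in> {0..len e}. edge_pt e t \<in> U}"
      using r(1) r'(1) by (intro exI[of _ "min r r'"]) auto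
  qed (use * in auto)
qed

lemma closedin_curve_iff:
  "closedin curve_topology C \<longleftrightarrow> C \<subseteq> points \<and>
    (\<forall>e\<in>arcs G. closed {t \<in> {0..len e}. edge_pt e t \<in> C})"
proof -
  have "openin (top_of_set {0..len e}) {t \<in> {0..len e}. edge_pt e t \<in> points - C} \<longleftrightarrow>
    closed {t \<in> {0..len e}. edge_pt e t \<in> C}" if "e \<in> arcs G" for e
  proof -
    define S where "S = {t \<in> {0..len e}. edge_pt e t \<in> C}"
    have "S \<subseteq> {0..len e}" by (auto simp: S_def)
    have "{t \<in> {0..len e}. edge_pt e t \<in> points - C} = {0..len e} - S"
      using edge_pt_in_points[OF that] by (auto simp: S_def)
    moreover have "openin (top_of_set {0..len e}) ({0..len e} - S) \<longleftrightarrow> closedin (top_of_set {0..len e}) S"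
      using \<open>S \<subseteq> _\<close> by (simp add: closedin_def)
    moreover have "\<dots> \<longleftrightarrow> closed S"
      using \<open>S \<subseteq> _\<close> by (simp add: closedin_closed_eq)
    ultimately show ?thesis by (simp add: S_def)
  qed
  then show ?thesis
    unfolding closedin_def topspace_curve_topology openin_curve_topology by blast
qed

lemma continuous_map_edge_pt:
  "e \<in> arcs G \<Longrightarrow> continuous_map (top_of_set {0..len e}) curve_topology (edge_pt e)"
  by (auto simp: continuous_map_def topspace_curve_topology edge_pt_in_points openin_curve_topology)

text \<open>Distinct edges meet only in vertices, so the image of a closed set traces on any edge
  either that set or nothing, up to the two end points. Closedness later upgrades injective paths to
  embeddings.\<close>

lemma closed_map_edge_pt:
  assumes e: "e \<in> arcs G"
  shows "closed_map (top_of_set {0..len e}) curve_topology (edge_pt e)"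
  unfolding closed_map_def
proof (intro allI impI)
  fix K assume "closedin (top_of_set {0..len e}) K"
  then have K: "closed K" "K \<subseteq> {0..len e}" by (auto simp: closedin_closed_eq)
  show "closedin curve_topology (edge_pt e ` K)"
    unfolding closedin_curve_iff
  proof (intro conjI ballI)
    show "edge_pt e ` K \<subseteq> points" using edge_pt_in_points[OF e] by auto
    fix e' assume e': "e' \<in> arcs G"
    define A where "A = {t \<in> {0..len e'}. edge_pt e' t \<in> edge_pt e ` K}"
    define K' where "K' = (if e' = e then K else {})"
    have "A \<subseteq> K' \<union> {0, len e'}"
    proof
      fix t assume "t \<in> A"
      then obtain u where t: "0 \<le> t" "t \<le> len e'" and u: "u \<in> K" "edge_pt e' t = edge_pt e u"
        by (auto simp: A_def)
      have u': "0 \<le> u" "u \<le> len e" using u K by auto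
      show "t \<in> K' \<union> {0, len e'}"
      proof (cases rule: edge_pt_cases[OF e' t])
        case 3
        show ?thesis
          by (cases rule: edge_pt_cases[OF e u']) (use u 3 in \<open>simp_all add: K'_def\<close>)
      qed simp_all
    qed
    moreover have "K' \<subseteq> A" using K by (auto simp: K'_def A_def)
    ultimately have "A = K' \<union> (A \<inter> {0, len e'})" by blast
    moreover have "closed (K' \<union> (A \<inter> {0, len e'}))"
    proof (rule closed_Un)
      show "closed K'" using K by (simp add: K'_def)
    qed (simp add: finite_imp_closed)
    ultimately have "closed A" by metis
    then show "closed {t \<in> {0..len e'}. edge_pt e' t \<in> edge_pt e ` K}"
      unfolding A_def .
  qed
qed

lemma connectedin_edge_segment:
  assumes "e \<in> arcs G" "0 \<le> a" "b \<le> len e"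
  shows "connectedin curve_topology (edge_pt e ` {a..b})"
  by (rule connectedin_continuous_map_image[OF continuous_map_edge_pt[OF assms(1)]])
    (use assms in \<open>auto simp: connectedin_subtopology\<close>)

lemma closed_edge_cover:
  "points = Vertex ` verts G \<union> (\<Union>e\<in>arcs G. edge_pt e ` {0..len e})"
proof -
  have "Inner e t \<in> edge_pt e ` {0..len e}" if "0 < t" "t < len e" for e t
    using that by (intro image_eqI[of _ _ t]) auto
  then show ?thesis
    using edge_pt_in_points by (fastforce simp: points_def)
qed

lemma points_nonempty: "\<exists>v. v \<in> verts G"
proof -
  have "verts (with_proj (mk_symmetric G)) \<noteq> {}"
    using connected_curve unfolding Digraph_Component.connected_def strongly_connected_def by blast
  then show ?thesis by auto
qed

lemma rational_function_attains_max:
  assumes "rational_function f"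
  obtains x where "x \<in> points" "\<And>y. y \<in> points \<Longrightarrow> f y \<le> f x"
proof -
  have "f ` points = (f \<circ> Vertex) ` verts G \<union> (\<Union>e\<in>arcs G. (\<lambda>t. f (edge_pt e t)) ` {0..len e})"
    unfolding closed_edge_cover by (simp add: image_Un image_UN image_comp comp_def)
  also have "compact \<dots>"
  proof (intro compact_Un compact_UN)
    show "compact ((f \<circ> Vertex) ` verts G)" by (simp add: finite_imp_compact)
    show "compact ((\<lambda>t. f (edge_pt e t)) ` {0..len e})" if "e \<in> arcs G" for e
      using assms that by (intro compact_continuous_image) (auto simp: rational_function_def)
  qed simp
  finally have "compact (f ` points)" .
  moreover have "f ` points \<noteq> {}" using points_nonempty by (auto simp: points_def)
  ultimately obtain y where "y \<in> f ` points" "\<And>z. z \<in> f ` points \<Longrightarrow> z \<le> y"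
    using compact_attains_sup by metis
  then show thesis using that by auto
qed

end


section \<open>Arcs and connected sets\<close>

lemma connectedin_separationD:
  assumes "connectedin X S" "openin X A" "openin X B" "S \<subseteq> A \<union> B" "A \<inter> B = {}"
    and "a \<in> A" "a \<in> S" "b \<in> B" "b \<in> S"
  shows False
proof -
  have "A \<inter> B \<inter> S = {}" "A \<inter> S \<noteq> {}" "B \<inter> S \<noteq> {}" using assms by auto
  then show False using assms(1,2,3,4) unfolding connectedin by blast
qed

context tropical_curve
begin

lemma dirs_uniform_radius:
  fixes P :: "'e \<Rightarrow> real \<Rightarrow> real \<Rightarrow> real \<Rightarrow> bool"
  assumes "x \<in> points"
    and "\<And>e t d. (e, t, d) \<in> dirs x \<Longrightarrow> \<forall>\<^sub>F s in at_right 0. P e t d s"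
  obtains r where "0 < r" "\<And>e t d s. (e, t, d) \<in> dirs x \<Longrightarrow> 0 < s \<Longrightarrow> s < r \<Longrightarrow> P e t d s"
proof -
  have ev: "\<forall>\<^sub>F s in at_right 0. \<forall>b\<in>dirs x. case b of (e, t, d) \<Rightarrow> P e t d s"
    by (rule eventually_ball_finite[OF finite_dirs[OF assms(1)]]) (use assms(2) in auto)
  obtain r where r: "0 < r" "\<And>s. 0 < s \<Longrightarrow> s < r \<Longrightarrow> \<forall>b\<in>dirs x. case b of (e, t, d) \<Rightarrow> P e t d s"
    by (rule eventually_at_right_0_obtain[OF ev]) blast
  have "P e t d s" if "(e, t, d) \<in> dirs x" "0 < s" "s < r" for e t d s
    using r(2)[OF that(2,3)] that(1) by auto
  then show thesis using that r(1) by blast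
qed

lemma openin_open_arc:
  assumes e: "e \<in> arcs G" and "0 \<le> a" "b \<le> len e"
  shows "openin curve_topology (edge_pt e ` {a<..<b})"
  unfolding openin_curve_iff_dirs
proof (rule conjI[OF _ ballI])
  show "edge_pt e ` {a<..<b} \<subseteq> points" using edge_pt_in_points[OF e] by auto
  fix x assume "x \<in> edge_pt e ` {a<..<b}"
  then obtain u where u: "a < u" "u < b" "x = edge_pt e u" by auto
  then have x: "x = Inner e u" "0 < u" "u < len e" using assms by auto
  have arc: "\<forall>\<^sub>F s in at_right 0. edge_pt e (u + d * s) \<in> edge_pt e ` {a<..<b}" if "d = 1 \<or> d = - 1" for d
    by (rule eventually_at_right_0I[of "min (u - a) (b - u)"]) (use u that in auto)
  show "\<forall>(e', t, d)\<in>dirs x. \<forall>\<^sub>F s in at_right 0. edge_pt e' (t + d * s) \<in> edge_pt e ` {a<..<b}"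
    unfolding x(1) dirs_Inner[OF e x(2,3)] using arc[of 1] arc[of "- 1"] by simp
qed

lemma closedin_closed_arc:
  assumes "e \<in> arcs G" "0 \<le> a" "b \<le> len e"
  shows "closedin curve_topology (edge_pt e ` {a..b})"
proof -
  have "closedin (top_of_set {0..len e}) {a..b}"
    using assms by (intro closed_subset) auto
  then show ?thesis using closed_map_edge_pt[OF assms(1)] unfolding closed_map_def by blast
qed

lemma edge_pt_inj:
  assumes "e \<in> arcs G" "e' \<in> arcs G" "0 < t" "t < len e" "0 \<le> u" "u \<le> len e'" "edge_pt e t = edge_pt e' u"
  shows "e' = e \<and> u = t"
  using assms(2,5,6) by (cases rule: edge_pt_cases) (use assms in auto)

lemma closedin_point:
  assumes "x \<in> points"
  shows "closedin curve_topology {x}"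
  unfolding closedin_curve_iff
proof (intro conjI ballI)
  fix e assume e: "e \<in> arcs G"
  have "{t \<in> {0..len e}. edge_pt e t \<in> {x}} \<subseteq> {0, len e, case x of Vertex v \<Rightarrow> 0 | Inner e t \<Rightarrow> t}"
  proof
    fix t assume "t \<in> {t \<in> {0..len e}. edge_pt e t \<in> {x}}"
    then have t: "0 \<le> t" "t \<le> len e" "x = edge_pt e t" by auto
    from e t(1,2) show "t \<in> {0, len e, case x of Vertex v \<Rightarrow> 0 | Inner e t \<Rightarrow> t}"
      by (cases rule: edge_pt_cases) (use t in auto)
  qed
  then have "finite {t \<in> {0..len e}. edge_pt e t \<in> {x}}" by (rule finite_subset) auto
  then show "closed {t \<in> {0..len e}. edge_pt e t \<in> {x}}" by (rule finite_imp_closed)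
qed (use assms in auto)

lemma dirs_eventually_ne:
  assumes "(e, t, d) \<in> dirs x" "y \<in> points"
  shows "\<forall>\<^sub>F s in at_right 0. edge_pt e (t + d * s) \<noteq> y"
proof (cases "x = y")
  case True
  have "\<forall>\<^sub>F s in at_right (0::real). 0 < s" by (rule eventually_at_right_0I[of 1]) auto
  then show ?thesis using dirs_eventually_inner[OF assms(1)]
  proof eventually_elim
    case (elim s)
    note D = dirsD[OF assms(1)]
    have "t + d * s \<noteq> t" using elim D(5) by auto
    then show ?case
      using edge_pt_inj[OF D(1,1), of "t + d * s" t] elim D True by auto
  qed
next
  case False
  have "openin curve_topology (points - {y})"
    using closedin_point[OF assms(2)] topspace_curve_topology by (simp add: closedin_def)
  moreover have "x \<in> points - {y}" using False dirs_in_points[OF assms(1)] by simp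
  ultimately have "\<forall>\<^sub>F s in at_right 0. edge_pt e (t + d * s) \<in> points - {y}"
    using assms(1) unfolding openin_curve_iff_dirs by blast
  then show ?thesis by eventually_elim simp
qed

lemma directed_image:
  fixes t d :: real
  assumes d: "d = 1 \<or> d = - 1" and that: "a \<le> b"
  shows "(\<lambda>s. t + d * s) ` {a..b} = {min (t + d * a) (t + d * b)..max (t + d * a) (t + d * b)}"
  using d
proof
  assume "d = 1" then show ?thesis using that by (simp add: image_add_atLeastAtMost)
next
  assume "d = - 1" then show ?thesis using that by (simp add: image_diff_atLeastAtMost)
qed

lemma directed_image_open:
  fixes t d :: real
  assumes d: "d = 1 \<or> d = - 1" and that: "a \<le> b"
  shows "(\<lambda>s. t + d * s) ` {a<..<b} = {min (t + d * a) (t + d * b)<..<max (t + d * a) (t + d * b)}"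
  using d
proof
  assume "d = 1"
  moreover have "x \<in> (\<lambda>s. t + s) ` {a<..<b}" if "t + a < x" "x < t + b" for x
    using that by (intro image_eqI[of _ _ "x - t"]) auto
  ultimately show ?thesis using that by auto
next
  assume "d = - 1"
  moreover have "x \<in> (\<lambda>s. t - s) ` {a<..<b}" if "t - b < x" "x < t - a" for x
    using that by (intro image_eqI[of _ _ "t - x"]) auto
  ultimately show ?thesis using that by auto
qed

lemma
  assumes "e \<in> arcs G" "d = 1 \<or> d = - 1" "a \<le> b"
    and "0 \<le> t + d * a" "t + d * a \<le> len e" "0 \<le> t + d * b" "t + d * b \<le> len e"
  shows closedin_directed_arc: "closedin curve_topology ((\<lambda>s. edge_pt e (t + d * s)) ` {a..b})"
    and connectedin_directed_arc: "connectedin curve_topology ((\<lambda>s. edge_pt e (t + d * s)) ` {a..b})"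
    and openin_directed_arc: "openin curve_topology ((\<lambda>s. edge_pt e (t + d * s)) ` {a<..<b})"
proof -
  have eq: "(\<lambda>s. edge_pt e (t + d * s)) ` A = edge_pt e ` (\<lambda>s. t + d * s) ` A" for A
    by (simp add: image_image)
  show "closedin curve_topology ((\<lambda>s. edge_pt e (t + d * s)) ` {a..b})"
    unfolding eq directed_image[OF assms(2,3)] by (rule closedin_closed_arc) (use assms in auto)
  show "connectedin curve_topology ((\<lambda>s. edge_pt e (t + d * s)) ` {a..b})"
    unfolding eq directed_image[OF assms(2,3)] by (rule connectedin_edge_segment) (use assms in auto)
  show "openin curve_topology ((\<lambda>s. edge_pt e (t + d * s)) ` {a<..<b})"
    unfolding eq directed_image_open[OF assms(2,3)] by (rule openin_open_arc) (use assms in auto)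
qed

text \<open>Otherwise points with parameters \<open>s4 < s3 < s2 < s1\<close> would lie alternately
  in and out of \<open>X\<close>, and the open arc between the missed points at \<open>s3\<close>
  and \<open>s1\<close> would cut \<open>p s2\<close> off from \<open>p s4\<close>.\<close>

lemma connectedin_direction_dichotomy:
  assumes X: "connectedin curve_topology X" and b: "(e, t, d) \<in> dirs x"
  shows "(\<forall>\<^sub>F s in at_right 0. edge_pt e (t + d * s) \<in> X) \<or>
    (\<forall>\<^sub>F s in at_right 0. edge_pt e (t + d * s) \<notin> X)"
proof (rule ccontr)
  note D = dirsD[OF b]
  define p where "p s = edge_pt e (t + d * s)" for s
  assume "\<not> ?thesis"
  then have notin: "\<exists>s. 0 < s \<and> s < r \<and> p s \<notin> X" and inX: "\<exists>s. 0 < s \<and> s < r \<and> p s \<in> X"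
    if "0 < r" for r
    using that unfolding p_def eventually_at_right_field by blast+
  obtain r where r: "0 < r" "\<And>s. 0 < s \<Longrightarrow> s < r \<Longrightarrow> 0 < t + d * s \<and> t + d * s < len e"
    by (rule eventually_at_right_0_obtain[OF dirs_eventually_inner[OF b]]) blast
  obtain s1 where s1: "0 < s1" "s1 < r" "p s1 \<notin> X" using notin[OF r(1)] by blast
  obtain s2 where s2: "0 < s2" "s2 < s1" "p s2 \<in> X" using inX[OF s1(1)] by blast
  obtain s3 where s3: "0 < s3" "s3 < s2" "p s3 \<notin> X" using notin[OF s2(1)] by blast
  obtain s4 where s4: "0 < s4" "s4 < s3" "p s4 \<in> X" using inX[OF s3(1)] by blast
  have rng: "0 \<le> t + d * s \<and> t + d * s \<le> len e" if "0 < s" "s < r" for s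
    using r(2)[OF that] by auto
  have r13: "0 \<le> t + d * s3" "t + d * s3 \<le> len e" "0 \<le> t + d * s1" "t + d * s1 \<le> len e"
    using rng[of s3] rng[of s1] s1 s2 s3 by auto
  have op: "openin curve_topology (p ` {s3<..<s1})"
    unfolding p_def by (rule openin_directed_arc[OF D(1,5)]) (use s2 s3 r13 in auto)
  have cl: "closedin curve_topology (p ` {s3..s1})"
    unfolding p_def by (rule closedin_directed_arc[OF D(1,5)]) (use s2 s3 r13 in auto)
  have op': "openin curve_topology (points - p ` {s3..s1})"
    using cl by (simp add: closedin_def topspace_curve_topology)
  have "X \<subseteq> points" using X by (simp add: connectedin_def topspace_curve_topology)
  have cov: "X \<subseteq> p ` {s3<..<s1} \<union> (points - p ` {s3..s1})"
  proof
    fix x assume x: "x \<in> X"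
    show "x \<in> p ` {s3<..<s1} \<union> (points - p ` {s3..s1})"
    proof (cases "x \<in> p ` {s3..s1}")
      case True
      then obtain s where s: "s3 \<le> s" "s \<le> s1" "x = p s" by auto
      then have "s \<noteq> s3" "s \<noteq> s1" using x s1 s3 by auto
      then show ?thesis using s by auto
    qed (use x \<open>X \<subseteq> points\<close> in auto)
  qed
  have disj: "p ` {s3<..<s1} \<inter> (points - p ` {s3..s1}) = {}" by auto
  have "p s4 \<notin> p ` {s3..s1}"
  proof
    assume "p s4 \<in> p ` {s3..s1}"
    then obtain s where s: "s3 \<le> s" "s \<le> s1" "p s4 = p s" by auto
    have "t + d * s = t + d * s4"
      using edge_pt_inj[OF D(1,1), of "t + d * s4" "t + d * s"] r(2)[of s4] r(2)[of s] s s1 s2 s3 s4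
      unfolding p_def by auto
    then show False using D(5) s s4 by auto
  qed
  then have "p s4 \<in> points - p ` {s3..s1}" using s4 \<open>X \<subseteq> points\<close> by auto
  moreover have "p s2 \<in> p ` {s3<..<s1}" using s2 s3 by auto
  ultimately show False
    using connectedin_separationD[OF X op op' cov disj] s2(3) s4(3) by blast
qed

section \<open>Outgoing degree as the number of leaving directions\<close>

definition leaving :: "('v, 'e) curve_point set \<Rightarrow> ('v, 'e) curve_point \<Rightarrow> ('e \<times> real \<times> real) set" where
  "leaving X v = {(e, t, d) \<in> dirs v. \<forall>\<^sub>F s in at_right 0. edge_pt e (t + d * s) \<notin> X}"

text \<open>If every direction at \<open>v\<close> contained points close to \<open>v\<close> that are missed by the segment, then
  removing these points would separate \<open>v\<close> from the other end of the segment.\<close>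

lemma segment_covers_direction:
  assumes \<gamma>: "segment_path \<gamma>" and v: "\<gamma> 0 = v" "v \<in> points"
  shows "\<exists>(e, t, d)\<in>dirs v. \<forall>\<^sub>F s in at_right 0. edge_pt e (t + d * s) \<in> \<gamma> ` {0<..<1}"
proof (rule ccontr)
  assume none: "\<not> ?thesis"
  define p where "p b s = (case b of (e, t, d) \<Rightarrow> edge_pt e (t + d * s))" for b :: "'e \<times> real \<times> real" and s
  have p: "p (e, t, d) s = edge_pt e (t + d * s)" for e t d s by (simp add: p_def)
  have emb: "homeomorphic_map (top_of_set {0..1}) (subtopology curve_topology (\<gamma> ` {0..1})) \<gamma>"
    using \<gamma> by (simp add: segment_path_def embedding_map_def)
  have "continuous_map (top_of_set {0..1}) (subtopology curve_topology (\<gamma> ` {0..1})) \<gamma>"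
    by (rule homeomorphic_imp_continuous_map[OF emb])
  then have cont: "continuous_map (top_of_set {0..1}) curve_topology \<gamma>"
    by (simp add: continuous_map_in_subtopology)
  have inj: "inj_on \<gamma> {0..1}" using homeomorphic_imp_injective_map[OF emb] by simp
  have conn: "connectedin curve_topology (\<gamma> ` {0..1})"
    by (rule connectedin_continuous_map_image[OF cont]) (simp add: connectedin_subtopology)
  have sub: "\<gamma> ` {0..1} \<subseteq> points"
    using conn by (simp add: connectedin_def topspace_curve_topology)
  have "\<gamma> 1 \<noteq> v" using inj v by (auto dest: inj_onD)
  have "\<gamma> 1 \<in> points" using sub by auto
  obtain r where r: "0 < r" "\<And>e t d s. (e, t, d) \<in> dirs v \<Longrightarrow> 0 < s \<Longrightarrow> s < r \<Longrightarrow>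
      0 < t + d * s \<and> t + d * s < len e \<and> edge_pt e (t + d * s) \<noteq> \<gamma> 1 \<and> edge_pt e (t + d * s) \<noteq> v"
  proof (rule dirs_uniform_radius[OF v(2)])
    fix e t d assume b: "(e, t, d) \<in> dirs v"
    show "\<forall>\<^sub>F s in at_right 0. 0 < t + d * s \<and> t + d * s < len e \<and>
        edge_pt e (t + d * s) \<noteq> \<gamma> 1 \<and> edge_pt e (t + d * s) \<noteq> v"
      using dirs_eventually_inner[OF b] dirs_eventually_ne[OF b \<open>\<gamma> 1 \<in> points\<close>]
        dirs_eventually_ne[OF b v(2)]
      by eventually_elim simp
  qed blast
  have "\<exists>s. 0 < s \<and> s < r \<and> p b s \<notin> \<gamma> ` {0<..<1}" if "b \<in> dirs v" for b
  proof -
    obtain e t d where b: "b = (e, t, d)" by (cases b)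
    have "\<not> (\<forall>\<^sub>F s in at_right 0. edge_pt e (t + d * s) \<in> \<gamma> ` {0<..<1})"
      using none that unfolding b by blast
    then show ?thesis using r(1) unfolding eventually_at_right_field b p by blast
  qed
  then obtain \<rho> where \<rho>: "\<And>b. b \<in> dirs v \<Longrightarrow> 0 < \<rho> b \<and> \<rho> b < r \<and> p b (\<rho> b) \<notin> \<gamma> ` {0<..<1}"
    by metis
  \<comment> \<open>\<open>S\<close> is the star at \<open>v\<close> cut off just before the missed
    points and \<open>T\<close> includes them, so \<open>T - S\<close> contains nothing but cut-off
    points. The choice of \<open>r\<close> keeps these away from both ends of the segment as
    well.\<close>
  define S where "S = insert v (\<Union>b\<in>dirs v. p b ` {0<..<\<rho> b})"
  define T where "T = {v} \<union> (\<Union>b\<in>dirs v. p b ` {0..\<rho> b})"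
  have arc_open: "openin curve_topology (p b ` {0<..<\<rho> b})"
    and arc_closed: "closedin curve_topology (p b ` {0..\<rho> b})" if "b \<in> dirs v" for b
  proof -
    obtain e t d where b: "b = (e, t, d)" by (cases b)
    note D = dirsD[OF that[unfolded b]]
    have rng: "0 \<le> t + d * \<rho> b" "t + d * \<rho> b \<le> len e"
      using r(2)[OF that[unfolded b], of "\<rho> b"] \<rho>[OF that] by auto
    show "openin curve_topology (p b ` {0<..<\<rho> b})"
      using openin_directed_arc[OF D(1,5), of 0 "\<rho> b" t] rng D(2,3) \<rho>[OF that] by (simp add: b p_def)
    show "closedin curve_topology (p b ` {0..\<rho> b})"
      using closedin_directed_arc[OF D(1,5), of 0 "\<rho> b" t] rng D(2,3) \<rho>[OF that] by (simp add: b p_def)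
  qed
  have S_open: "openin curve_topology S"
    unfolding openin_curve_iff_dirs
  proof (rule conjI[OF _ ballI])
    show "S \<subseteq> points"
    proof -
      have "p b ` {0<..<\<rho> b} \<subseteq> points" if "b \<in> dirs v" for b
        using openin_subset[OF arc_open[OF that]] by (simp add: topspace_curve_topology)
      then show ?thesis using v(2) unfolding S_def by blast
    qed
    fix x assume x: "x \<in> S"
    show "\<forall>(e, t, d)\<in>dirs x. \<forall>\<^sub>F s in at_right 0. edge_pt e (t + d * s) \<in> S"
    proof (clarify)
      fix e t d assume b: "(e, t, d) \<in> dirs x"
      show "\<forall>\<^sub>F s in at_right 0. edge_pt e (t + d * s) \<in> S"
      proof (cases "x = v")
        case True
        show ?thesis
          by (rule eventually_at_right_0I[of "\<rho> (e, t, d)"])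
            (use b True \<rho> p in \<open>auto simp: S_def intro!: bexI[of _ "(e, t, d)"]\<close>)
      next
        case False
        then obtain b' where b': "b' \<in> dirs v" "x \<in> p b' ` {0<..<\<rho> b'}" using x by (auto simp: S_def)
        have "\<forall>\<^sub>F s in at_right 0. edge_pt e (t + d * s) \<in> p b' ` {0<..<\<rho> b'}"
          using arc_open[OF b'(1)] b b'(2) unfolding openin_curve_iff_dirs by blast
        then show ?thesis by eventually_elim (use b' in \<open>auto simp: S_def\<close>)
      qed
    qed
  qed
  have "closedin curve_topology T"
    unfolding T_def using finite_dirs[OF v(2)] arc_closed closedin_point[OF v(2)]
    by (intro closedin_Un closedin_Union) auto
  then have T_open: "openin curve_topology (points - T)"
    by (simp add: closedin_def topspace_curve_topology)
  have "S \<subseteq> T" by (fastforce simp: S_def T_def)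
  have cov: "\<gamma> ` {0..1} \<subseteq> S \<union> (points - T)"
  proof
    fix x assume x: "x \<in> \<gamma> ` {0..1}"
    show "x \<in> S \<union> (points - T)"
    proof (rule ccontr)
      assume "x \<notin> S \<union> (points - T)"
      then have "x \<in> T" "x \<notin> S" using x sub by auto
      then obtain b s where b: "b \<in> dirs v" "x = p b s" "0 \<le> s" "s \<le> \<rho> b" by (auto simp: S_def T_def)
      have "s \<noteq> 0"
      proof
        assume "s = 0"
        then have "x = v" using b(1,2) dirsD(4) by (cases b) (auto simp: p)
        then show False using \<open>x \<notin> S\<close> by (simp add: S_def)
      qed
      have "\<not> s < \<rho> b"
      proof
        assume "s < \<rho> b"
        then have "x \<in> p b ` {0<..<\<rho> b}" using \<open>s \<noteq> 0\<close> b by auto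
        then show False using b(1) \<open>x \<notin> S\<close> unfolding S_def by blast
      qed
      then have s: "s = \<rho> b" using b by simp
      obtain e t d where edb: "b = (e, t, d)" by (cases b)
      have "x \<noteq> \<gamma> 1" "x \<noteq> v"
        using r(2)[of e t d s] b s \<rho>[OF b(1)] by (auto simp: edb p)
      moreover have "x \<notin> \<gamma> ` {0<..<1}" using \<rho>[OF b(1)] b s by simp
      moreover obtain u where u: "0 \<le> u" "u \<le> 1" "x = \<gamma> u" using x by auto
      ultimately have "u \<noteq> 0" "u \<noteq> 1" "u \<notin> {0<..<1}" using v by auto
      then show False using u by auto
    qed
  qed
  have "\<gamma> 1 \<notin> T"
  proof
    assume "\<gamma> 1 \<in> T"
    then obtain b s where b: "b \<in> dirs v" "\<gamma> 1 = p b s" "0 \<le> s" "s \<le> \<rho> b"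
      using \<open>\<gamma> 1 \<noteq> v\<close> by (auto simp: T_def)
    obtain e t d where edb: "b = (e, t, d)" by (cases b)
    have "s \<noteq> 0" using b(1,2) dirsD(4) \<open>\<gamma> 1 \<noteq> v\<close> by (auto simp: edb p)
    then show False using r(2)[of e t d s] b \<rho>[OF b(1)] by (auto simp: edb p)
  qed
  then have "\<gamma> 1 \<in> points - T" using \<open>\<gamma> 1 \<in> points\<close> by simp
  moreover have "S \<inter> (points - T) = {}" using \<open>S \<subseteq> T\<close> by auto
  moreover have "v \<in> S" by (simp add: S_def)
  moreover have "v \<in> \<gamma> ` {0..1}" "\<gamma> 1 \<in> \<gamma> ` {0..1}" using v by auto
  ultimately show False
    using connectedin_separationD[OF conn S_open T_open cov] by blast
qed

text \<open>The bound \<open>r < len e\<close> prevents a segment on a loop from returning to its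
  vertex: two coordinates on one edge give the same point only if they are equal or are the two
  ends. Injectivity and closedness then give the embedding.\<close>

lemma directed_segment_path:
  assumes b: "(e, t, d) \<in> dirs v" and r: "0 < r" "r < len e" "0 \<le> t + d * r" "t + d * r \<le> len e"
  shows "segment_path (\<lambda>u. edge_pt e (t + d * (r * u)))"
proof -
  note D = dirsD[OF b]
  define q where "q u = t + d * (r * u)" for u
  have q: "q u \<in> {0..len e}" if "u \<in> {0..1}" for u
  proof -
    have "0 \<le> r * u" "r * u \<le> r" using r(1) that by (auto simp: mult_le_cancel_left1 mult_left_le)
    then show ?thesis using D r(3,4) unfolding q_def by auto
  qed
  have cont: "continuous_map (top_of_set {0..1}) (top_of_set {0..len e}) q"
    using q by (auto simp: q_def continuous_map_in_subtopology intro!: continuous_intros)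
  have "closed_map (top_of_set {0..1}) (top_of_set {0..len e}) q"
    unfolding closed_map_def
  proof (intro allI impI)
    fix K assume "closedin (top_of_set {0..1}) (K :: real set)"
    then have K: "closed K" "K \<subseteq> {0..1}" by (auto simp: closedin_closed_eq)
    then have "compact K" using bounded_subset[of "{0..1::real}" K] by (simp add: compact_eq_bounded_closed)
    then have "compact (q ` K)" unfolding q_def by (intro compact_continuous_image continuous_intros)
    then show "closedin (top_of_set {0..len e}) (q ` K)"
      using K(2) q by (intro closed_subset) (auto simp: compact_imp_closed)
  qed
  then have "closed_map (top_of_set {0..1}) curve_topology (edge_pt e \<circ> q)"
    by (rule closed_map_compose[OF _ closed_map_edge_pt[OF D(1)]])
  moreover have "continuous_map (top_of_set {0..1}) curve_topology (edge_pt e \<circ> q)"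
    by (rule continuous_map_compose[OF cont continuous_map_edge_pt[OF D(1)]])
  moreover have "inj_on (edge_pt e \<circ> q) (topspace (top_of_set {0..1}))"
  proof (rule inj_onI)
    fix u w assume "u \<in> topspace (top_of_set {0..1::real})" "w \<in> topspace (top_of_set {0..1::real})"
      and eq: "(edge_pt e \<circ> q) u = (edge_pt e \<circ> q) w"
    then have uw: "u \<in> {0..1}" "w \<in> {0..1}" by auto
    have "\<bar>q u - q w\<bar> = r * \<bar>u - w\<bar>"
      using D(5) r(1) unfolding q_def by (auto simp: abs_mult right_diff_distrib[symmetric] abs_minus_commute)
    also have "\<dots> \<le> r" using uw r(1) by (auto simp: mult_left_le)
    finally have "\<bar>q u - q w\<bar> < len e" using r(2) by simp
    moreover have "q u = q w \<or> \<bar>q u - q w\<bar> = len e"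
    proof (cases "0 < q u \<and> q u < len e")
      case True
      then show ?thesis using edge_pt_inj[OF D(1,1), of "q u" "q w"] eq q[OF uw(2)] by auto
    next
      case False
      then have "q u = 0 \<or> q u = len e" using q[OF uw(1)] by auto
      moreover have "q w = 0 \<or> q w = len e"
        using edge_pt_inj[OF D(1,1), of "q w" "q u"] eq q[OF uw(2)] q[OF uw(1)] False by force
      ultimately show ?thesis using len_pos[OF D(1)] by auto
    qed
    ultimately have "q u = q w" by auto
    then show "u = w" using D(5) r(1) by (auto simp: q_def)
  qed
  ultimately have "embedding_map (top_of_set {0..1}) curve_topology (edge_pt e \<circ> q)"
    using injective_closed_imp_embedding_map by blast
  then show ?thesis by (simp add: segment_path_def comp_def q_def)
qed

text \<open>Each segment swallows the beginning of some direction, which therefore leaves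
  \<open>X\<close>, and disjoint segments swallow different ones. Conversely, short straight pieces
  along the leaving directions are admissible and disjoint.\<close>

lemma outdeg_eq:
  assumes v: "v \<in> points"
  shows "outdeg X v = card (leaving X v)"
proof -
  define N where "N = {n. \<exists>\<gamma> :: nat \<Rightarrow> real \<Rightarrow> ('v, 'e) curve_point.
     (\<forall>i<n. segment_path (\<gamma> i) \<and> \<gamma> i 0 = v \<and> \<gamma> i ` {0..1} \<subseteq> points - (X - {v})) \<and>
     (\<forall>i<n. \<forall>j<n. i \<noteq> j \<longrightarrow> \<gamma> i ` {0<..<1} \<inter> \<gamma> j ` {0<..<1} = {})}"
  have fin: "finite (leaving X v)"
    using finite_dirs[OF v] by (rule rev_finite_subset) (auto simp: leaving_def)
  have le: "n \<le> card (leaving X v)" if "n \<in> N" for n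
  proof -
    have "\<exists>\<gamma> :: nat \<Rightarrow> real \<Rightarrow> ('v, 'e) curve_point.
     (\<forall>i<n. segment_path (\<gamma> i) \<and> \<gamma> i 0 = v \<and> \<gamma> i ` {0..1} \<subseteq> points - (X - {v})) \<and>
     (\<forall>i<n. \<forall>j<n. i \<noteq> j \<longrightarrow> \<gamma> i ` {0<..<1} \<inter> \<gamma> j ` {0<..<1} = {})"
      using that unfolding N_def by (rule CollectD)
    then obtain \<gamma> :: "nat \<Rightarrow> real \<Rightarrow> ('v, 'e) curve_point" where
      \<gamma>': "(\<forall>i<n. segment_path (\<gamma> i) \<and> \<gamma> i 0 = v \<and> \<gamma> i ` {0..1} \<subseteq> points - (X - {v})) \<and>
        (\<forall>i<n. \<forall>j<n. i \<noteq> j \<longrightarrow> \<gamma> i ` {0<..<1} \<inter> \<gamma> j ` {0<..<1} = {})"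
      by (rule exE)
    note \<gamma> = \<gamma>'[THEN conjunct1, rule_format] and disj = \<gamma>'[THEN conjunct2, rule_format]
    have "\<exists>b. b \<in> dirs v \<and> (case b of (e, t, d) \<Rightarrow> \<forall>\<^sub>F s in at_right 0. edge_pt e (t + d * s) \<in> \<gamma> i ` {0<..<1})"
      if "i < n" for i
      using segment_covers_direction[of "\<gamma> i" v] \<gamma>[OF that] v by blast
    then obtain b where b: "\<And>i. i < n \<Longrightarrow> b i \<in> dirs v \<and>
      (case b i of (e, t, d) \<Rightarrow> \<forall>\<^sub>F s in at_right 0. edge_pt e (t + d * s) \<in> \<gamma> i ` {0<..<1})"
      by metis
    have "b i \<in> leaving X v" if "i < n" for i
    proof -
      obtain e t d where edb: "b i = (e, t, d)" by (cases "b i")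
      have bd: "(e, t, d) \<in> dirs v" using b[OF that] edb by simp
      have "\<forall>\<^sub>F s in at_right 0. edge_pt e (t + d * s) \<in> \<gamma> i ` {0<..<1}" using b[OF that] edb by simp
      then have "\<forall>\<^sub>F s in at_right 0. edge_pt e (t + d * s) \<notin> X"
        using dirs_eventually_ne[OF bd v]
      proof eventually_elim
        case (elim s)
        then have "edge_pt e (t + d * s) \<in> \<gamma> i ` {0..1}" by auto
        then show ?case using \<gamma>[OF that] elim by auto
      qed
      then show ?thesis using bd edb by (simp add: leaving_def)
    qed
    moreover have "inj_on b {..<n}"
    proof (rule inj_onI, rule ccontr)
      fix i j assume ij: "i \<in> {..<n}" "j \<in> {..<n}" "b i = b j" "i \<noteq> j"
      obtain e t d where edb: "b i = (e, t, d)" by (cases "b i")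
      have "\<forall>\<^sub>F s in at_right 0. edge_pt e (t + d * s) \<in> \<gamma> i ` {0<..<1}"
        "\<forall>\<^sub>F s in at_right 0. edge_pt e (t + d * s) \<in> \<gamma> j ` {0<..<1}"
        using b[of i] b[of j] ij edb by auto
      then have "\<forall>\<^sub>F s in at_right (0::real). False"
        by eventually_elim (use disj[of i j] ij in auto)
      then show False by simp
    qed
    ultimately have "card {..<n} \<le> card (leaving X v)"
      using fin by (intro card_inj_on_le[of b]) auto
    then show ?thesis by simp
  qed
  have "card (leaving X v) \<in> N"
  proof -
    \<comment> \<open>The condition \<open>2 * s < len e\<close> makes each piece shorter than its
      edge and keeps the pieces starting at the two ends of a loop apart.\<close>
    obtain r where r: "0 < r" "\<And>e t d s. (e, t, d) \<in> dirs v \<Longrightarrow> 0 < s \<Longrightarrow> s < r \<Longrightarrow>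
      (0 < t + d * s \<and> t + d * s < len e) \<and> 2 * s < len e \<and>
      ((e, t, d) \<in> leaving X v \<longrightarrow> edge_pt e (t + d * s) \<notin> X)"
    proof (rule dirs_uniform_radius[OF v])
      fix e t d assume b: "(e, t, d) \<in> dirs v"
      have 1: "\<forall>\<^sub>F s in at_right 0. 2 * s < len e"
        by (rule eventually_at_right_0I[of "len e / 2"]) (use len_pos dirsD(1)[OF b] in auto)
      have 2: "\<forall>\<^sub>F s in at_right 0. (e, t, d) \<in> leaving X v \<longrightarrow> edge_pt e (t + d * s) \<notin> X"
        by (cases "(e, t, d) \<in> leaving X v") (auto simp: leaving_def)
      show "\<forall>\<^sub>F s in at_right 0. (0 < t + d * s \<and> t + d * s < len e) \<and> 2 * s < len e \<and>
        ((e, t, d) \<in> leaving X v \<longrightarrow> edge_pt e (t + d * s) \<notin> X)"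
        using dirs_eventually_inner[OF b] 1 2 by eventually_elim blast
    qed blast
    define \<rho> where "\<rho> = r / 2"
    have \<rho>: "0 < \<rho>" "\<rho> < r" using r(1) by (auto simp: \<rho>_def)
    define g where "g b u = (case b of (e, t, d) \<Rightarrow> edge_pt e (t + d * (\<rho> * u)))"
      for b :: "'e \<times> real \<times> real" and u
    have small: "0 < \<rho> * u \<and> \<rho> * u < r" if "0 < u" "u \<le> 1" for u
    proof -
      have "0 < \<rho> * u" "\<rho> * u \<le> \<rho>" using that \<rho> by (simp_all add: mult_left_le)
      then show ?thesis using \<rho>(2) by linarith
    qed
    have seg: "segment_path (g b) \<and> g b 0 = v \<and> g b ` {0..1} \<subseteq> points - (X - {v})"
      if "b \<in> leaving X v" for b
    proof -
      obtain e t d where edb: "b = (e, t, d)" by (cases b)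
      have bd: "(e, t, d) \<in> dirs v" using that edb by (auto simp: leaving_def)
      note D = dirsD[OF bd]
      have "g b = (\<lambda>u. edge_pt e (t + d * (\<rho> * u)))" by (simp add: g_def edb fun_eq_iff)
      moreover have "segment_path (\<lambda>u. edge_pt e (t + d * (\<rho> * u)))"
        by (rule directed_segment_path[OF bd]) (use r(2)[OF bd \<rho>] \<rho> in auto)
      moreover have "g b 0 = v" using D by (simp add: g_def edb)
      moreover have "g b u \<in> points - (X - {v})" if u: "u \<in> {0..1}" for u
      proof (cases "u = 0")
        case True then show ?thesis using \<open>g b 0 = v\<close> v by simp
      next
        case False
        then have "0 < \<rho> * u" "\<rho> * u < r" using small[of u] u by auto
        from r(2)[OF bd this] \<open>b \<in> leaving X v\<close>[unfolded edb] have "edge_pt e (t + d * (\<rho> * u)) \<notin> X" by blast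
        then show ?thesis using edge_pt_in_points[OF D(1)] by (simp add: g_def edb)
      qed
      ultimately show ?thesis by auto
    qed
    have disj: "g b ` {0<..<1} \<inter> g b' ` {0<..<1} = {}"
      if "b \<in> leaving X v" "b' \<in> leaving X v" "b \<noteq> b'" for b b'
    proof (rule ccontr)
      assume "g b ` {0<..<1} \<inter> g b' ` {0<..<1} \<noteq> {}"
      then obtain u u' where u: "0 < u" "u < 1" "0 < u'" "u' < 1" "g b u = g b' u'" by auto
      obtain e t d where edb: "b = (e, t, d)" by (cases b)
      obtain e' t' d' where edb': "b' = (e', t', d')" by (cases b')
      have bd: "(e, t, d) \<in> dirs v" "(e', t', d') \<in> dirs v" using that edb edb' by (auto simp: leaving_def)
      note D = dirsD[OF bd(1)] and D' = dirsD[OF bd(2)]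
      define s s' where "s = \<rho> * u" and "s' = \<rho> * u'"
      have s: "0 < s" "s < r" "0 < s'" "s' < r" using small u by (auto simp: s_def s'_def)
      have eq: "edge_pt e (t + d * s) = edge_pt e' (t' + d' * s')"
        using u(5) by (simp add: g_def edb edb' s_def s'_def)
      have ee: "e' = e" "t' + d' * s' = t + d * s"
        using edge_pt_inj[OF D(1) D'(1), of "t + d * s" "t' + d' * s'"] eq r(2)[OF bd(1) s(1,2)]
          r(2)[OF bd(2) s(3,4)] by auto
      have "t = t' \<or> \<bar>t - t'\<bar> = len e"
      proof (cases "0 < t \<and> t < len e")
        case True
        then show ?thesis using edge_pt_inj[OF D(1) D'(1), of t t'] D D' by auto
      next
        case False
        then have "t = 0 \<or> t = len e" using D by auto
        moreover have "t' = 0 \<or> t' = len e"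
          using edge_pt_inj[OF D'(1) D(1), of t' t] D D' False ee(1) by force
        ultimately show ?thesis using len_pos[OF D(1)] by auto
      qed
      moreover have "\<bar>t - t'\<bar> < len e"
        using r(2)[OF bd(1) s(1,2)] r(2)[OF bd(2) s(3,4)] ee D(5) D'(5) s by auto
      ultimately have "t = t'" by simp
      then have "d * s = d' * s'" using ee by simp
      then have "d = d'" using D(5) D'(5) s by auto
      then show False using that(3) edb edb' ee(1) \<open>t = t'\<close> by simp
    qed
    obtain h where h: "bij_betw h {0..<card (leaving X v)} (leaving X v)"
      using ex_bij_betw_nat_finite[OF fin] by blast
    have hin: "h i \<in> leaving X v" if "i < card (leaving X v)" for i
      using bij_betwE[OF h] that by auto
    have hinj: "h i \<noteq> h j" if "i < card (leaving X v)" "j < card (leaving X v)" "i \<noteq> j" for i j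
      using bij_betw_imp_inj_on[OF h] that by (auto dest: inj_onD)
    show ?thesis
      unfolding N_def
      by (rule CollectI, rule exI[of _ "\<lambda>i. g (h i)"]) (use seg disj hin hinj in auto)
  qed
  then have "Max N = card (leaving X v)"
    using le by (intro Max_eqI) (auto intro: finite_subset[of N "{..card (leaving X v)}"])
  then show ?thesis unfolding outdeg_def N_def .
qed


subsection \<open>Reduced divisors dominate\<close>

lemma closedin_level_set:
  assumes "rational_function h"
  shows "closedin curve_topology {x \<in> points. h x = M}"
  unfolding closedin_curve_iff
proof (intro conjI ballI)
  fix e assume e: "e \<in> arcs G"
  have "closed {t \<in> {0..len e}. h (edge_pt e t) = M}"
    using assms e by (intro continuous_closed_preimage_constant) (auto simp: rational_function_def)
  then show "closed {t \<in> {0..len e}. edge_pt e t \<in> {x \<in> points. h x = M}}"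
    using edge_pt_in_points[OF e] by simp
qed auto

lemma slope_nonpos_at_max:
  assumes h: "rational_function h" and b: "(e, t, d) \<in> dirs x" and "\<And>y. y \<in> points \<Longrightarrow> h y \<le> h x"
  shows "slope h e t d \<le> 0"
proof -
  have "of_int (slope h e t d) \<le> (0::real)"
    by (rule germ_le[OF rational_germ[OF h b]])
      (use assms(3) edge_pt_in_points dirsD(1,4)[OF b] in auto)
  then show ?thesis by simp
qed

text \<open>Let \<open>h\<close> be the difference of the two functions and \<open>X\<close> a component of the set where \<open>h\<close> is
  maximal. In every direction leaving \<open>X\<close> the slope of \<open>h\<close> is at most \<open>-1\<close>, so the reduced divisor
  has at least \<open>outdeg X v\<close> chips at each boundary point \<open>v\<close>. Hence \<open>X\<close> contains \<open>P\<close>.\<close>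

lemma reduced_dominates:
  assumes f: "rational_function f" and g: "rational_function g" and P: "P \<in> points"
    and red: "reduced P (\<lambda>x. D x + div_of f x)"
    and pos: "\<And>v. v \<in> points \<Longrightarrow> v \<noteq> P \<Longrightarrow> 0 \<le> D v + div_of g v"
    and x: "x \<in> points"
  shows "g x - g P \<le> f x - f P"
proof -
  define h where "h = (\<lambda>x. g x - f x)"
  have h: "rational_function h" unfolding h_def by (rule rational_function_diff[OF g f])
  have div_h: "div_of h v = div_of g v - div_of f v" for v
    unfolding h_def by (rule div_of_diff[OF g f])
  obtain y where y: "y \<in> points" "\<And>z. z \<in> points \<Longrightarrow> h z \<le> h y"
    by (rule rational_function_attains_max[OF h]) blast
  define Y where "Y = {z \<in> points. h z = h y}"
  \<comment> \<open>A component is taken, rather than the whole set of maxima, because reducedness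
    only tests connected sets.\<close>
  define X where "X = connected_component_of_set (subtopology curve_topology Y) y"
  have "closedin curve_topology Y" unfolding Y_def by (rule closedin_level_set[OF h])
  then have closed: "closedin curve_topology X"
    unfolding X_def by (rule closedin_trans_full[OF closedin_connected_component_of])
  have "connectedin (subtopology curve_topology Y) X"
    unfolding X_def by (rule connectedin_connected_component_of)
  then have conn: "connectedin curve_topology X" and XY: "X \<subseteq> Y"
    by (auto simp: connectedin_subtopology)
  have "y \<in> Y" using y(1) by (simp add: Y_def)
  then have "y \<in> X"
    unfolding X_def using y(1)
    by (auto simp: connected_component_of_refl topspace_curve_topology)
  have maximal: "A \<subseteq> X" if A: "connectedin curve_topology A" "A \<subseteq> Y" "A \<inter> X \<noteq> {}" for A
  proof -
    have "connectedin curve_topology (X \<union> A)" using connectedin_Un[OF conn A(1)] A(3) by blast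
    then have "connectedin (subtopology curve_topology Y) (X \<union> A)"
      using A(2) XY by (simp add: connectedin_subtopology)
    moreover have "y \<in> X \<union> A" using \<open>y \<in> X\<close> by simp
    ultimately have "X \<union> A \<subseteq> connected_component_of_set (subtopology curve_topology Y) y"
      by (rule connected_component_of_maximal)
    then show ?thesis unfolding X_def by blast
  qed
  have slopes: "slope h e t d \<le> 0" "(e, t, d) \<in> leaving X v \<Longrightarrow> slope h e t d \<le> - 1"
    if v: "v \<in> X" and b: "(e, t, d) \<in> dirs v" for v e t d
  proof -
    have hv: "h v = h y" using v XY by (auto simp: Y_def)
    show le: "slope h e t d \<le> 0" by (rule slope_nonpos_at_max[OF h b]) (use y(2) hv in auto)
    assume leave: "(e, t, d) \<in> leaving X v"
    note D = dirsD[OF b]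
    show "slope h e t d \<le> - 1"
    proof (rule ccontr)
      assume "\<not> ?thesis"
      \<comment> \<open>With slope \<open>0\<close> the function \<open>h\<close> would keep its
        maximum along a short arc at \<open>v\<close>. The component \<open>X\<close> would have to
        absorb this arc, although the direction leaves \<open>X\<close>.\<close>
      then have "slope h e t d = 0" using le by simp
      then have "\<forall>\<^sub>F s in at_right 0. h (edge_pt e (t + d * s)) = h y"
        using rational_germ[OF h b] hv D(4) by (simp add: germ_def)
      then have ev: "\<forall>\<^sub>F s in at_right 0. h (edge_pt e (t + d * s)) = h y \<and>
          (0 < t + d * s \<and> t + d * s < len e) \<and> edge_pt e (t + d * s) \<notin> X"
        using dirs_eventually_inner[OF b] leave by (auto simp: leaving_def eventually_conj_iff)
      obtain r where r: "0 < r" "\<And>s. 0 < s \<Longrightarrow> s < r \<Longrightarrow> h (edge_pt e (t + d * s)) = h y \<and>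
          (0 < t + d * s \<and> t + d * s < len e) \<and> edge_pt e (t + d * s) \<notin> X"
        by (rule eventually_at_right_0_obtain[OF ev]) blast
      define s where "s = r / 2"
      have s: "0 < s" "s < r" using r(1) by (auto simp: s_def)
      define A where "A = (\<lambda>s. edge_pt e (t + d * s)) ` {0..s}"
      have "connectedin curve_topology A"
        unfolding A_def by (rule connectedin_directed_arc[OF D(1,5)]) (use D r(2)[OF s] s in auto)
      moreover have "A \<subseteq> Y"
      proof
        fix z assume "z \<in> A"
        then obtain u where u: "0 \<le> u" "u \<le> s" "z = edge_pt e (t + d * u)" by (auto simp: A_def)
        have "z \<in> points" unfolding u(3) by (rule edge_pt_in_points[OF D(1)])
        moreover have "h z = h y"
        proof (cases "u = 0")
          case True then show ?thesis using u(3) D(4) hv by simp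
        next
          case False
          then have "0 < u" "u < r" using u s by auto
          then show ?thesis using r(2) unfolding u(3) by blast
        qed
        ultimately show "z \<in> Y" by (simp add: Y_def)
      qed
      moreover have "v \<in> A" using D(4) s(1) by (auto simp: A_def intro!: image_eqI[of _ _ 0])
      ultimately have "A \<subseteq> X" using maximal v by blast
      moreover have "edge_pt e (t + d * s) \<in> A" using s by (auto simp: A_def)
      ultimately show False using r(2)[OF s] by blast
    qed
  qed
  have "P \<in> X"
  proof (rule ccontr)
    assume "P \<notin> X"
    have "X \<noteq> {}" using \<open>y \<in> X\<close> by blast
    then obtain v where v: "v \<in> curve_topology frontier_of X" "D v + div_of f v < int (outdeg X v)"
      using red closed conn \<open>P \<notin> X\<close> unfolding reduced_def by blast
    have vX: "v \<in> X" using v(1) frontier_of_subset_closedin[OF closed] by blast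
    then have vp: "v \<in> points" using XY by (auto simp: Y_def)
    have "v \<noteq> P" using vX \<open>P \<notin> X\<close> by blast
    have fin: "finite (dirs v)" by (rule finite_dirs[OF vp])
    have sub: "leaving X v \<subseteq> dirs v" by (auto simp: leaving_def)
    have "(\<Sum>(e, t, d)\<in>dirs v. slope h e t d) \<le> (\<Sum>b\<in>dirs v. if b \<in> leaving X v then - 1 else 0)"
      by (rule sum_mono) (use slopes[OF vX] in auto)
    also have "\<dots> = - int (card (leaving X v))"
      using sub by (simp add: sum.If_cases[OF fin] Int_absorb1)
    finally have "div_of h v \<le> - int (outdeg X v)"
      using vp by (simp add: div_of_def ord_at_dirs outdeg_eq)
    \<comment> \<open>Effectivity for \<open>g\<close> is assumed away from \<open>P\<close> only,
      and \<open>v\<close> lies in \<open>X\<close>, which misses \<open>P\<close>. As the order of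
      \<open>f\<close> is that of \<open>g\<close> minus that of \<open>h\<close>, the point
      \<open>v\<close> has at least \<open>outdeg X v\<close> chips.\<close>
    moreover have "0 \<le> D v + div_of g v" by (rule pos[OF vp \<open>v \<noteq> P\<close>])
    ultimately show False using v(2) div_h[of v] by simp
  qed
  then have "h P = h y" using XY by (auto simp: Y_def)
  then show ?thesis using y(2)[OF x] by (simp add: h_def)
qed

subsection \<open>Convexity and oscillation\<close>

lemma divisor_star:
  assumes "is_divisor D" "x \<in> points"
  obtains \<delta> where "0 < \<delta>" "\<And>e t d s. (e, t, d) \<in> dirs x \<Longrightarrow> 0 < s \<Longrightarrow> s \<le> \<delta> \<Longrightarrow>
    0 < t + d * s \<and> t + d * s < len e \<and> D (edge_pt e (t + d * s)) = 0"
proof -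
  obtain r where r: "0 < r" "\<And>e t d s. (e, t, d) \<in> dirs x \<Longrightarrow> 0 < s \<Longrightarrow> s < r \<Longrightarrow>
    (0 < t + d * s \<and> t + d * s < len e) \<and> (\<forall>y\<in>{y. D y \<noteq> 0}. edge_pt e (t + d * s) \<noteq> y)"
  proof (rule dirs_uniform_radius[OF assms(2)])
    fix e t d assume b: "(e, t, d) \<in> dirs x"
    have "\<forall>\<^sub>F s in at_right 0. \<forall>y\<in>{y. D y \<noteq> 0}. edge_pt e (t + d * s) \<noteq> y"
      using assms(1) dirs_eventually_ne[OF b] unfolding is_divisor_def
      by (intro eventually_ball_finite) auto
    then show "\<forall>\<^sub>F s in at_right 0. (0 < t + d * s \<and> t + d * s < len e) \<and>
        (\<forall>y\<in>{y. D y \<noteq> 0}. edge_pt e (t + d * s) \<noteq> y)"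
      using dirs_eventually_inner[OF b] by eventually_elim blast
  qed blast
  \<comment> \<open>Half the radius is used, so that the far end \<open>s = \<delta>\<close> of each
    arm is included.\<close>
  show thesis
  proof (rule that[of "r / 2"])
    show "0 < r / 2" using r(1) by simp
    fix e t d s assume "(e, t, d) \<in> dirs x" "0 < s" "s \<le> r / 2"
    then have "(0 < t + d * s \<and> t + d * s < len e) \<and> (\<forall>y\<in>{y. D y \<noteq> 0}. edge_pt e (t + d * s) \<noteq> y)"
      using r(1) by (intro r(2)) auto
    then show "0 < t + d * s \<and> t + d * s < len e \<and> D (edge_pt e (t + d * s)) = 0" by blast
  qed
qed

text \<open>Where \<open>D\<close> vanishes, effectivity of \<open>D + div_of f\<close> leaves no
  negative order, so \<open>f\<close> is convex along the arm. The centre \<open>x\<close> is only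
  an end of the arm: it may be a vertex or carry chips, and the tangent at \<open>s = 0\<close> is
  still a supporting line.\<close>

lemma R_space_tangent:
  assumes f: "f \<in> R_space D" and b: "(e, t, d) \<in> dirs x"
    and star: "\<And>s. 0 < s \<Longrightarrow> s \<le> \<delta> \<Longrightarrow>
      0 < t + d * s \<and> t + d * s < len e \<and> D (edge_pt e (t + d * s)) = 0"
    and s: "0 \<le> s" "s < \<delta>" and u: "0 \<le> u" "u \<le> \<delta>"
  shows "f (edge_pt e (t + d * s)) + of_int (slope f e (t + d * s) d) * (u - s) \<le> f (edge_pt e (t + d * u))"
proof -
  note D = dirsD[OF b]
  have rat: "rational_function f" and eff: "\<And>x. 0 \<le> D x + div_of f x"
    using f by (auto simp: R_space_def effective_def)
  define \<phi> where "\<phi> = (\<lambda>u. f (edge_pt e (t + d * u)))"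
  define r l :: "real \<Rightarrow> real" where "r u = of_int (slope f e (t + d * u) d)"
    and "l u = of_int (slope f e (t + d * u) (- d))" for u
  have inner: "dirs (Inner e (t + d * u)) = {(e, t + d * u, 1), (e, t + d * u, - 1)}"
    "edge_pt e (t + d * u) = Inner e (t + d * u)" if "0 < u" "u \<le> \<delta>" for u
    using star[OF that] D(1) by (simp_all add: dirs_Inner)
  have germs: "germ \<phi> u 1 (r u)" if "0 \<le> u" "u < \<delta>" for u
  proof -
    have "(e, t + d * u, d) \<in> dirs (edge_pt e (t + d * u))"
      using b D(4,5) inner[of u] that by (cases "u = 0") auto
    from rational_germ[OF rat this] show ?thesis
      unfolding \<phi>_def r_def using germ_line[of "\<lambda>u. f (edge_pt e u)" t d u 1] by simp
  qed
  have germs': "germ \<phi> u (- 1) (l u)" if "0 < u" "u \<le> \<delta>" for u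
  proof -
    have "(e, t + d * u, - d) \<in> dirs (edge_pt e (t + d * u))"
      using D(5) inner[OF that] by auto
    from rational_germ[OF rat this] show ?thesis
      unfolding \<phi>_def l_def using germ_line[of "\<lambda>u. f (edge_pt e u)" t d u "- 1"] by simp
  qed
  have bend: "0 \<le> r u + l u" if "0 < u" "u < \<delta>" for u
  proof -
    have "D (Inner e (t + d * u)) = 0" using star[of u] inner(2)[of u] that by simp
    then have "0 \<le> div_of f (Inner e (t + d * u))" using eff[of "Inner e (t + d * u)"] by simp
    moreover have "Inner e (t + d * u) \<in> points"
      using edge_pt_in_points[OF D(1), of "t + d * u"] inner(2)[of u] that by simp
    ultimately have "0 \<le> slope f e (t + d * u) 1 + slope f e (t + d * u) (- 1)"
      by (simp add: div_of_def ord_at_def)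
    then have "0 \<le> slope f e (t + d * u) d + slope f e (t + d * u) (- d)" using D(5) by auto
    then show ?thesis unfolding r_def l_def by (simp flip: of_int_add)
  qed
  have "\<phi> s + r s * (u - s) \<le> \<phi> u"
    by (rule convex_germs_tangent[of 0 \<delta> \<phi> r l]) (use germs germs' bend s u in auto)
  then show ?thesis by (simp add: \<phi>_def r_def)
qed

text \<open>The oscillation on a small set has no local bound; it is controlled by how far
  \<open>f\<close> has dropped below a global bound \<open>M\<close>. Letting \<open>K'\<close>
  depend on an arbitrary \<open>K\<close> allows the estimate to be chained.\<close>

definition harnack :: "(('v, 'e) curve_point \<Rightarrow> int) \<Rightarrow> ('v, 'e) curve_point set \<Rightarrow> bool" where
  "harnack D A \<longleftrightarrow> (\<forall>K. \<exists>K'. \<forall>f\<in>R_space D. \<forall>M. (\<forall>x\<in>points. f x \<le> M) \<longrightarrow>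
     (\<forall>y\<in>A. \<forall>z\<in>A. M - K \<le> f y \<longrightarrow> M - K' \<le> f z))"

lemma harnackE:
  assumes "harnack D A"
  obtains K' where "\<And>f M y z. f \<in> R_space D \<Longrightarrow> (\<And>x. x \<in> points \<Longrightarrow> f x \<le> M) \<Longrightarrow>
    y \<in> A \<Longrightarrow> z \<in> A \<Longrightarrow> M - K \<le> f y \<Longrightarrow> M - K' \<le> f z"
  using assms unfolding harnack_def by meson

lemma harnackI:
  assumes "\<And>K. \<exists>K'. \<forall>f M y z. f \<in> R_space D \<longrightarrow> (\<forall>x\<in>points. f x \<le> M) \<longrightarrow>
    y \<in> A \<longrightarrow> z \<in> A \<longrightarrow> M - K \<le> f y \<longrightarrow> M - K' \<le> f z"
  shows "harnack D A"
  using assms unfolding harnack_def by meson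

lemma harnack_subset: "harnack D A \<Longrightarrow> B \<subseteq> A \<Longrightarrow> harnack D B"
  unfolding harnack_def by (meson subsetD)

text \<open>The estimate passes through the common point \<open>c\<close>: a drop of at most
  \<open>K\<close> becomes at most \<open>K1\<close> or \<open>K2\<close> there, and this is the
  input for the other set.\<close>

lemma harnack_Un:
  assumes A: "harnack D A" and B: "harnack D B" and c: "c \<in> A" "c \<in> B"
  shows "harnack D (A \<union> B)"
proof (rule harnackI)
  fix K
  obtain K1 where K1: "\<And>f M y z. f \<in> R_space D \<Longrightarrow> (\<And>x. x \<in> points \<Longrightarrow> f x \<le> M) \<Longrightarrow>
    y \<in> A \<Longrightarrow> z \<in> A \<Longrightarrow> M - K \<le> f y \<Longrightarrow> M - K1 \<le> f z" by (rule harnackE[OF A, of K]) blast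
  obtain K2 where K2: "\<And>f M y z. f \<in> R_space D \<Longrightarrow> (\<And>x. x \<in> points \<Longrightarrow> f x \<le> M) \<Longrightarrow>
    y \<in> B \<Longrightarrow> z \<in> B \<Longrightarrow> M - K \<le> f y \<Longrightarrow> M - K2 \<le> f z" by (rule harnackE[OF B, of K]) blast
  obtain K3 where K3: "\<And>f M y z. f \<in> R_space D \<Longrightarrow> (\<And>x. x \<in> points \<Longrightarrow> f x \<le> M) \<Longrightarrow>
    y \<in> A \<Longrightarrow> z \<in> A \<Longrightarrow> M - K2 \<le> f y \<Longrightarrow> M - K3 \<le> f z" by (rule harnackE[OF A, of K2]) blast
  obtain K4 where K4: "\<And>f M y z. f \<in> R_space D \<Longrightarrow> (\<And>x. x \<in> points \<Longrightarrow> f x \<le> M) \<Longrightarrow>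
    y \<in> B \<Longrightarrow> z \<in> B \<Longrightarrow> M - K1 \<le> f y \<Longrightarrow> M - K4 \<le> f z" by (rule harnackE[OF B, of K1]) blast
  have "M - max (max K1 K2) (max K3 K4) \<le> f z"
    if f: "f \<in> R_space D" and M: "\<And>x. x \<in> points \<Longrightarrow> f x \<le> M"
      and yz: "y \<in> A \<union> B" "z \<in> A \<union> B" "M - K \<le> f y" for f M y z
  proof -
    have "(M - K1 \<le> f c \<and> y \<in> A) \<or> (M - K2 \<le> f c \<and> y \<in> B)"
      using K1[OF f M _ c(1) yz(3)] K2[OF f M _ c(2) yz(3)] yz(1) by blast
    then have "M - K1 \<le> f z \<or> M - K2 \<le> f z \<or> M - K3 \<le> f z \<or> M - K4 \<le> f z"
      using K1[OF f M _ _ yz(3), of z] K2[OF f M _ _ yz(3), of z] K3[OF f M c(1), of z]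
        K4[OF f M c(2), of z] yz(2) by blast
    then show ?thesis by linarith
  qed
  then show "\<exists>K'. \<forall>f M y z. f \<in> R_space D \<longrightarrow> (\<forall>x\<in>points. f x \<le> M) \<longrightarrow>
    y \<in> A \<union> B \<longrightarrow> z \<in> A \<union> B \<longrightarrow> M - K \<le> f y \<longrightarrow> M - K' \<le> f z" by blast
qed

text \<open>The outgoing slopes at \<open>x\<close> add up to at least \<open>- D x\<close>, so if
  none of them is large, none can be very negative.\<close>

lemma R_space_slope_lower:
  fixes c :: real
  assumes f: "f \<in> R_space D" and b: "(e, t, d) \<in> dirs x"
    and up: "\<And>e t d. (e, t, d) \<in> dirs x \<Longrightarrow> of_int (slope f e t d) \<le> c" and c: "0 \<le> c"
  shows "- (\<bar>of_int (D x)\<bar> + card (dirs x) * c) \<le> of_int (slope f e t d)"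
proof -
  have x: "x \<in> points" by (rule dirs_in_points[OF b])
  have fin: "finite (dirs x)" by (rule finite_dirs[OF x])
  define \<sigma> :: "'e \<times> real \<times> real \<Rightarrow> real" where "\<sigma> b = (case b of (e, t, d) \<Rightarrow> of_int (slope f e t d))" for b
  have "0 \<le> D x + div_of f x" using f by (auto simp: R_space_def effective_def)
  then have "0 \<le> D x + (\<Sum>(e, t, d)\<in>dirs x. slope f e t d)"
    using x by (simp add: div_of_def ord_at_dirs)
  then have "(0::real) \<le> of_int (D x + (\<Sum>(e, t, d)\<in>dirs x. slope f e t d))" by (simp only: of_int_0_le_iff)
  then have "0 \<le> of_int (D x) + sum \<sigma> (dirs x)"
    by (simp add: \<sigma>_def split_beta)
  also have "sum \<sigma> (dirs x) = \<sigma> (e, t, d) + sum \<sigma> (dirs x - {(e, t, d)})"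
    by (rule sum.remove[OF fin b])
  also have "sum \<sigma> (dirs x - {(e, t, d)}) \<le> of_nat (card (dirs x - {(e, t, d)})) * c"
    by (rule sum_bounded_above) (use up in \<open>auto simp: \<sigma>_def\<close>)
  also have "\<dots> \<le> card (dirs x) * c"
    using c fin by (auto intro!: mult_right_mono card_mono)
  finally show ?thesis by (simp add: \<sigma>_def)
qed

text \<open>Convexity along an arm carries closeness to \<open>M\<close> from \<open>y\<close> to
  the centre. There the values at the arm ends, bounded by \<open>M\<close>, cap the outgoing slopes
  from above, the divisor then caps them from below, and the tangents at the centre bound
  \<open>f\<close> on all arms.\<close>

lemma harnack_star:
  assumes D: "is_divisor D" and x: "x \<in> points"
  obtains \<delta> where "0 < \<delta>"
    "harnack D (insert x {edge_pt e (t + d * s) | e t d s. (e, t, d) \<in> dirs x \<and> 0 \<le> s \<and> s \<le> \<delta>})"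
proof -
  obtain \<delta> where \<delta>: "0 < \<delta>" "\<And>e t d s. (e, t, d) \<in> dirs x \<Longrightarrow> 0 < s \<Longrightarrow> s \<le> \<delta> \<Longrightarrow>
    0 < t + d * s \<and> t + d * s < len e \<and> D (edge_pt e (t + d * s)) = 0"
    by (rule divisor_star[OF D x]) blast
  \<comment> \<open>On a half arm the end is at least as far away as the centre, so a nonnegative
    slope at \<open>y\<close> costs no more on the way to \<open>x\<close> than it gains on the way
    to the end.\<close>
  define A where "A = insert x {edge_pt e (t + d * s) | e t d s. (e, t, d) \<in> dirs x \<and> 0 \<le> s \<and> s \<le> \<delta> / 2}"
  have "harnack D A"
  proof (rule harnackI)
    fix K
    \<comment> \<open>The drop at the centre is at most \<open>2 * \<bar>K\<bar>\<close>; divided by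
      the arm length it gives the upper slope bound \<open>c\<close>, which entails the lower bound
      \<open>- B\<close>. The term \<open>\<delta> * B\<close> is the further loss along an
      arm.\<close>
    define c where "c = 2 * \<bar>K\<bar> / \<delta>"
    have "0 \<le> c" using \<delta>(1) by (simp add: c_def)
    define B where "B = \<bar>of_int (D x)\<bar> + card (dirs x) * c"
    have "0 \<le> B" using \<open>0 \<le> c\<close> by (simp add: B_def)
    define K' where "K' = 2 * \<bar>K\<bar> + \<delta> * B"
    have "M - K' \<le> f z"
      if f: "f \<in> R_space D" and M: "\<And>x. x \<in> points \<Longrightarrow> f x \<le> M"
        and yz: "y \<in> A" "z \<in> A" "M - K \<le> f y" for f M y z
    proof -
      have Mx: "f x \<le> M" by (rule M[OF x])
      have Mb: "f (edge_pt e u) \<le> M" if "(e, t, d) \<in> dirs x" for e t d u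
        by (rule M[OF edge_pt_in_points[OF dirsD(1)[OF that]]])
      have tangent: "f (edge_pt e (t + d * s)) + of_int (slope f e (t + d * s) d) * (u - s)
          \<le> f (edge_pt e (t + d * u))"
        if b: "(e, t, d) \<in> dirs x" and "0 \<le> s" "s < \<delta>" "0 \<le> u" "u \<le> \<delta>" for e t d s u
        by (rule R_space_tangent[OF f b \<delta>(2)[OF b] that(2-5)])
      have fx: "M - 2 * \<bar>K\<bar> \<le> f x"
      proof (cases "y = x")
        case False
        then obtain e t d s where b: "(e, t, d) \<in> dirs x" "0 \<le> s" "s \<le> \<delta> / 2"
          and y: "y = edge_pt e (t + d * s)" using yz(1) by (auto simp: A_def)
        define m where "m = (of_int (slope f e (t + d * s) d) :: real)"
        have "f y + m * (0 - s) \<le> f x" "f y + m * (\<delta> - s) \<le> M"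
          using tangent[OF b(1), of s 0]
            tangent[OF b(1), of s \<delta>] Mb[OF b(1), of "t + d * \<delta>"]
            b \<delta>(1) y dirsD(4)[OF b(1)] by (auto simp: m_def)
        moreover have "m * s \<le> \<bar>K\<bar>"
        proof (cases "0 \<le> m")
          case True
          then have "m * s \<le> m * (\<delta> - s)" using b by (intro mult_left_mono) auto
          then show ?thesis using \<open>f y + m * (\<delta> - s) \<le> M\<close> yz(3) by linarith
        next
          case False
          then have "m * s \<le> 0" using b by (simp add: mult_nonpos_nonneg)
          then show ?thesis by linarith
        qed
        ultimately show ?thesis using yz(3) by auto
      qed (use yz(3) in auto)
      have up: "of_int (slope f e t d) \<le> c" if b: "(e, t, d) \<in> dirs x" for e t d
      proof -
        have "f x + of_int (slope f e t d) * \<delta> \<le> M"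
          using tangent[OF b, of 0 \<delta>] Mb[OF b, of "t + d * \<delta>"] \<delta>(1) dirsD(4)[OF b]
          by simp
        then have "of_int (slope f e t d) * \<delta> \<le> 2 * \<bar>K\<bar>" using fx by linarith
        then show ?thesis using \<delta>(1) by (simp add: c_def pos_le_divide_eq)
      qed
      show ?thesis
      proof (cases "z = x")
        case True
        have "0 \<le> \<delta> * B" using \<delta>(1) \<open>0 \<le> B\<close> by simp
        then show ?thesis using fx True unfolding K'_def by simp
      next
        case False
        then obtain e t d s where b: "(e, t, d) \<in> dirs x" "0 \<le> s" "s \<le> \<delta> / 2"
          and z: "z = edge_pt e (t + d * s)" using yz(2) by (auto simp: A_def)
        define m where "m = (of_int (slope f e t d) :: real)"
        have "- B \<le> m" unfolding B_def m_def by (rule R_space_slope_lower[OF f b(1) up \<open>0 \<le> c\<close>])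
        have "f x + m * s \<le> f z"
          using tangent[OF b(1), of 0 s] b \<delta>(1) z dirsD(4)[OF b(1)]
          by (simp add: m_def)
        moreover have "- (\<delta> * B) \<le> m * s"
        proof -
          have "B * s \<le> B * \<delta>" using b \<delta>(1) \<open>0 \<le> B\<close> by (intro mult_left_mono) auto
          moreover have "- B * s \<le> m * s" using \<open>- B \<le> m\<close> b(2) by (rule mult_right_mono)
          ultimately show ?thesis by (simp add: mult.commute)
        qed
        ultimately show ?thesis using fx unfolding K'_def by linarith
      qed
    qed
    then show "\<exists>K'. \<forall>f M y z. f \<in> R_space D \<longrightarrow> (\<forall>x\<in>points. f x \<le> M) \<longrightarrow>
      y \<in> A \<longrightarrow> z \<in> A \<longrightarrow> M - K \<le> f y \<longrightarrow> M - K' \<le> f z" by blast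
  qed
  then show thesis using that[of "\<delta> / 2"] \<delta>(1) unfolding A_def by simp
qed

text \<open>Every point of the edge has a star on which the estimate holds. Adjacent intervals share
  a point, so \<open>Bolzano\<close> extends it to the whole edge.\<close>

lemma harnack_edge:
  assumes D: "is_divisor D" and e: "e \<in> arcs G"
  shows "harnack D (edge_pt e ` {0..len e})"
proof -
  define P where "P a b \<longleftrightarrow> (0 \<le> a \<longrightarrow> b \<le> len e \<longrightarrow> harnack D (edge_pt e ` {a..b}))" for a b
  have "0 \<le> len e" using len_pos[OF e] by simp
  then have "P 0 (len e)"
  proof (induct rule: Bolzano)
    case (trans a b c)
    show ?case unfolding P_def
    proof (intro impI)
      assume *: "0 \<le> a" "c \<le> len e"
      have "harnack D (edge_pt e ` {a..b} \<union> edge_pt e ` {b..c})"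
        by (rule harnack_Un[of _ _ _ "edge_pt e b"]) (use trans * in \<open>auto simp: P_def\<close>)
      moreover have "{a..c} = {a..b} \<union> {b..c}" using trans by auto
      ultimately show "harnack D (edge_pt e ` {a..c})" by (simp add: image_Un)
    qed
  next
    case (local x)
    obtain \<delta> where \<delta>: "0 < \<delta>"
      "harnack D (insert (edge_pt e x) {edge_pt e' (t + d * s) | e' t d s.
        (e', t, d) \<in> dirs (edge_pt e x) \<and> 0 \<le> s \<and> s \<le> \<delta>})"
      by (rule harnack_star[OF D edge_pt_in_points[OF e, of x]]) blast
    have "P a b" if ab: "a \<le> x" "x \<le> b" "b - a < \<delta>" for a b
      unfolding P_def
    proof (intro impI)
      assume *: "0 \<le> a" "b \<le> len e"
      show "harnack D (edge_pt e ` {a..b})"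
      proof (rule harnack_subset[OF \<delta>(2)], rule image_subsetI)
        fix u assume u: "u \<in> {a..b}"
        consider "u = x" | "x < u" | "u < x" by linarith
        then show "edge_pt e u \<in> insert (edge_pt e x) {edge_pt e' (t + d * s) | e' t d s.
            (e', t, d) \<in> dirs (edge_pt e x) \<and> 0 \<le> s \<and> s \<le> \<delta>}"
        proof cases
          case 2
          then have "(e, x, 1) \<in> dirs (edge_pt e x)" using e u ab * by (simp add: dirs_def)
          then have "\<exists>e' t d s. edge_pt e u = edge_pt e' (t + d * s) \<and>
              (e', t, d) \<in> dirs (edge_pt e x) \<and> 0 \<le> s \<and> s \<le> \<delta>"
            using 2 u ab by (intro exI[of _ e] exI[of _ x] exI[of _ 1] exI[of _ "u - x"]) simp
          then show ?thesis by blast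
        next
          case 3
          then have "(e, x, - 1) \<in> dirs (edge_pt e x)" using e u ab * by (simp add: dirs_def)
          then have "\<exists>e' t d s. edge_pt e u = edge_pt e' (t + d * s) \<and>
              (e', t, d) \<in> dirs (edge_pt e x) \<and> 0 \<le> s \<and> s \<le> \<delta>"
            using 3 u ab by (intro exI[of _ e] exI[of _ x] exI[of _ "- 1"] exI[of _ "x - u"]) simp
          then show ?thesis by blast
        qed simp
      qed
    qed
    then show ?case using \<delta>(1) by blast
  qed
  then show ?thesis by (simp add: P_def)
qed

lemma harnack_singleton: "harnack D {x}"
  unfolding harnack_def by blast

text \<open>Connectedness of the graph enters the estimate here, by induction along a walk in the
  symmetrised graph.\<close>

lemma harnack_vertices:
  assumes D: "is_divisor D" and v: "v \<in> verts G" "w \<in> verts G"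
  shows "harnack D {Vertex v, Vertex w}"
proof -
  have arc: "harnack D {Vertex a, Vertex b}" if "(a, b) \<in> arcs_ends (with_proj (mk_symmetric G))" for a b
  proof -
    have "(a, b) \<in> parcs (mk_symmetric G)"
      using that by (simp add: arcs_ends_conv)
    then obtain e where e: "e \<in> arcs G" "{a, b} = {tail G e, head G e}"
      unfolding parcs_mk_symmetric by auto
    have "{Vertex a, Vertex b} = (Vertex ` {a, b} :: ('v, 'e) curve_point set)" by simp
    also have "\<dots> = {edge_pt e 0, edge_pt e (len e)}" using e by simp
    also have "\<dots> \<subseteq> edge_pt e ` {0..len e}"
    proof -
      have "0 \<in> {0..len e}" "len e \<in> {0..len e}" using len_pos[OF e(1)] by auto
      then show ?thesis by blast
    qed
    finally show ?thesis by (rule harnack_subset[OF harnack_edge[OF D e(1)]])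
  qed
  have "(v, w) \<in> rtrancl_on (verts (with_proj (mk_symmetric G))) (arcs_ends (with_proj (mk_symmetric G)))"
    using connected_curve v
    unfolding Digraph_Component.connected_def strongly_connected_def reachable_def by simp
  then show ?thesis
  proof (induct rule: rtrancl_on_induct)
    case base then show ?case by (simp add: harnack_singleton)
  next
    case (step y z)
    have "harnack D ({Vertex v, Vertex y} \<union> {Vertex y, Vertex z})"
      by (rule harnack_Un[OF step(5) arc[OF step(2)], of "Vertex y"]) auto
    then show ?case by (rule harnack_subset) auto
  qed
qed

lemma harnack_points:
  assumes D: "is_divisor D"
  shows "harnack D points"
proof -
  obtain v0 where v0: "v0 \<in> verts G" using points_nonempty by blast
  \<comment> \<open>Every piece is enlarged by the base vertex \<open>v0\<close>, so that all pieces
    share a point and \<open>harnack_Un\<close> applies.\<close>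
  have fin_Un: "harnack D (insert (Vertex v0) (\<Union>i\<in>I. A i))"
    if "finite I" "\<And>i. i \<in> I \<Longrightarrow> harnack D (insert (Vertex v0) (A i))" for A :: "'i \<Rightarrow> _" and I
    using that
  proof (induct I rule: finite_induct)
    case empty then show ?case by (simp add: harnack_singleton)
  next
    case (insert i I)
    have "harnack D (insert (Vertex v0) (A i) \<union> insert (Vertex v0) (\<Union>i\<in>I. A i))"
      by (rule harnack_Un[of _ _ _ "Vertex v0"]) (use insert in auto)
    then show ?case by (rule harnack_subset) auto
  qed
  have 1: "harnack D (insert (Vertex v0) (\<Union>v\<in>verts G. {Vertex v}))"
    by (rule fin_Un) (use harnack_vertices[OF D v0] in auto)
  have 2: "harnack D (insert (Vertex v0) (\<Union>e\<in>arcs G. edge_pt e ` {0..len e}))"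
  proof (rule fin_Un)
    fix e assume e: "e \<in> arcs G"
    have "Vertex (tail G e) \<in> edge_pt e ` {0..len e}"
      using len_pos[OF e] by (intro image_eqI[of _ _ 0]) auto
    then have "harnack D ({Vertex v0, Vertex (tail G e)} \<union> edge_pt e ` {0..len e})"
      using e by (intro harnack_Un[of _ _ _ "Vertex (tail G e)"] harnack_vertices[OF D v0] harnack_edge[OF D]) auto
    then show "harnack D (insert (Vertex v0) (edge_pt e ` {0..len e}))"
      by (rule harnack_subset) auto
  qed simp
  have "harnack D (insert (Vertex v0) (\<Union>v\<in>verts G. {Vertex v}) \<union>
      insert (Vertex v0) (\<Union>e\<in>arcs G. edge_pt e ` {0..len e}))"
    by (rule harnack_Un[OF 1 2, of "Vertex v0"]) auto
  then show ?thesis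
    by (rule harnack_subset) (auto simp: closed_edge_cover)
qed

text \<open>The Harnack estimate is used with \<open>K = 0\<close>, starting from a point where
  \<open>f\<close> attains its maximum \<open>M\<close>.\<close>

lemma R_space_oscillation:
  assumes "is_divisor D"
  obtains K where "\<And>f x y. f \<in> R_space D \<Longrightarrow> x \<in> points \<Longrightarrow> y \<in> points \<Longrightarrow> f x - f y \<le> K"
proof -
  obtain K where K: "\<And>f M y z. f \<in> R_space D \<Longrightarrow> (\<And>x. x \<in> points \<Longrightarrow> f x \<le> M) \<Longrightarrow>
    y \<in> points \<Longrightarrow> z \<in> points \<Longrightarrow> M - 0 \<le> f y \<Longrightarrow> M - K \<le> f z"
    by (rule harnackE[OF harnack_points[OF assms], of 0]) blast
  have "f x - f y \<le> K" if f: "f \<in> R_space D" and xy: "x \<in> points" "y \<in> points" for f x y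
  proof -
    have "rational_function f" using f by (simp add: R_space_def)
    then obtain m where m: "m \<in> points" "\<And>z. z \<in> points \<Longrightarrow> f z \<le> f m"
      by (rule rational_function_attains_max) blast
    have "f m - K \<le> f y" by (rule K[OF f m(2) m(1) xy(2)]) auto
    then show ?thesis using m(2)[OF xy(1)] by linarith
  qed
  then show thesis by (rule that)
qed


subsection \<open>Extremal functions\<close>

text \<open>Near \<open>x\<close> the functions of \<open>R_space D\<close> are convex with integer slopes bounded uniformly, so their
  supremum is the maximum of finitely many lines: for each slope \<open>m\<close> the highest line that lies
  below one of them.\<close>

lemma R_space_sup_germ:
  assumes D: "is_divisor D" and P: "P \<in> points" and f0: "f0 \<in> R_space D"
    and b: "(e, t, d) \<in> dirs x"
  defines "F \<equiv> \<lambda>x. SUP f\<in>R_space D. f x - f P"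
  shows "\<exists>m::int. germ (\<lambda>u. F (edge_pt e u)) t d m"
proof -
  note Db = dirsD[OF b]
  have x: "x \<in> points" by (rule dirs_in_points[OF b])
  obtain K where K: "\<And>f x y. f \<in> R_space D \<Longrightarrow> x \<in> points \<Longrightarrow> y \<in> points \<Longrightarrow> f x - f y \<le> K"
    by (rule R_space_oscillation[OF D]) blast
  have "0 \<le> K" using K[OF f0 P P] by simp
  obtain \<delta> where \<delta>: "0 < \<delta>" "\<And>e t d s. (e, t, d) \<in> dirs x \<Longrightarrow> 0 < s \<Longrightarrow> s \<le> \<delta> \<Longrightarrow>
    0 < t + d * s \<and> t + d * s < len e \<and> D (edge_pt e (t + d * s)) = 0"
    by (rule divisor_star[OF D x]) blast
  have tangent: "f (edge_pt e (t + d * s)) + of_int (slope f e (t + d * s) d) * (u - s)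
      \<le> f (edge_pt e (t + d * u))"
    if "f \<in> R_space D" and b: "(e, t, d) \<in> dirs x" and "0 \<le> s" "s < \<delta>" "0 \<le> u" "u \<le> \<delta>"
    for f e t d s u
    by (rule R_space_tangent[OF that(1) b \<delta>(2)[OF b] that(3-6)])
  define p where "p s = edge_pt e (t + d * s)" for s
  have p_points: "p s \<in> points" for s unfolding p_def by (rule edge_pt_in_points[OF Db(1)])
  have p0: "p 0 = x" using Db(4) by (simp add: p_def)
  define c where "c = K / \<delta>"
  have "0 \<le> c" using \<open>0 \<le> K\<close> \<delta>(1) by (simp add: c_def)
  define B where "B = \<bar>of_int (D x)\<bar> + card (dirs x) * c"
  \<comment> \<open>\<open>- B\<close> bounds the slope at the centre from below. The bound
    \<open>2 * K / \<delta>\<close> from above holds because the end of the arm is at least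
    \<open>\<delta> / 2\<close> away and at most \<open>K\<close> higher.\<close>
  define N where "N = \<lceil>max B (2 * K / \<delta>)\<rceil>"
  have N: "B \<le> of_int N" "2 * K / \<delta> \<le> of_int N" unfolding N_def by linarith+
  have slope_bound: "slope f e (t + d * s) d \<in> {- N..N}"
    if f: "f \<in> R_space D" and s: "0 \<le> s" "s < \<delta> / 2" for f s
  proof -
    define m where "m = (of_int (slope f e (t + d * s) d) :: real)"
    have tan: "f (p s) + m * (u - s) \<le> f (p u)" if "0 \<le> u" "u \<le> \<delta>" for u
      using tangent[OF f b, of s u] s \<delta>(1) that by (simp add: m_def p_def)
    have "m \<le> 2 * K / \<delta>"
    proof (cases "0 \<le> m")
      case True
      have "m * (\<delta> / 2) \<le> m * (\<delta> - s)" using s True by (intro mult_left_mono) auto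
      also have "\<dots> \<le> K" using tan[of \<delta>] K[OF f p_points p_points, of \<delta> s] \<delta>(1) by simp
      finally show ?thesis using \<delta>(1) by (simp add: field_simps)
    next
      case False
      then show ?thesis using \<open>0 \<le> K\<close> \<delta>(1) by (smt (verit) divide_nonneg_pos)
    qed
    then have up: "slope f e (t + d * s) d \<le> N" using N(2) unfolding m_def by linarith
    have "of_int (slope f e' t' d') \<le> c" if b': "(e', t', d') \<in> dirs x" for e' t' d'
    proof -
      have "f x + of_int (slope f e' t' d') * \<delta> \<le> f (edge_pt e' (t' + d' * \<delta>))"
        using tangent[OF f b', of 0 \<delta>] \<delta>(1) dirsD(4)[OF b'] by simp
      also have "\<dots> \<le> K + f x"
        using K[OF f edge_pt_in_points[OF dirsD(1)[OF b']] x, of "t' + d' * \<delta>"] by linarith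
      finally show ?thesis using \<delta>(1) by (simp add: c_def pos_le_divide_eq)
    qed
    then have low: "- B \<le> of_int (slope f e t d)"
      unfolding B_def by (rule R_space_slope_lower[OF f b _ \<open>0 \<le> c\<close>])
    \<comment> \<open>Slopes increase along the arm: compare the tangents at the centre and at
      \<open>p s\<close>, each evaluated at the foot of the other.\<close>
    have "of_int (slope f e t d) \<le> m"
    proof (cases "s = 0")
      case False
      then have "0 < s" using s by simp
      have "f x + of_int (slope f e t d) * s \<le> f (p s)"
        using tangent[OF f b, of 0 s] s \<delta>(1) Db(4) by (simp add: p_def)
      moreover have "f (p s) + m * (0 - s) \<le> f x" using tan[of 0] \<delta>(1) p0 by simp
      ultimately have "of_int (slope f e t d) * s \<le> m * s" by simp
      then show ?thesis using \<open>0 < s\<close> by simp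
    qed (simp add: m_def)
    then have "- N \<le> slope f e (t + d * s) d" using low N(1) unfolding m_def by linarith
    then show ?thesis using up by simp
  qed
  define S where "S m = {c. \<exists>f\<in>R_space D. \<forall>u. 0 \<le> u \<longrightarrow> u < \<delta> / 2 \<longrightarrow> of_int m * u + c \<le> f (p u) - f P}"
    for m :: int
  have S_bdd: "bdd_above (S m)" for m
  proof (rule bdd_aboveI)
    fix c assume "c \<in> S m"
    then obtain f where f: "f \<in> R_space D" "\<And>u. 0 \<le> u \<Longrightarrow> u < \<delta> / 2 \<Longrightarrow> of_int m * u + c \<le> f (p u) - f P"
      unfolding S_def by blast
    show "c \<le> K" using f(2)[of 0] K[OF f(1) p_points P, of 0] \<delta>(1) by simp
  qed
  \<comment> \<open>Every slope admits a line below \<open>f0\<close> if its intercept is low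
    enough, so \<open>C m\<close> is a genuine supremum for every \<open>m\<close>.\<close>
  have S_ne: "S m \<noteq> {}" for m
  proof -
    have "of_int m * u + (- K - \<bar>of_int m\<bar> * \<delta>) \<le> f0 (p u) - f0 P" if "0 \<le> u" "u < \<delta> / 2" for u
    proof -
      have "of_int m * u \<le> \<bar>of_int m\<bar> * u" using that by (intro mult_right_mono) auto
      also have "\<dots> \<le> \<bar>of_int m\<bar> * \<delta>" using that by (intro mult_left_mono) auto
      finally show ?thesis using K[OF f0 P p_points, of u] by linarith
    qed
    then show ?thesis unfolding S_def using f0 by blast
  qed
  have F_bdd: "bdd_above ((\<lambda>f. f y - f P) ` R_space D)" if "y \<in> points" for y
    using K[OF _ that P] by (auto intro!: bdd_aboveI)
  define C where "C m = Sup (S m)" for m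
  have below: "of_int m * s + C m \<le> F (p s)" if "0 \<le> s" "s < \<delta> / 2" for m s
  proof -
    have "C m \<le> F (p s) - of_int m * s"
      unfolding C_def
    proof (rule cSup_least[OF S_ne])
      fix c assume "c \<in> S m"
      then obtain f where f: "f \<in> R_space D" "\<And>u. 0 \<le> u \<Longrightarrow> u < \<delta> / 2 \<Longrightarrow> of_int m * u + c \<le> f (p u) - f P"
        unfolding S_def by blast
      have "f (p s) - f P \<le> F (p s)"
        unfolding F_def by (rule cSUP_upper[OF f(1) F_bdd[OF p_points]])
      then show "c \<le> F (p s) - of_int m * s" using f(2)[OF that] by simp
    qed
    then show ?thesis by simp
  qed
  have attained: "\<exists>m\<in>{- N..N}. F (p s) = of_int m * s + C m" if s: "0 \<le> s" "s < \<delta> / 2" for s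
  proof -
    define V where "V = (\<lambda>m. of_int m * s + C m) ` {- N..N}"
    have "finite V" by (simp add: V_def)
    have "V \<noteq> {}" using slope_bound[OF f0 s] by (auto simp: V_def)
    have "F (p s) \<le> Max V"
      unfolding F_def
    proof (rule cSUP_least)
      show "R_space D \<noteq> {}" using f0 by blast
      fix f assume f: "f \<in> R_space D"
      \<comment> \<open>The tangent of \<open>f\<close> at \<open>p s\<close> has one of the
        finitely many slopes and stays below \<open>f\<close> on the half arm, so its intercept
        belongs to \<open>S m\<close>.\<close>
      define m where "m = slope f e (t + d * s) d"
      have m: "m \<in> {- N..N}" unfolding m_def by (rule slope_bound[OF f s])
      have "of_int m * u + (f (p s) - f P - of_int m * s) \<le> f (p u) - f P"
        if "0 \<le> u" "u < \<delta> / 2" for u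
        using tangent[OF f b, of s u] s \<delta>(1) that by (simp add: m_def p_def algebra_simps)
      then have "f (p s) - f P - of_int m * s \<in> S m" unfolding S_def using f by blast
      then have "f (p s) - f P - of_int m * s \<le> C m" unfolding C_def by (rule cSup_upper[OF _ S_bdd])
      then have "f (p s) - f P \<le> of_int m * s + C m" by simp
      also have "\<dots> \<le> Max V" using m \<open>finite V\<close> by (intro Max_ge) (auto simp: V_def)
      finally show "f (p s) - f P \<le> Max V" .
    qed
    moreover obtain m where "m \<in> {- N..N}" "Max V = of_int m * s + C m"
      using Max_in[OF \<open>finite V\<close> \<open>V \<noteq> {}\<close>] by (auto simp: V_def)
    ultimately show ?thesis using below[OF s, of m] by (intro bexI[of _ m]) auto
  qed
  have "\<exists>m::int. germ (\<lambda>u. F (edge_pt e u)) t d m \<and>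
      (\<forall>k. (k, F (edge_pt e t)) \<in> (\<lambda>m. (m, C m)) ` {- N..N} \<longrightarrow> k \<le> m)"
  proof (rule germ_max_lines[where \<delta> = "\<delta> / 2"])
    show "(\<lambda>m. (m, C m)) ` {- N..N} \<noteq> {}" using slope_bound[OF f0, of 0] \<delta>(1) by auto
    show "of_int m * s + c \<le> F (edge_pt e (t + d * s))"
      if "(m, c) \<in> (\<lambda>m. (m, C m)) ` {- N..N}" "0 \<le> s" "s < \<delta> / 2" for m c s
      using below[of s m] that by (auto simp: p_def)
    show "\<exists>(m, c)\<in>(\<lambda>m. (m, C m)) ` {- N..N}. F (edge_pt e (t + d * s)) = of_int m * s + c"
      if "0 \<le> s" "s < \<delta> / 2" for s
      using attained[OF that] by (auto simp: p_def)
  qed (use \<delta>(1) in auto)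
  then show ?thesis by blast
qed

text \<open>The supremum, normalised at \<open>P\<close>, dominates by construction and has integer
  germs. Effectivity passes to it because an order is a sum of outgoing slopes, which can be
  compared one by one with those of a nearly optimal function.\<close>

lemma R_space_dominating_exists:
  assumes D: "is_divisor D" and P: "P \<in> points" and f0: "f0 \<in> R_space D"
  obtains F where "F \<in> R_space D"
    "\<And>g x. g \<in> R_space D \<Longrightarrow> x \<in> points \<Longrightarrow> g x - g P \<le> F x - F P"
proof -
  define F where "F = (\<lambda>x. SUP f\<in>R_space D. f x - f P)"
  obtain K where K: "\<And>f x y. f \<in> R_space D \<Longrightarrow> x \<in> points \<Longrightarrow> y \<in> points \<Longrightarrow> f x - f y \<le> K"
    by (rule R_space_oscillation[OF D]) blast
  have F_bdd: "bdd_above ((\<lambda>f. f y - f P) ` R_space D)" if "y \<in> points" for y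
    using K[OF _ that P] by (auto intro!: bdd_aboveI)
  have F_upper: "f y - f P \<le> F y" if "f \<in> R_space D" "y \<in> points" for f y
    unfolding F_def by (rule cSUP_upper[OF that(1) F_bdd[OF that(2)]])
  have "R_space D \<noteq> {}" using f0 by blast
  then have FP: "F P = 0" by (simp add: F_def)
  have rat: "rational_function F"
    unfolding rational_function_iff F_def using R_space_sup_germ[OF D P f0] by blast
  have "0 \<le> D x + div_of F x" for x
  proof (cases "x \<in> points")
    case False
    then have "D x = 0" using D unfolding is_divisor_def by blast
    then show ?thesis using False by (simp add: div_of_def)
  next
    case x: True
    obtain \<delta> where \<delta>: "0 < \<delta>" "\<And>e t d s. (e, t, d) \<in> dirs x \<Longrightarrow> 0 < s \<Longrightarrow> s \<le> \<delta> \<Longrightarrow>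
      0 < t + d * s \<and> t + d * s < len e \<and> D (edge_pt e (t + d * s)) = 0"
      by (rule divisor_star[OF D x]) blast
    obtain r where r: "0 < r" "\<And>e t d s. (e, t, d) \<in> dirs x \<Longrightarrow> 0 < s \<Longrightarrow> s < r \<Longrightarrow>
      F (edge_pt e (t + d * s)) = F x + of_int (slope F e t d) * s"
    proof (rule dirs_uniform_radius[OF x])
      fix e t d assume b: "(e, t, d) \<in> dirs x"
      show "\<forall>\<^sub>F s in at_right 0. F (edge_pt e (t + d * s)) = F x + of_int (slope F e t d) * s"
        using rational_germ[OF rat b] dirsD(4)[OF b] by (simp add: germ_def)
    qed blast
    \<comment> \<open>The same \<open>s\<close> serves as the distance walked and as the error
      allowed at \<open>x\<close>: an error below \<open>s\<close> over a distance \<open>s\<close>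
      changes a slope by less than \<open>1\<close>.\<close>
    define s where "s = min (r / 2) \<delta>"
    have s: "0 < s" "s < r" "s \<le> \<delta>" using r(1) \<delta>(1) by (auto simp: s_def)
    \<comment> \<open>\<open>f\<close> is below \<open>F\<close> and almost equal to it at \<open>x\<close>, so its integer slopes there do not exceed
      those of \<open>F\<close>.\<close>
    have "\<exists>f\<in>R_space D. F x - s < f x - f P"
      using less_cSUP_iff[OF _ F_bdd[OF x], of "F x - s"] f0 s(1) unfolding F_def by auto
    then obtain f where f: "f \<in> R_space D" "F x - s < f x - f P" by blast
    have le: "slope f e t d \<le> slope F e t d" if b: "(e, t, d) \<in> dirs x" for e t d
    proof -
      have "f x + of_int (slope f e t d) * s \<le> f (edge_pt e (t + d * s))"
        using R_space_tangent[OF f(1) b \<delta>(2)[OF b], of \<delta> 0 s] s \<delta>(1) dirsD(4)[OF b] by simp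
      also have "\<dots> \<le> F (edge_pt e (t + d * s)) + f P"
        using F_upper[OF f(1) edge_pt_in_points[OF dirsD(1)[OF b]], of "t + d * s"] by simp
      also have "\<dots> = F x + of_int (slope F e t d) * s + f P" using r(2)[OF b s(1,2)] by simp
      finally have "of_int (slope f e t d) * s < (of_int (slope F e t d) + 1) * s"
        using f(2) by (simp add: algebra_simps)
      then have "(of_int (slope f e t d) :: real) < of_int (slope F e t d) + 1" using s(1) by simp
      then show ?thesis by linarith
    qed
    have "0 \<le> D x + div_of f x" using f(1) by (simp add: R_space_def effective_def)
    also have "div_of f x = (\<Sum>(e, t, d)\<in>dirs x. slope f e t d)"
      using x by (simp add: div_of_def ord_at_dirs)
    also have "\<dots> \<le> (\<Sum>(e, t, d)\<in>dirs x. slope F e t d)"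
      by (rule sum_mono) (use le in auto)
    also have "\<dots> = div_of F x" using x by (simp add: div_of_def ord_at_dirs)
    finally show ?thesis by simp
  qed
  then have "F \<in> R_space D" using rat by (simp add: R_space_def effective_def)
  then show thesis using that F_upper FP by auto
qed

text \<open>If every boundary point of \<open>X\<close> had enough chips, one could fire \<open>X\<close>, that is, add the function
  \<open>- min \<epsilon> (dist X)\<close> to \<open>F\<close>; this would raise \<open>F\<close> on \<open>X\<close> relative to \<open>P\<close>. Adjoining the
  two points outside \<open>{0..len e}\<close> keeps the sets \<open>C e\<close> nonempty without changing this function.\<close>

lemma dominating_imp_reduced:
  assumes D: "is_divisor D" and P: "P \<in> points" and F: "F \<in> R_space D"
    and dom: "\<And>g x. g \<in> R_space D \<Longrightarrow> x \<in> points \<Longrightarrow> g x - g P \<le> F x - F P"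
  shows "reduced P (\<lambda>x. D x + div_of F x)"
  unfolding reduced_def
proof (intro conjI allI impI ballI)
  have ratF: "rational_function F" and effF: "\<And>v. 0 \<le> D v + div_of F v"
    using F by (auto simp: R_space_def effective_def)
  show "0 \<le> D v + div_of F v" for v by (rule effF)
  fix X assume X: "X \<noteq> {} \<and> closedin curve_topology X \<and> connectedin curve_topology X \<and> P \<notin> X"
  then have closed: "closedin curve_topology X" and conn: "connectedin curve_topology X"
    and "P \<notin> X" by auto
  have Xp: "X \<subseteq> points" using closed by (simp add: closedin_curve_iff)
  show "\<exists>v\<in>curve_topology frontier_of X. D v + div_of F v < int (outdeg X v)"
  proof (rule ccontr)
    assume "\<not> ?thesis"
    then have enough: "int (outdeg X v) \<le> D v + div_of F v" if "v \<in> curve_topology frontier_of X" for v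
      using that by force
    define C\<^sub>0 where "C\<^sub>0 e = {t \<in> {0..len e}. edge_pt e t \<in> X}" for e
    have C0_closed: "closed (C\<^sub>0 e)" if "e \<in> arcs G" for e
      using closed that by (simp add: closedin_curve_iff C\<^sub>0_def)
    \<comment> \<open>Marked are the coordinates where \<open>h\<close> must have reached its full
      depth \<open>- \<epsilon>\<close> if they are not in \<open>X\<close>: the ends of each edge,
      so that the edges fit together, and \<open>P\<close>. The coordinate of an inner
      \<open>P\<close> is marked on every edge, which can only make \<open>\<epsilon>\<close>
      smaller.\<close>
    define marks where "marks e = {0, len e} \<union> (case P of Vertex v \<Rightarrow> {} | Inner e' t \<Rightarrow> {t})" for e
    have "\<forall>\<^sub>F \<epsilon> in at_right 0. \<forall>(e, t)\<in>Sigma (arcs G) marks. t \<notin> C\<^sub>0 e \<longrightarrow> (\<forall>u\<in>C\<^sub>0 e. \<epsilon> \<le> dist t u)"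
    proof (rule eventually_ball_finite)
      show "finite (Sigma (arcs G) marks)"
        by (intro finite_SigmaI) (auto simp: marks_def split: curve_point.split)
      have "\<forall>\<^sub>F \<epsilon> in at_right 0. t \<notin> C\<^sub>0 e \<longrightarrow> (\<forall>u\<in>C\<^sub>0 e. \<epsilon> \<le> dist t u)" if e: "e \<in> arcs G" for e t
      proof (cases "t \<in> C\<^sub>0 e")
        case False
        then obtain r where r: "0 < r" "\<forall>u\<in>C\<^sub>0 e. r \<le> dist t u"
          using separate_point_closed[OF C0_closed[OF e]] by blast
        show ?thesis
          by (rule eventually_at_right_0I[OF r(1)]) (use r(2) in fastforce)
      qed simp
      then show "\<forall>y\<in>Sigma (arcs G) marks. \<forall>\<^sub>F \<epsilon> in at_right 0.
          case y of (e, t) \<Rightarrow> t \<notin> C\<^sub>0 e \<longrightarrow> (\<forall>u\<in>C\<^sub>0 e. \<epsilon> \<le> dist t u)" by auto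
    qed
    then obtain \<epsilon> where \<epsilon>: "0 < \<epsilon>"
      "\<forall>(e, t)\<in>Sigma (arcs G) marks. t \<notin> C\<^sub>0 e \<longrightarrow> (\<forall>u\<in>C\<^sub>0 e. \<epsilon> \<le> dist t u)"
      by (rule eventually_at_right_0_witness)
    define C where "C e = C\<^sub>0 e \<union> {- \<epsilon>, len e + \<epsilon>}" for e
    have C_closed: "closed (C e)" if "e \<in> arcs G" for e
      using C0_closed[OF that] unfolding C_def by (intro closed_Un) (auto intro: finite_imp_closed)
    have C_iff: "t \<in> C e \<longleftrightarrow> edge_pt e t \<in> X" if "0 \<le> t" "t \<le> len e" for e t
      using that \<epsilon>(1) by (auto simp: C_def C\<^sub>0_def)
    \<comment> \<open>Distance is measured within each edge separately. The choice of
      \<open>\<epsilon>\<close> makes this consistent: at a vertex outside \<open>X\<close> the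
      value is \<open>- \<epsilon>\<close> on every edge ending there.\<close>
    define \<psi> where "\<psi> e u = - min \<epsilon> (infdist u (C e))" for e u
    have \<psi>_in: "\<psi> e t = 0" if "t \<in> C e" for e t using that \<epsilon>(1) by (simp add: \<psi>_def)
    have \<psi>_far: "\<psi> e t = - \<epsilon>" if e: "e \<in> arcs G" and t: "t \<in> marks e" "0 \<le> t" "t \<le> len e" "edge_pt e t \<notin> X" for e t
    proof -
      have "t \<notin> C\<^sub>0 e" using t by (auto simp: C\<^sub>0_def)
      then have "\<forall>u\<in>C\<^sub>0 e. \<epsilon> \<le> dist t u" using \<epsilon>(2) e t(1) by blast
      then have "\<epsilon> \<le> dist t u" if "u \<in> C e" for u
        using that t(2,3) \<epsilon>(1) by (auto simp: C_def dist_real_def)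
      moreover have "C e \<noteq> {}" by (simp add: C_def)
      ultimately have "\<epsilon> \<le> infdist t (C e)"
        by (simp add: infdist_def cINF_greatest)
      then show ?thesis by (simp add: \<psi>_def)
    qed
    have \<psi>_range: "- \<epsilon> \<le> \<psi> e t" "\<psi> e t \<le> 0" for e t
      using infdist_nonneg[of t "C e"] \<epsilon>(1) by (auto simp: \<psi>_def)
    define h where "h x = (case x of Vertex v \<Rightarrow> if Vertex v \<in> X then 0 else - \<epsilon> | Inner e t \<Rightarrow> \<psi> e t)" for x
    have h_edge: "h (edge_pt e t) = \<psi> e t" if e: "e \<in> arcs G" and t: "0 \<le> t" "t \<le> len e" for e t
      using e t
    proof (cases rule: edge_pt_cases)
      case 1
      then show ?thesis using \<psi>_in[of t e] C_iff[OF t] \<psi>_far[OF e _ t] by (auto simp: h_def marks_def)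
    next
      case 2
      then show ?thesis using \<psi>_in[of t e] C_iff[OF t] \<psi>_far[OF e _ t] by (auto simp: h_def marks_def)
    next
      case 3
      then show ?thesis by (simp add: h_def)
    qed
    have h_range: "- \<epsilon> \<le> h x" for x
      using \<psi>_range(1) \<epsilon>(1) by (auto simp: h_def split: curve_point.split)
    have h_X: "h x = 0" if "x \<in> X" for x
    proof -
      have "x \<in> points" using that Xp by blast
      then show ?thesis
      proof (cases rule: points_cases)
        case (2 e t)
        then show ?thesis using \<psi>_in[of t e] C_iff[of t e] that by (simp add: h_def)
      qed (use that in \<open>simp add: h_def\<close>)
    qed
    have h_P: "h P = - \<epsilon>"
      using P
    proof (cases rule: points_cases)
      case (2 e t)
      then show ?thesis using \<psi>_far[of e t] \<open>P \<notin> X\<close> by (simp add: h_def marks_def)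
    qed (use \<open>P \<notin> X\<close> in \<open>simp add: h_def\<close>)
    have h_germ: "germ (\<lambda>u. h (edge_pt e u)) t d m \<longleftrightarrow> germ (\<psi> e) t d m" if b: "(e, t, d) \<in> dirs x" for e t d x m
    proof (rule germ_cong)
      show "\<forall>\<^sub>F s in at_right 0. h (edge_pt e (t + d * s)) = \<psi> e (t + d * s)"
        using dirs_eventually_inner[OF b] by eventually_elim (rule h_edge[OF dirsD(1)[OF b]]; simp)
      show "h (edge_pt e t) = \<psi> e t" by (rule h_edge[OF dirsD(1-3)[OF b]])
    qed
    \<comment> \<open>The adjoined points \<open>- \<epsilon>\<close> and
      \<open>len e + \<epsilon>\<close> put \<open>t\<close> into a gap of \<open>C e\<close> even
      at the ends of the edge.\<close>
    have outside: "\<exists>(m1::int) (m2::int). germ (\<psi> e) t 1 m1 \<and> germ (\<psi> e) t (- 1) m2 \<and> (0::int) \<le> m1 + m2"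
      if e: "e \<in> arcs G" and t: "0 \<le> t" "t \<le> len e" "edge_pt e t \<notin> X" for e t
      unfolding \<psi>_def
      by (rule neg_infdist_germs_outside[OF C_closed[OF e], of t "- \<epsilon>" "len e + \<epsilon>" \<epsilon>])
        (use t C_iff[OF t(1,2)] \<epsilon>(1) in \<open>auto simp: C_def\<close>)
    have inside: "germ (\<psi> e) t d (of_int (if (e, t, d) \<in> leaving X x then - 1 else 0))"
      if x: "x \<in> X" and b: "(e, t, d) \<in> dirs x" for e t d x
    proof -
      note Db = dirsD[OF b]
      have tC: "t \<in> C e" using C_iff[OF Db(2,3)] Db(4) x by simp
      show ?thesis
      proof (cases "(e, t, d) \<in> leaving X x")
        case False
        then have "\<not> (\<forall>\<^sub>F s in at_right 0. edge_pt e (t + d * s) \<notin> X)" using b by (simp add: leaving_def)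
        \<comment> \<open>Connectedness of \<open>X\<close> excludes directions that oscillate
          between \<open>X\<close> and its complement.\<close>
        then have "\<forall>\<^sub>F s in at_right 0. edge_pt e (t + d * s) \<in> X"
          using connectedin_direction_dichotomy[OF conn b] by blast
        then have "\<forall>\<^sub>F s in at_right 0. \<psi> e (t + d * s) = 0"
          using dirs_eventually_inner[OF b]
          by eventually_elim (rule \<psi>_in, simp add: C_iff)
        then show ?thesis using False \<psi>_in[OF tC] by (simp add: germ_def)
      next
        case True
        then have "\<forall>\<^sub>F s in at_right 0. edge_pt e (t + d * s) \<notin> X" by (simp add: leaving_def)
        then have ev: "\<forall>\<^sub>F s in at_right 0. t + d * s \<notin> C e"
          using dirs_eventually_inner[OF b] by eventually_elim (simp add: C_iff)
        obtain r where r: "0 < r" "\<And>s. 0 < s \<Longrightarrow> s < r \<Longrightarrow> t + d * s \<notin> C e"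
          by (rule eventually_at_right_0_obtain[OF ev]) blast
        have "germ (\<psi> e) t d (- 1)"
          unfolding germ_def
        proof (rule eventually_at_right_0I)
          show "0 < min (r / 2) \<epsilon>" using r(1) \<epsilon>(1) by simp
          fix s assume s: "0 < s" "s < min (r / 2) \<epsilon>"
          have "infdist (t + d * s) (C e) = s"
            by (rule infdist_germ_leaving[OF tC Db(5) r]) (use s in auto)
          then show "\<psi> e (t + d * s) = \<psi> e t + - 1 * s" using s \<psi>_in[OF tC] by (simp add: \<psi>_def)
        qed
        then show ?thesis using True by simp
      qed
    qed
    have rat: "rational_function h"
      unfolding rational_function_iff
    proof (clarify)
      fix x e t d assume b: "(e, t, d) \<in> dirs x"
      note Db = dirsD[OF b]
      show "\<exists>m::int. germ (\<lambda>u. h (edge_pt e u)) t d m"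
      proof (cases "x \<in> X")
        case True
        then show ?thesis using inside[OF True b] h_germ[OF b] by blast
      next
        case False
        then have "edge_pt e t \<notin> X" using Db(4) by simp
        then show ?thesis using outside[OF Db(1-3)] Db(5) h_germ[OF b] by blast
      qed
    qed
    have "0 \<le> D x + div_of F x + div_of h x" for x
    proof (cases "x \<in> points")
      case False
      then show ?thesis using effF[of x] by (simp add: div_of_def)
    next
      case xp: True
      have div_h: "div_of h x = (\<Sum>(e, t, d)\<in>dirs x. slope h e t d)"
        using xp by (simp add: div_of_def ord_at_dirs)
      show ?thesis
      proof (cases "x \<in> X")
        case True
        have "slope h e t d = (if (e, t, d) \<in> leaving X x then - 1 else 0)" if b: "(e, t, d) \<in> dirs x" for e t d
          by (rule slope_eq) (use inside[OF True b] h_germ[OF b] in blast)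
        then have "div_of h x = (\<Sum>b\<in>dirs x. if b \<in> leaving X x then - 1 else 0)"
          unfolding div_h by (intro sum.cong) auto
        also have "\<dots> = - int (card (leaving X x))"
        proof -
          have "leaving X x \<subseteq> dirs x" by (auto simp: leaving_def)
          then show ?thesis by (simp add: sum.If_cases[OF finite_dirs[OF xp]] Int_absorb1)
        qed
        finally have h_ord: "div_of h x = - int (card (leaving X x))" .
        show ?thesis
        proof (cases "x \<in> curve_topology frontier_of X")
          case True
          then show ?thesis using enough[OF True] h_ord outdeg_eq[OF xp] by simp
        next
          case False
          \<comment> \<open>Off the frontier a point of \<open>X\<close> is interior, so no
            direction leaves \<open>X\<close> there and \<open>h\<close> has order
            \<open>0\<close>.\<close>
          have "x \<in> curve_topology closure_of X"
            using \<open>x \<in> X\<close> closure_of_subset[of X curve_topology] Xp topspace_curve_topology by blast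
          then have int: "x \<in> curve_topology interior_of X" using False by (simp add: frontier_of_def)
          have "leaving X x = {}"
          proof (rule ccontr)
            assume "leaving X x \<noteq> {}"
            then obtain e t d where b: "(e, t, d) \<in> dirs x"
              and out: "\<forall>\<^sub>F s in at_right 0. edge_pt e (t + d * s) \<notin> X" by (auto simp: leaving_def)
            have "openin curve_topology (curve_topology interior_of X)" by simp
            then have "\<forall>\<^sub>F s in at_right 0. edge_pt e (t + d * s) \<in> curve_topology interior_of X"
              using int b unfolding openin_curve_iff_dirs by blast
            with out have "\<forall>\<^sub>F s in at_right (0::real). False"
              by eventually_elim (use interior_of_subset[of curve_topology X] in blast)
            then show False by simp
          qed
          then show ?thesis using h_ord effF[of x] by simp
        qed
      next
        case xX: False
        have "0 \<le> div_of h x"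
          using xp
        proof (cases rule: points_cases)
          \<comment> \<open>At a vertex outside \<open>X\<close> the function \<open>h\<close> takes
            its minimum \<open>- \<epsilon>\<close>, so every outgoing slope is nonnegative. Inner
            points rely on convexity of \<open>\<psi>\<close> instead.\<close>
          case (1 v)
          then have hx: "h x = - \<epsilon>" using xX by (simp add: h_def)
          have "0 \<le> slope h e t d" if b: "(e, t, d) \<in> dirs x" for e t d
          proof -
            have "(0::real) \<le> of_int (slope h e t d)"
              by (rule germ_ge[OF rational_germ[OF rat b]]) (use h_range hx dirsD(4)[OF b] in auto)
            then show ?thesis by simp
          qed
          then show ?thesis unfolding div_h by (intro sum_nonneg) auto
        next
          case (2 e t)
          then have b: "(e, t, 1) \<in> dirs x" "(e, t, - 1) \<in> dirs x" by (auto simp: dirs_Inner)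
          have "edge_pt e t \<notin> X" using xX 2 by simp
          then obtain m1 m2 :: int where m: "germ (\<psi> e) t 1 m1" "germ (\<psi> e) t (- 1) m2" "0 \<le> m1 + m2"
            using outside[of e t] 2 by auto
          have "slope h e t 1 = m1" "slope h e t (- 1) = m2"
            using m h_germ[OF b(1)] h_germ[OF b(2)] by (auto intro!: slope_eq)
          then show ?thesis using m(3) 2 unfolding div_h by (simp add: dirs_Inner)
        qed
        then show ?thesis using effF[of x] by simp
      qed
    qed
    then have "(\<lambda>x. F x + h x) \<in> R_space D"
      using rational_function_add[OF ratF rat]
      by (simp add: R_space_def effective_def div_of_add[OF ratF rat] add.assoc)
    moreover obtain x where x: "x \<in> X" using X by blast
    ultimately have "(F x + h x) - (F P + h P) \<le> F x - F P" using dom Xp by blast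
    then show False using h_X[OF x] h_P \<epsilon>(1) by simp
  qed
qed

subsection \<open>The map to reduced divisors\<close>

lemma div_of_eqI:
  assumes f: "rational_function f" and g: "rational_function g"
    and "\<And>x. x \<in> points \<Longrightarrow> f x - g x = c"
  shows "div_of f x = div_of g x"
  using div_of_const[of "\<lambda>x. f x - g x" c x] div_of_diff[OF f g, of x] assms(3) by simp

text \<open>This contains the uniqueness behind \<open>THE\<close>. A reduced \<open>D'\<close> is
  nonnegative away from \<open>P\<close>, which is what domination asks of the dominated function;
  domination in both directions makes the two functions differ by a constant.\<close>

lemma Red_eq:
  assumes D: "is_divisor D" and P: "P \<in> points" and f: "f \<in> R_space D"
    and red: "reduced P (\<lambda>x. D x + div_of f x)"
  shows "Red D P = (\<lambda>x. D x + div_of f x)"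
  unfolding Red_def
proof (rule the_equality)
  have rat: "rational_function f" using f by (simp add: R_space_def)
  then have "lin_equiv (\<lambda>x. D x + div_of f x) D" unfolding lin_equiv_def by (intro exI[of _ f]) simp
  then show "is_divisor (\<lambda>x. D x + div_of f x) \<and> lin_equiv (\<lambda>x. D x + div_of f x) D \<and>
      reduced P (\<lambda>x. D x + div_of f x)"
    using red is_divisor_add_div[OF D rat] by blast
  fix D' assume D': "is_divisor D' \<and> lin_equiv D' D \<and> reduced P D'"
  then obtain g where g: "rational_function g" "\<And>x. D' x - D x = div_of g x"
    unfolding lin_equiv_def by blast
  have eq: "D' = (\<lambda>x. D x + div_of g x)"
  proof
    show "D' x = D x + div_of g x" for x using g(2)[of x] by simp
  qed
  have red': "reduced P (\<lambda>x. D x + div_of g x)" using D' eq by simp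
  have "g x - f x = g P - f P" if x: "x \<in> points" for x
  proof -
    have "g x - g P \<le> f x - f P"
      by (rule reduced_dominates[OF rat g(1) P red _ x]) (use red' in \<open>auto simp: reduced_def\<close>)
    moreover have "f x - f P \<le> g x - g P"
      by (rule reduced_dominates[OF g(1) rat P red' _ x]) (use red in \<open>auto simp: reduced_def\<close>)
    ultimately show ?thesis by simp
  qed
  then have "div_of g x = div_of f x" for x by (rule div_of_eqI[OF g(1) rat])
  then show "D' = (\<lambda>x. D x + div_of f x)" using eq by simp
qed

text \<open>Nonnegative rank makes the least degree of an \<open>E\<close> with empty system
  positive, which rules out \<open>E = 0\<close>; so \<open>D\<close> itself is equivalent to an
  effective divisor.\<close>

lemma R_space_nonempty:
  assumes "divisor_rank D \<ge> 0"
  obtains f where "f \<in> R_space D"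
proof -
  let ?Q = "\<lambda>n. \<exists>E. is_divisor E \<and> effective E \<and> deg E = int n \<and> linear_system (\<lambda>x. D x - E x) = {}"
  have "0 < (LEAST n. ?Q n)" using assms by (simp add: divisor_rank_def)
  then have "\<not> ?Q 0" by (rule not_less_Least)
  moreover have "is_divisor (\<lambda>x. 0)" "effective (\<lambda>x. 0)" "deg (\<lambda>x. 0) = int 0"
    by (simp_all add: is_divisor_def effective_def deg_def)
  ultimately have "linear_system (\<lambda>x. D x - (\<lambda>x. 0) x) \<noteq> {}" by blast
  then obtain E where E: "effective E" "lin_equiv E D"
    unfolding linear_system_def by auto
  then obtain f where f: "rational_function f" "\<And>x. E x - D x = div_of f x"
    unfolding lin_equiv_def by blast
  have "D x + div_of f x = E x" for x using f(2)[of x] by simp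
  then have "f \<in> R_space D" using E(1) f(1) by (simp add: R_space_def)
  then show thesis by (rule that)
qed

lemma very_ample_iff_Red_inj:
  assumes D: "is_divisor D" and rank: "divisor_rank D \<ge> 0"
  shows "very_ample D \<longleftrightarrow> inj_on (Red D) points"
proof -
  obtain f0 where f0: "f0 \<in> R_space D" by (rule R_space_nonempty[OF rank])
  define good where "good P F \<longleftrightarrow> F \<in> R_space D \<and> Red D P = (\<lambda>x. D x + div_of F x) \<and>
    reduced P (\<lambda>x. D x + div_of F x) \<and>
    (\<forall>g\<in>R_space D. \<forall>x\<in>points. g x - g P \<le> F x - F P)" for P F
  define F where "F P = (SOME F. good P F)" for P
  have ex: "\<exists>F. good P F" if P: "P \<in> points" for P
  proof -
    obtain F where F: "F \<in> R_space D" "\<And>g x. g \<in> R_space D \<Longrightarrow> x \<in> points \<Longrightarrow> g x - g P \<le> F x - F P"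
      by (rule R_space_dominating_exists[OF D P f0]) blast
    have red: "reduced P (\<lambda>x. D x + div_of F x)" by (rule dominating_imp_reduced[OF D P F])
    show ?thesis unfolding good_def using F red Red_eq[OF D P F(1) red] by blast
  qed
  have "good P (F P)" if "P \<in> points" for P
    unfolding F_def by (rule someI_ex[OF ex[OF that]])
  then have F: "\<And>P. P \<in> points \<Longrightarrow> F P \<in> R_space D"
    and Red: "\<And>P. P \<in> points \<Longrightarrow> Red D P = (\<lambda>x. D x + div_of (F P) x)"
    and red: "\<And>P. P \<in> points \<Longrightarrow> reduced P (\<lambda>x. D x + div_of (F P) x)"
    and dom: "\<And>P g x. P \<in> points \<Longrightarrow> g \<in> R_space D \<Longrightarrow> x \<in> points \<Longrightarrow> g x - g P \<le> F P x - F P P"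
    unfolding good_def by blast+
  have rat: "rational_function f" and eff: "\<And>x. 0 \<le> D x + div_of f x" if "f \<in> R_space D" for f
    using that by (auto simp: R_space_def effective_def)
  show ?thesis
  proof
    assume va: "very_ample D"
    show "inj_on (Red D) points"
    proof (rule inj_onI, rule ccontr)
      fix P Q assume PQ: "P \<in> points" "Q \<in> points" "Red D P = Red D Q" "P \<noteq> Q"
      \<comment> \<open>As the two reduced divisors agree, \<open>F P\<close> is extremal from
        \<open>Q\<close> as well.\<close>
      have redQ: "reduced Q (\<lambda>x. D x + div_of (F P) x)"
        using red[OF PQ(2)] Red[OF PQ(1)] Red[OF PQ(2)] PQ(3) by simp
      have "g P - g Q = F P P - F P Q" if g: "g \<in> R_space D" for g
      proof -
        have "g P - g Q \<le> F P P - F P Q"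
          by (rule reduced_dominates[OF rat[OF F[OF PQ(1)]] rat[OF g] PQ(2) redQ eff[OF g] PQ(1)])
        then show ?thesis using dom[OF PQ(1) g PQ(2)] by simp
      qed
      moreover obtain f g where "f \<in> R_space D" "g \<in> R_space D" "f P - g P \<noteq> f Q - g Q"
        using va PQ unfolding very_ample_def by blast
      ultimately show False by (smt (verit))
    qed
  next
    assume inj: "inj_on (Red D) points"
    show "very_ample D"
      unfolding very_ample_def
    proof (intro ballI impI, rule ccontr)
      fix P Q assume PQ: "P \<in> points" "Q \<in> points" "P \<noteq> Q"
        and "\<not> (\<exists>f\<in>R_space D. \<exists>g\<in>R_space D. f P - g P \<noteq> f Q - g Q)"
      then have same: "F P P - F Q P = F P Q - F Q Q" using F[OF PQ(1)] F[OF PQ(2)] by blast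
      \<comment> \<open>By domination from \<open>P\<close> and from \<open>Q\<close>, the
        difference \<open>F P x - F Q x\<close> is smallest at \<open>x = P\<close> and largest at
        \<open>x = Q\<close>; \<open>same\<close> says that these two values coincide.\<close>
      have "F P x - F Q x = F P P - F Q P" if x: "x \<in> points" for x
        using dom[OF PQ(1) F[OF PQ(2)] x] dom[OF PQ(2) F[OF PQ(1)] x] same by simp
      then have "div_of (F P) x = div_of (F Q) x" for x
        by (rule div_of_eqI[OF rat[OF F[OF PQ(1)]] rat[OF F[OF PQ(2)]]])
      then have "Red D P = Red D Q" using Red PQ by simp
      then show False using inj PQ by (auto dest: inj_onD)
    qed
  qed
qed

end

theorem theorem6:
  fixes G :: "('v, 'e) pre_digraph" and len :: "'e \<Rightarrow> real"
    and D :: "('v, 'e) curve_point \<Rightarrow> int"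
  assumes "tropical_curve G len"
    and "tropical_curve.is_divisor G len D"
    and "tropical_curve.divisor_rank G len D \<ge> 0"
  shows "tropical_curve.very_ample G len D \<longleftrightarrow>
    inj_on (tropical_curve.Red G len D) (tropical_curve.points G len)"
  by (rule tropical_curve.very_ample_iff_Red_inj[OF assms])

end
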